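(* Let $(S,\Sigma,\mu)$ be a finite positive measure space, let $(E,\mathcal{E})$ be a measurable space, let $Z$ be a Banach space, and let $\boldsymbol{m}:\mathcal{E}\to L_0(\mu,Z)$ be a countably additive vector measure. Then $\boldsymbol{m}$ has a control measure, that is, there exists a finite positive measure $\nu$ on $\mathcal{E}$ such that, for every $A\in\mathcal{E}$, $\nu(A)=0$ implies $\boldsymbol{m}(A)=0$.
   Context: A measurable space $(E,\mathcal{E})$ is a set $E$ with a $\sigma$-algebra $\mathcal{E}$ of its subsets. A function $f:S\to Z$ is Bochner measurable (or $\mu$-measurable) if some sequence of $\Sigma$-simple $Z$-valued functions converges to $f$ $\mu$-a.e. on $S$. $L_0(\mu,Z)$ is the linear space of $\mu$-equivalence classes of Bochner measurable functions $S\to Z$, equipped with the topology $\tau_\mu$ of convergence in measure $\mu$, given by the $F$-norm $\|f\|_\mu=\inf\{\varepsilon>0:\mu(\{s:\|f(s)\|\ge\varepsilon\})\le\varepsilon\}$, where $\|\cdot\|$ is the norm of $Z$ (if needed, $\mu$ is replaced by the associated outer measure $A\mapsto\inf\{\mu(B):A\subset B\in\Sigma\}$). Countable additivity of $\boldsymbol{m}$ is with respect to $\tau_\mu$. *)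

theory Defs
  imports "HOL-Analysis.Analysis"
begin

text \<open>Since \<^term>\<open>borel_measurable\<close> is too weak a notion for a non-separable Banach space
  (almost separable range can fail), Bochner measurability is spelled out through simple functions.\<close>

definition bochner_measurable :: "'s measure \<Rightarrow> ('s \<Rightarrow> 'z::banach) \<Rightarrow> bool" where
  "bochner_measurable M f \<longleftrightarrow>
     (\<exists>u. (\<forall>n. simple_function M (u n)) \<and> (AE s in M. (\<lambda>n. u n s) \<longlonglongrightarrow> f s))"

text \<open>Functions are total on the type \<open>'s\<close>; their values outside \<^term>\<open>space M\<close> are irrelevant
  and are identified by the almost everywhere equality.\<close>

definition L0_rel :: "'s measure \<Rightarrow> (('s \<Rightarrow> 'z::banach) \<times> ('s \<Rightarrow> 'z)) set" where
  "L0_rel M = {(f, g). bochner_measurable M f \<and> bochner_measurable M g \<and> (AE s in M. f s = g s)}"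

definition L0 :: "'s measure \<Rightarrow> ('s \<Rightarrow> 'z::banach) set set" where
  "L0 M = {f. bochner_measurable M f} // L0_rel M"

definition L0_class :: "'s measure \<Rightarrow> ('s \<Rightarrow> 'z::banach) \<Rightarrow> ('s \<Rightarrow> 'z) set" where
  "L0_class M f = L0_rel M `` {f}"

definition L0_zero :: "'s measure \<Rightarrow> ('s \<Rightarrow> 'z::banach) set" where
  "L0_zero M = L0_class M (\<lambda>s. 0)"

definition L0_add ::
    "'s measure \<Rightarrow> ('s \<Rightarrow> 'z::banach) set \<Rightarrow> ('s \<Rightarrow> 'z) set \<Rightarrow> ('s \<Rightarrow> 'z) set" where
  "L0_add M F G = (\<Union>f\<in>F. \<Union>g\<in>G. L0_class M (\<lambda>s. f s + g s))"

definition L0_diff ::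
    "'s measure \<Rightarrow> ('s \<Rightarrow> 'z::banach) set \<Rightarrow> ('s \<Rightarrow> 'z) set \<Rightarrow> ('s \<Rightarrow> 'z) set" where
  "L0_diff M F G = (\<Union>f\<in>F. \<Union>g\<in>G. L0_class M (\<lambda>s. f s - g s))"

primrec L0_psum :: "'s measure \<Rightarrow> (nat \<Rightarrow> ('s \<Rightarrow> 'z::banach) set) \<Rightarrow> nat \<Rightarrow> ('s \<Rightarrow> 'z) set" where
  "L0_psum M F 0 = L0_zero M"
| "L0_psum M F (Suc n) = L0_add M (L0_psum M F n) (F n)"

text \<open>The outer measure is needed because a Bochner measurable function is measurable only with
  respect to the completion of \<open>M\<close>.\<close>

definition in_measure_norm :: "'s measure \<Rightarrow> ('s \<Rightarrow> 'z::banach) \<Rightarrow> real" where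
  "in_measure_norm M f =
     Inf {\<epsilon>. \<epsilon> > 0 \<and> outer_measure_of M {s \<in> space M. norm (f s) \<ge> \<epsilon>} \<le> ennreal \<epsilon>}"

text \<open>The image below is a singleton for every class in \<^term>\<open>L0 M\<close>;
  see \<open>L0_norm_class\<close>.\<close>

definition L0_norm :: "'s measure \<Rightarrow> ('s \<Rightarrow> 'z::banach) set \<Rightarrow> real" where
  "L0_norm M F = the_elem (in_measure_norm M ` F)"

definition L0_tendsto ::
    "'s measure \<Rightarrow> (nat \<Rightarrow> ('s \<Rightarrow> 'z::banach) set) \<Rightarrow> ('s \<Rightarrow> 'z) set \<Rightarrow> bool" where
  "L0_tendsto M F G \<longleftrightarrow> (\<lambda>n. L0_norm M (L0_diff M (F n) G)) \<longlonglongrightarrow> 0"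

text \<open>Finite additivity and \<open>m {} = L0_zero M\<close> are not required separately: applying the
  condition to the constant sequence \<open>{}\<close> gives the latter, and then the former.\<close>

definition L0_vector_measure ::
    "'s measure \<Rightarrow> 'e set set \<Rightarrow> ('e set \<Rightarrow> ('s \<Rightarrow> 'z::banach) set) \<Rightarrow> bool" where
  "L0_vector_measure M \<E> m \<longleftrightarrow>
     (\<forall>A\<in>\<E>. m A \<in> L0 M) \<and>
     (\<forall>A::nat \<Rightarrow> 'e set. range A \<subseteq> \<E> \<longrightarrow> disjoint_family A \<longrightarrow>
        L0_tendsto M (L0_psum M (\<lambda>i. m (A i))) (m (\<Union>i. A i)))"

lemma bochner_measurable_zero: "bochner_measurable M (\<lambda>s. 0)"
  unfolding bochner_measurable_def by (intro exI[of _ "\<lambda>_ _. 0"]) auto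

lemma bochner_measurable_add:
  assumes "bochner_measurable M f" "bochner_measurable M g"
  shows "bochner_measurable M (\<lambda>s. f s + g s)"
proof -
  obtain u v where uv: "\<forall>n. simple_function M (u n)" "AE s in M. (\<lambda>n. u n s) \<longlonglongrightarrow> f s"
    "\<forall>n. simple_function M (v n)" "AE s in M. (\<lambda>n. v n s) \<longlonglongrightarrow> g s"
    using assms unfolding bochner_measurable_def by blast
  have "AE s in M. (\<lambda>n. u n s + v n s) \<longlonglongrightarrow> f s + g s"
    using uv(2,4) by eventually_elim (rule tendsto_add)
  with uv(1,3) show ?thesis
    unfolding bochner_measurable_def
    by (intro exI[of _ "\<lambda>n s. u n s + v n s"]) (auto intro: simple_function_compose2)
qed

lemma bochner_measurable_diff:
  assumes "bochner_measurable M f" "bochner_measurable M g"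
  shows "bochner_measurable M (\<lambda>s. f s - g s)"
proof -
  obtain u v where uv: "\<forall>n. simple_function M (u n)" "AE s in M. (\<lambda>n. u n s) \<longlonglongrightarrow> f s"
    "\<forall>n. simple_function M (v n)" "AE s in M. (\<lambda>n. v n s) \<longlonglongrightarrow> g s"
    using assms unfolding bochner_measurable_def by blast
  have "AE s in M. (\<lambda>n. u n s - v n s) \<longlonglongrightarrow> f s - g s"
    using uv(2,4) by eventually_elim (rule tendsto_diff)
  with uv(1,3) show ?thesis
    unfolding bochner_measurable_def
    by (intro exI[of _ "\<lambda>n s. u n s - v n s"]) (auto intro: simple_function_compose2)
qed

lemma equiv_L0_rel: "equiv {f. bochner_measurable M f} (L0_rel M)"
proof (rule equivI)
  show "L0_rel M \<subseteq> {f. bochner_measurable M f} \<times> {f. bochner_measurable M f}"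
    by (auto simp: L0_rel_def)
  show "refl_on {f. bochner_measurable M f} (L0_rel M)"
    by (auto simp: refl_on_def L0_rel_def)
  show "sym (L0_rel M)"
    by (auto simp: sym_def L0_rel_def elim: AE_mp)
  show "trans (L0_rel M)"
    by (auto simp: trans_def L0_rel_def elim: eventually_elim2)
qed

lemma L0_class_in_L0: "bochner_measurable M f \<Longrightarrow> L0_class M f \<in> L0 M"
  by (auto simp: L0_def L0_class_def intro: quotientI)

lemma mem_L0_class: "bochner_measurable M f \<Longrightarrow> f \<in> L0_class M f"
  by (auto simp: L0_class_def L0_rel_def)

lemma L0_E:
  assumes "F \<in> L0 M"
  obtains f where "bochner_measurable M f" "F = L0_class M f"
  using assms by (auto simp: L0_def L0_class_def quotient_def)

lemma L0_class_eq_iff: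
  assumes "bochner_measurable M f" "bochner_measurable M g"
  shows "L0_class M f = L0_class M g \<longleftrightarrow> (AE s in M. f s = g s)"
  using eq_equiv_class_iff[OF equiv_L0_rel, of f M g] assms
  by (auto simp: L0_class_def L0_rel_def)

lemma L0_add_class:
  assumes "bochner_measurable M f" "bochner_measurable M g"
  shows "L0_add M (L0_class M f) (L0_class M g) = L0_class M (\<lambda>s. f s + g s)"
proof -
  have "L0_class M (\<lambda>s. f' s + g' s) = L0_class M (\<lambda>s. f s + g s)"
    if "f' \<in> L0_class M f" "g' \<in> L0_class M g" for f' g'
  proof (subst L0_class_eq_iff)
    have *: "AE s in M. f s = f' s" "AE s in M. g s = g' s"
      using that by (auto simp: L0_class_def L0_rel_def)
    then show "AE s in M. f' s + g' s = f s + g s" by eventually_elim simp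
  qed (use that assms in \<open>auto simp: L0_class_def L0_rel_def intro: bochner_measurable_add\<close>)
  then show ?thesis
    using mem_L0_class[OF assms(1)] mem_L0_class[OF assms(2)] unfolding L0_add_def by blast
qed

lemma L0_diff_class:
  assumes "bochner_measurable M f" "bochner_measurable M g"
  shows "L0_diff M (L0_class M f) (L0_class M g) = L0_class M (\<lambda>s. f s - g s)"
proof -
  have "L0_class M (\<lambda>s. f' s - g' s) = L0_class M (\<lambda>s. f s - g s)"
    if "f' \<in> L0_class M f" "g' \<in> L0_class M g" for f' g'
  proof (subst L0_class_eq_iff)
    have *: "AE s in M. f s = f' s" "AE s in M. g s = g' s"
      using that by (auto simp: L0_class_def L0_rel_def)
    then show "AE s in M. f' s - g' s = f s - g s" by eventually_elim simp
  qed (use that assms in \<open>auto simp: L0_class_def L0_rel_def intro: bochner_measurable_diff\<close>)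
  then show ?thesis
    using mem_L0_class[OF assms(1)] mem_L0_class[OF assms(2)] unfolding L0_diff_def by blast
qed

lemma outer_measure_of_AE_mono:
  assumes "AE s in M. s \<in> A \<longrightarrow> s \<in> B" "A \<subseteq> space M"
  shows "outer_measure_of M A \<le> outer_measure_of M B"
  unfolding outer_measure_of_def
proof (rule INF_greatest)
  fix C assume C: "C \<in> {C \<in> sets M. B \<subseteq> C}"
  obtain N where N: "{s \<in> space M. \<not> (s \<in> A \<longrightarrow> s \<in> B)} \<subseteq> N" "N \<in> sets M" "emeasure M N = 0"
    using assms(1) by (rule AE_E)
  have "(INF C\<in>{C \<in> sets M. A \<subseteq> C}. emeasure M C) \<le> emeasure M (C \<union> N)"
    using C N assms(2) by (intro INF_lower) auto
  also have "\<dots> \<le> emeasure M C + emeasure M N"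
    using C N by (intro emeasure_subadditive) auto
  finally show "(INF C\<in>{C \<in> sets M. A \<subseteq> C}. emeasure M C) \<le> emeasure M C"
    using N by simp
qed

lemma in_measure_norm_cong_AE:
  assumes "AE s in M. f s = g s"
  shows "in_measure_norm M f = in_measure_norm M g"
proof -
  have "outer_measure_of M {s \<in> space M. norm (f s) \<ge> \<epsilon>}
      = outer_measure_of M {s \<in> space M. norm (g s) \<ge> \<epsilon>}" for \<epsilon>
    by (intro antisym outer_measure_of_AE_mono; use assms in \<open>auto elim!: eventually_mono\<close>)
  then show ?thesis by (simp add: in_measure_norm_def)
qed

lemma L0_norm_class:
  assumes "bochner_measurable M f"
  shows "L0_norm M (L0_class M f) = in_measure_norm M f"
proof -
  have "in_measure_norm M ` L0_class M f = {in_measure_norm M f}"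
    using mem_L0_class[OF assms]
    by (auto simp: L0_class_def L0_rel_def intro: in_measure_norm_cong_AE[symmetric])
  then show ?thesis by (simp add: L0_norm_def)
qed

end

theory Submission
  imports Defs
begin

text \<open>For a scalar measure \<open>f\<close> with values in \<open>L\<^sub>0\<close> and
  \<open>f E \<noteq> 0\<close> there is a finite measure \<open>\<nu>\<close> with \<open>\<nu> E > 0\<close> that vanishes on every \<open>f\<close>-null set: for a finite
  partition \<open>I\<close> of \<open>E\<close> with increments \<open>x\<^sub>a\<close> put \<open>T\<^sub>J h = (\<Sum>a\<in>J. h a * x\<^sub>a)\<close> and consider the convex set of the
  square functions \<open>w = (\<Sum>i. (T\<^sub>I h\<^sub>i)\<^sup>2)\<close> with \<open>(\<Sum>i. h\<^sub>i\<^sup>2) \<le> 1\<close>. If \<open>w\<close>, given by \<open>h\<close>, nearly maximizes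
  \<open>\<integral> ln (1 + w)\<close>, then the integrals \<open>\<integral> w' / (1 + w)\<close> of the other square functions \<open>w'\<close> are bounded, and
  \<open>\<nu> J = \<integral> (\<Sum>i. T\<^sub>I h\<^sub>i * T\<^sub>J h\<^sub>i) / (1 + w)\<close> is additive in \<open>J\<close>, bounded below at \<open>I\<close>, and small as soon
  as \<open>f\<close> is small on all subsets of \<open>J\<close>, by a version of Grothendieck's inequality for \<open>L\<^sub>0\<close>. Tychonoff's
  theorem yields a limit over all partitions; it is countably additive because \<open>f\<close> is exhaustive.
  For values in a Banach space, norming functionals produce for every non-null \<open>A\<close> such a \<open>\<nu>\<close> with
  \<open>\<nu> A > 0\<close>, and by the countable chain condition countably many of them exhaust \<open>E\<close>.\<close>

text \<open>For atomless \<mu> the space \<open>L0\<close> has no nonzero continuous functional, so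
  control measures cannot be obtained by duality on the range. Exhaustivity alone does not help
  either: there are continuous submeasures without a control measure. Duality is replaced by a
  change of density. With the weight 1 / (1 + w) all square functions have bounded integrals, which
  puts the problem into a weighted Hilbert space. The logarithm is taken because its derivative from
  w towards w' is (w' - w) / (1 + w): near maximality then bounds the integral of w' / (1 + w) by
  that of w / (1 + w), hence by the total mass, up to the slack. The weight depends on the
  partition, and no limit of it is available. Only the numbers \<open>\<nu> J\<close> pass to the
  limit, which works because their bounds involve the total mass, the size of \<open>f E\<close> and
  the smallness of \<open>f\<close> on subsets, but neither the number nor the size of the
  increments. The final exhaustion has two levels: \<open>\<nu> A > 0\<close> does not prevent
  non-null subsets of \<open>A\<close> from being \<nu>-null, and these have to be cut away before
  measures are added up.\<close>

section \<open>Random signs\<close>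

text \<open>\<open>coin L\<close> lists the signed sums of the functions in \<open>L\<close> together with the probability of
  each of them when the sign of \<open>f\<close> in an entry \<open>(p, f)\<close> is drawn independently with mean \<open>p\<close>.\<close>

fun coin :: "(real \<times> ('a \<Rightarrow> real)) list \<Rightarrow> (real \<times> ('a \<Rightarrow> real)) list" where
  "coin [] = [(1, \<lambda>_. 0)]"
| "coin ((p, f) # L) =
     map (\<lambda>(w, g). ((1 + p) / 2 * w, \<lambda>a. g a + f a)) (coin L) @
     map (\<lambda>(w, g). ((1 - p) / 2 * w, \<lambda>a. g a - f a)) (coin L)"

text \<open>Expectation as a finite weighted sum over the list of outcomes, so that exchanging it
  with an integral over \<open>M\<close> is finite linearity. Equal functions that come from
  different choices of signs stay separate entries.\<close>

definition cexp :: "(real \<times> ('a \<Rightarrow> real)) list \<Rightarrow> (('a \<Rightarrow> real) \<Rightarrow> real) \<Rightarrow> real" where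
  "cexp L \<phi> = (\<Sum>(w, g)\<leftarrow>coin L. w * \<phi> g)"

text \<open>Signed sums are built with \<open>+\<close> and \<open>-\<close> only, so the moment
  computations need just this. It covers evaluation at a point \<open>a\<close> as well as
  \<open>lincomb J x\<close> at a fixed \<open>s\<close>.\<close>

definition additive_fun :: "(('a \<Rightarrow> real) \<Rightarrow> real) \<Rightarrow> bool" where
  "additive_fun l \<longleftrightarrow> l (\<lambda>_. 0) = 0 \<and> (\<forall>f g. l (\<lambda>a. g a + f a) = l g + l f) \<and>
     (\<forall>f g. l (\<lambda>a. g a - f a) = l g - l f)"

lemma additive_funD:
  assumes "additive_fun l"
  shows "l (\<lambda>_. 0) = 0" "l (\<lambda>a. g a + f a) = l g + l f" "l (\<lambda>a. g a - f a) = l g - l f"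
  using assms by (auto simp: additive_fun_def)

lemma cexp_Nil [simp]: "cexp [] \<phi> = \<phi> (\<lambda>_. 0)"
  by (simp add: cexp_def)

lemma cexp_Cons [simp]:
  "cexp ((p, f) # L) \<phi> = (1 + p) / 2 * cexp L (\<lambda>g. \<phi> (\<lambda>a. g a + f a)) +
     (1 - p) / 2 * cexp L (\<lambda>g. \<phi> (\<lambda>a. g a - f a))"
  by (simp only: cexp_def coin.simps map_append sum_list_append map_map o_def case_prod_unfold
      fst_conv snd_conv mult.assoc sum_list_const_mult)

lemma cexp_add: "cexp L (\<lambda>g. \<phi> g + \<psi> g) = cexp L \<phi> + cexp L \<psi>"
  by (simp add: cexp_def case_prod_unfold distrib_left sum_list_addf)

lemma cexp_cmult: "cexp L (\<lambda>g. c * \<phi> g) = c * cexp L \<phi>"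
  by (simp add: cexp_def case_prod_unfold sum_list_const_mult mult.left_commute)

lemma cexp_const [simp]: "cexp L (\<lambda>g. c) = c"
  by (induction L) (auto simp: field_simps)

lemma cexp_diff: "cexp L (\<lambda>g. \<phi> g - \<psi> g) = cexp L \<phi> - cexp L \<psi>"
  using cexp_add[of L \<phi> "\<lambda>g. (-1) * \<psi> g"] cexp_cmult[of L "-1" \<psi>] by simp

lemma coin_nonneg:
  assumes "\<forall>(p, f)\<in>set L. \<bar>p\<bar> \<le> 1" "(w, g) \<in> set (coin L)"
  shows "0 \<le> w"
  using assms by (induction L arbitrary: w g rule: coin.induct) auto

lemma cexp_mono:
  assumes "\<forall>(p, f)\<in>set L. \<bar>p\<bar> \<le> 1"
    and "\<And>w g. (w, g) \<in> set (coin L) \<Longrightarrow> \<phi> g \<le> \<psi> g"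
  shows "cexp L \<phi> \<le> cexp L \<psi>"
  unfolding cexp_def
  by (rule sum_list_mono) (use assms coin_nonneg[OF assms(1)] in \<open>auto intro!: mult_left_mono\<close>)

text \<open>Variance plus squared bias: an independent sign of mean \<open>p\<close> in front of
  \<open>l f\<close> has variance \<open>(1 - p^2) * (l f)^2\<close>. The free constant
  \<open>c\<close> carries the induction, since fixing one more sign shifts it by \<open>l f\<close>
  up or down.\<close>

lemma cexp_square:
  assumes "additive_fun l"
  shows "cexp L (\<lambda>g. (l g - c)\<^sup>2) =
    (\<Sum>(p, f)\<leftarrow>L. (1 - p\<^sup>2) * (l f)\<^sup>2) + ((\<Sum>(p, f)\<leftarrow>L. p * l f) - c)\<^sup>2"
proof (induction L arbitrary: c)
  case Nil
  then show ?case using assms by (simp add: additive_funD)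
next
  case (Cons pf L)
  obtain p f where pf: "pf = (p, f)" by force
  have 1: "l g + l f - c = l g - (c - l f)" "l g - l f - c = l g - (c + l f)" for g
    by simp_all
  show ?case
    unfolding pf cexp_Cons additive_funD[OF assms] 1 Cons.IH
    by (simp add: power2_eq_square) (simp add: field_simps)
qed

lemma cexp_square_unbiased:
  assumes "additive_fun l"
  shows "cexp (map (Pair 0) F) (\<lambda>g. (l g)\<^sup>2) = (\<Sum>f\<leftarrow>F. (l f)\<^sup>2)"
  using cexp_square[OF assms, of "map (Pair 0) F" 0] by (simp add: o_def)

text \<open>Khintchine's inequality for the fourth moment, with its usual constant 3. Averaging over
  one fair sign removes the odd powers, and the remaining 6 x^2 y^2 is exactly the cross term of 3
  (x^2 + y^2)^2.\<close>

lemma cexp_fourth_unbiased: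
  assumes "additive_fun l"
  shows "cexp (map (Pair 0) F) (\<lambda>g. (l g)^4) \<le> 3 * (\<Sum>f\<leftarrow>F. (l f)\<^sup>2)\<^sup>2"
proof (induction F)
  case Nil
  then show ?case using assms by (simp add: additive_funD)
next
  case (Cons f F)
  let ?L = "map (Pair 0) F" and ?V = "\<Sum>f\<leftarrow>F. (l f)\<^sup>2"
  have *: "cexp (map (Pair 0) (f # F)) (\<lambda>g. (l g)^4) =
      1/2 * (cexp ?L (\<lambda>g. (l g + l f)^4) + cexp ?L (\<lambda>g. (l g - l f)^4))"
    by (simp add: additive_funD[OF assms])
  also have "\<dots> = cexp ?L (\<lambda>g. 1/2 * ((l g + l f)^4 + (l g - l f)^4))"
    by (simp only: cexp_cmult cexp_add)
  also have "(\<lambda>g. 1/2 * ((l g + l f)^4 + (l g - l f)^4)) =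
      (\<lambda>g. (l g)^4 + (6 * (l f)\<^sup>2 * (l g)\<^sup>2 + (l f)^4))"
    by (auto simp: power2_eq_square power4_eq_xxxx algebra_simps)
  also have "cexp ?L \<dots> = cexp ?L (\<lambda>g. (l g)^4) + (6 * (l f)\<^sup>2 * ?V + (l f)^4)"
    by (simp add: cexp_add cexp_cmult cexp_square_unbiased[OF assms])
  also have "\<dots> \<le> 3 * ?V\<^sup>2 + (6 * (l f)\<^sup>2 * ?V + (l f)^4)"
    using Cons.IH by simp
  also have "\<dots> \<le> 3 * ((l f)\<^sup>2 + ?V)\<^sup>2"
  proof -
    have "0 \<le> (l f)^4" by (rule zero_le_even_power) simp
    moreover have "3 * ((l f)\<^sup>2 + ?V)\<^sup>2 - (3 * ?V\<^sup>2 + (6 * (l f)\<^sup>2 * ?V + (l f)^4)) = 2 * (l f)^4"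
      by (simp add: power2_eq_square power4_eq_xxxx algebra_simps)
    ultimately show ?thesis by linarith
  qed
  finally show ?case by simp
qed

text \<open>Let y be the square of the signed sum, of mean V. Below V / 4 it contributes at most V /
  4; elsewhere y \<le> y^2 / (8 V) + 2 V. The fourth moment bound turns this into 1 \<le> 1/4 + 3/8
  + 2 P, where P is the probability in question.\<close>

lemma Paley_Zygmund_signs:
  assumes "additive_fun l"
  shows "3 / 16 \<le> cexp (map (Pair 0) F) (\<lambda>g. of_bool ((\<Sum>f\<leftarrow>F. (l f)\<^sup>2) \<le> 4 * (l g)\<^sup>2))"
proof -
  let ?L = "map (Pair (0::real)) F"
  define V where "V = (\<Sum>f\<leftarrow>F. (l f)\<^sup>2)"
  let ?b = "\<lambda>g. of_bool (V \<le> 4 * (l g)\<^sup>2) :: real"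
  have p: "\<forall>(p, f)\<in>set ?L. \<bar>p\<bar> \<le> 1" by auto
  have "V \<ge> 0" unfolding V_def by (rule sum_list_nonneg) auto
  show ?thesis
  proof (cases "V = 0")
    case True
    then have "?b = (\<lambda>g. 1)" by auto
    then show ?thesis by (simp add: V_def[symmetric])
  next
    case False
    with \<open>V \<ge> 0\<close> have V: "V > 0" by simp
    have "V = cexp ?L (\<lambda>g. (l g)\<^sup>2)"
      by (simp add: V_def cexp_square_unbiased[OF assms])
    also have "\<dots> \<le> cexp ?L (\<lambda>g. V / 4 + (1 / (8 * V) * (l g)^4 + 2 * V * ?b g))"
    proof (rule cexp_mono[OF p])
      fix w g
      let ?y = "(l g)\<^sup>2"
      have "0 \<le> (?y - 4 * V)\<^sup>2 / (8 * V)" using V by simp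
      also have "\<dots> = 1 / (8 * V) * (l g)^4 + 2 * V - ?y"
        using V by (simp add: power2_eq_square power4_eq_xxxx field_simps)
      finally have "?y \<le> 1 / (8 * V) * (l g)^4 + 2 * V" by simp
      moreover have "0 \<le> 1 / (8 * V) * (l g)^4" using V by simp
      ultimately show "?y \<le> V / 4 + (1 / (8 * V) * (l g)^4 + 2 * V * ?b g)"
      proof (cases "V \<le> 4 * (l g)\<^sup>2")
        case True
        then have "?b g = 1" by simp
        show ?thesis unfolding \<open>?b g = 1\<close> using \<open>?y \<le> _\<close> V by linarith
      next
        case False
        then have "?b g = 0" "?y \<le> V / 4" by simp_all
        show ?thesis unfolding \<open>?b g = 0\<close> using \<open>0 \<le> 1 / _ * _\<close> \<open>?y \<le> V / 4\<close> by linarith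
      qed
    qed
    also have "\<dots> = V / 4 + (1 / (8 * V) * cexp ?L (\<lambda>g. (l g)^4) + 2 * V * cexp ?L ?b)"
      by (simp only: cexp_add cexp_cmult cexp_const)
    also have "\<dots> \<le> V / 4 + (1 / (8 * V) * (3 * V\<^sup>2) + 2 * V * cexp ?L ?b)"
      using cexp_fourth_unbiased[OF assms, of F] V
      by (intro add_mono order_refl mult_left_mono) (auto simp: V_def)
    also have "\<dots> = V * (5 / 8 + 2 * cexp ?L ?b)"
      using V by (simp add: field_simps power2_eq_square)
    finally have "1 \<le> 5 / 8 + 2 * cexp ?L ?b" using V by simp
    then show ?thesis by (simp add: V_def)
  qed
qed

section \<open>Square functions of finite families\<close>

definition lincomb :: "'a set \<Rightarrow> ('a \<Rightarrow> 's \<Rightarrow> real) \<Rightarrow> ('a \<Rightarrow> real) \<Rightarrow> 's \<Rightarrow> real" where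
  "lincomb J x f s = (\<Sum>a\<in>J. f a * x a s)"

definition sqfun :: "'a set \<Rightarrow> ('a \<Rightarrow> 's \<Rightarrow> real) \<Rightarrow> ('a \<Rightarrow> real) list \<Rightarrow> 's \<Rightarrow> real" where
  "sqfun J x F s = (\<Sum>f\<leftarrow>F. (lincomb J x f s)\<^sup>2)"

text \<open>A list \<open>F\<close> encodes a map from \<open>J\<close> to a Euclidean space,
  \<open>a\<close> being sent to the vector of all \<open>f a\<close>. Admissibility places the
  values in the unit ball, and \<open>sqfun J x F\<close> is the squared norm of the combination of
  the \<open>x a\<close> with these vector coefficients. This is the setting of Grothendieck's
  inequality.\<close>

definition admissible :: "'a set \<Rightarrow> ('a \<Rightarrow> real) list \<Rightarrow> bool" where
  "admissible J F \<longleftrightarrow> (\<forall>a\<in>J. (\<Sum>f\<leftarrow>F. (f a)\<^sup>2) \<le> 1)"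

lemma additive_fun_lincomb: "additive_fun (\<lambda>f. lincomb J x f s)"
  by (simp add: additive_fun_def lincomb_def algebra_simps sum.distrib sum_subtractf)

lemma additive_fun_apply: "additive_fun (\<lambda>f. f a)"
  by (simp add: additive_fun_def)

lemma lincomb_cmult: "lincomb J x (\<lambda>a. c * f a) s = c * lincomb J x f s"
  by (simp add: lincomb_def sum_distrib_left mult.assoc)

lemma lincomb_indicator:
  assumes "finite J" "b \<in> J"
  shows "lincomb J x (\<lambda>a. of_bool (a = b)) s = x b s"
  using assms by (simp add: lincomb_def of_bool_def if_distrib[of "\<lambda>t. t * _"] cong: if_cong)

lemma sqfun_nonneg: "0 \<le> sqfun J x F s"
  unfolding sqfun_def by (rule sum_list_nonneg) auto

lemma sqfun_append: "sqfun J x (F @ G) s = sqfun J x F s + sqfun J x G s"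
  by (simp add: sqfun_def)

lemma sqfun_scale: "sqfun J x (map (\<lambda>f a. c * f a) F) s = c\<^sup>2 * sqfun J x F s"
  by (simp add: sqfun_def o_def lincomb_cmult power_mult_distrib sum_list_const_mult)

lemma admissible_mono: "admissible I F \<Longrightarrow> J \<subseteq> I \<Longrightarrow> admissible J F"
  by (auto simp: admissible_def)

text \<open>Concatenation adds square sums and a factor acts on them by its square, so weights
  \<open>sqrt (1 - t)\<close> and \<open>sqrt t\<close> realize convex combinations. This makes the
  set of square functions convex.\<close>

lemma admissible_convex:
  assumes "admissible J F" "admissible J G" "0 \<le> t" "t \<le> 1"
  shows "admissible J (map (\<lambda>f a. sqrt (1 - t) * f a) F @ map (\<lambda>f a. sqrt t * f a) G)"
  unfolding admissible_def
proof
  fix a assume "a \<in> J"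
  then have "(1 - t) * (\<Sum>f\<leftarrow>F. (f a)\<^sup>2) + t * (\<Sum>f\<leftarrow>G. (f a)\<^sup>2) \<le> (1 - t) * 1 + t * 1"
    using assms unfolding admissible_def by (intro add_mono mult_left_mono) auto
  then show "(\<Sum>f\<leftarrow>map (\<lambda>f a. sqrt (1 - t) * f a) F @ map (\<lambda>f a. sqrt t * f a) G. (f a)\<^sup>2) \<le> 1"
    using assms by (simp add: o_def power_mult_distrib sum_list_const_mult)
qed

lemma sqfun_convex:
  assumes "0 \<le> t" "t \<le> 1"
  shows "sqfun J x (map (\<lambda>f a. sqrt (1 - t) * f a) F @ map (\<lambda>f a. sqrt t * f a) G) s =
    (1 - t) * sqfun J x F s + t * sqfun J x G s"
  using assms by (simp add: sqfun_append sqfun_scale)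

text \<open>A crude Cauchy-Schwarz bound. It only makes suprema and integrals finite; the constants
  of the later estimates do not depend on it.\<close>

lemma sqfun_le:
  assumes "finite J" "admissible J F" and C: "\<And>a. a \<in> J \<Longrightarrow> \<bar>x a s\<bar> \<le> C"
  shows "sqfun J x F s \<le> (real (card J) * C)\<^sup>2"
proof -
  have "sqfun J x F s \<le> (\<Sum>f\<leftarrow>F. real (card J) * (\<Sum>a\<in>J. (f a)\<^sup>2 * C\<^sup>2))"
    unfolding sqfun_def
  proof (rule sum_list_mono)
    fix f
    have "(lincomb J x f s)\<^sup>2 \<le> real (card J) * (\<Sum>a\<in>J. (f a * x a s)\<^sup>2)"
      using sum_squared_le_sum_of_squares[of "\<lambda>a. f a * x a s" J] assms(1)
      by (simp add: lincomb_def mult.commute)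
    also have "\<dots> \<le> real (card J) * (\<Sum>a\<in>J. (f a)\<^sup>2 * C\<^sup>2)"
    proof (intro mult_left_mono sum_mono)
      fix a assume "a \<in> J"
      then have "\<bar>x a s\<bar>\<^sup>2 \<le> C\<^sup>2" using C by (intro power_mono) auto
      then show "(f a * x a s)\<^sup>2 \<le> (f a)\<^sup>2 * C\<^sup>2"
        by (simp add: power_mult_distrib mult_left_mono)
    qed simp
    finally show "(lincomb J x f s)\<^sup>2 \<le> real (card J) * (\<Sum>a\<in>J. (f a)\<^sup>2 * C\<^sup>2)" .
  qed
  also have "\<dots> = real (card J) * C\<^sup>2 * (\<Sum>a\<in>J. \<Sum>f\<leftarrow>F. (f a)\<^sup>2)"
    by (induction F) (simp_all add: sum.distrib algebra_simps sum_distrib_left)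
  also have "\<dots> \<le> real (card J) * C\<^sup>2 * (\<Sum>a\<in>J. 1)"
    using assms(2) unfolding admissible_def by (intro mult_left_mono sum_mono) auto
  finally show ?thesis by (simp add: power2_eq_square algebra_simps)
qed

lemma borel_measurable_lincomb [measurable]:
  assumes "\<And>a. a \<in> J \<Longrightarrow> x a \<in> borel_measurable M"
  shows "lincomb J x f \<in> borel_measurable M"
  unfolding lincomb_def using assms by measurable

lemma borel_measurable_sqfun:
  assumes "\<And>a. a \<in> J \<Longrightarrow> x a \<in> borel_measurable M"
  shows "sqfun J x F \<in> borel_measurable M"
proof (induction F)
  case (Cons f F)
  have "sqfun J x (f # F) = (\<lambda>s. (lincomb J x f s)\<^sup>2 + sqfun J x F s)"
    by (auto simp: sqfun_def)
  with Cons borel_measurable_lincomb[where J = J and f = f, OF assms] show ?case by simp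
qed (simp add: sqfun_def[abs_def])

lemma integral_cexp:
  assumes "\<And>g. integrable M (h g)"
  shows "integrable M (\<lambda>s. cexp L (\<lambda>g. h g s))"
    and "(\<integral>s. cexp L (\<lambda>g. h g s) \<partial>M) = cexp L (\<lambda>g. \<integral>s. h g s \<partial>M)"
  using assms by (induction L arbitrary: h rule: coin.induct) auto

section \<open>Near-maximizers of the logarithmic functional\<close>

context finite_measure
begin

lemma integral_of_bool:
  assumes "Measurable.pred M P"
  shows "integrable M (\<lambda>s. of_bool (P s) :: real)"
    and "(\<integral>s. of_bool (P s) \<partial>M) = measure M {s\<in>space M. P s}"
proof -
  have *: "(of_bool (P s) :: real) = indicator {s\<in>space M. P s} s" if "s \<in> space M" for s
    using that by (auto simp: indicator_def)
  have "integrable M (indicator {s\<in>space M. P s} :: _ \<Rightarrow> real)"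
    using assms by (intro integrable_real_indicator) (auto simp: emeasure_eq_measure)
  then show "integrable M (\<lambda>s. of_bool (P s) :: real)"
    by (subst Bochner_Integration.integrable_cong[OF refl *]) auto
  have "(\<integral>s. of_bool (P s) \<partial>M) = (\<integral>s. indicator {s\<in>space M. P s} s \<partial>M :: real)"
    by (rule Bochner_Integration.integral_cong) (auto simp: *)
  then show "(\<integral>s. of_bool (P s) \<partial>M) = measure M {s\<in>space M. P s}"
    using assms by simp
qed

lemma integrable_bounded:
  fixes f :: "'a \<Rightarrow> real"
  assumes "f \<in> borel_measurable M" "\<And>s. s \<in> space M \<Longrightarrow> \<bar>f s\<bar> \<le> C"
  shows "integrable M f"
  using assms by (intro integrable_const_bound[of _ C]) auto

text \<open>First-order optimality of an approximate maximizer of the concave functional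
  \<open>F \<mapsto> \<integral>\<^sub>Y ln (1 + sqfun J x F)\<close>.\<close>

lemma log_optimal:
  fixes x :: "'b \<Rightarrow> 'a \<Rightarrow> real"
  assumes J: "finite J" and x: "\<And>a. a \<in> J \<Longrightarrow> x a \<in> borel_measurable M"
    and bdd: "\<And>a s. a \<in> J \<Longrightarrow> s \<in> space M \<Longrightarrow> \<bar>x a s\<bar> \<le> C"
    and Y: "Y \<in> sets M" and \<iota>: "0 < \<iota>"
  obtains F where "admissible J F"
    and "\<And>G. admissible J G \<Longrightarrow>
      (\<integral>s. indicator Y s * ((sqfun J x G s - sqfun J x F s) / (1 + sqfun J x F s)) \<partial>M) \<le> \<iota>"
proof -
  define B where "B = (real (card J) * C)\<^sup>2"
  have B: "sqfun J x F s \<le> B" if "admissible J F" "s \<in> space M" for F s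
    unfolding B_def using that bdd by (intro sqfun_le[OF J]) auto
  have B0: "B \<ge> 0" by (simp add: B_def)
  note [measurable] = borel_measurable_sqfun[OF x] Y
  define \<Phi> where "\<Phi> F = (\<integral>s. indicator Y s * ln (1 + sqfun J x F s) \<partial>M)" for F
  have int: "integrable M (\<lambda>s. indicator Y s * ln (1 + sqfun J x F s))" if "admissible J F" for F
  proof (rule integrable_bounded[of _ B])
    fix s assume "s \<in> space M"
    then have "0 \<le> ln (1 + sqfun J x F s)" "ln (1 + sqfun J x F s) \<le> B"
      using B[OF that, of s] sqfun_nonneg[of J x F s]
        ln_add_one_self_le_self[of "sqfun J x F s"] by auto
    then show "\<bar>indicator Y s * ln (1 + sqfun J x F s)\<bar> \<le> B"
      using B0 by (auto simp: indicator_def)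
  qed simp
  have \<Phi>_le: "\<Phi> F \<le> measure M (space M) * B" if "admissible J F" for F
  proof -
    have "\<Phi> F \<le> (\<integral>s. B \<partial>M)"
      unfolding \<Phi>_def
    proof (rule integral_mono[OF int[OF that]])
      fix s assume "s \<in> space M"
      then show "indicator Y s * ln (1 + sqfun J x F s) \<le> B"
        using B[OF that, of s] sqfun_nonneg[of J x F s] B0
          ln_add_one_self_le_self[of "sqfun J x F s"] by (auto simp: indicator_def)
    qed simp
    then show ?thesis by simp
  qed
  define m where "m = measure M (space M)"
  have m: "m \<ge> 0" by (simp add: m_def)
  \<comment> \<open>Step size from \<open>F\<close> towards \<open>G\<close>: the second-order loss
    \<open>2 * t^2 * (B + 1)^2 * m\<close> must not exceed \<open>t * \<iota> / 2\<close>, and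
    \<open>t \<le> 1 / 2\<close> keeps \<open>1 + t * d s\<close> at least 1/2.\<close>
  define t where "t = min (1 / 2) (\<iota> / (4 * (m + 1) * (B + 1)\<^sup>2))"
  have t: "0 < t" using m \<iota> B0 by (auto simp: t_def)
  have t2: "t \<le> 1 / 2" unfolding t_def by (rule min.cobounded1)
  note t = t t2
  have t': "2 * t * ((B + 1)\<^sup>2 * m) \<le> \<iota> / 2"
  proof -
    have "2 * t * ((B + 1)\<^sup>2 * m) \<le> 2 * (\<iota> / (4 * (m + 1) * (B + 1)\<^sup>2)) * ((B + 1)\<^sup>2 * m)"
      using m B0 by (intro mult_right_mono) (auto simp: t_def)
    also have "\<dots> = \<iota> / 2 * (m / (m + 1))"
    proof -
      have "2 * (\<iota> / (4 * n * K)) * (K * m) = \<iota> / 2 * (m / n)" if "n \<noteq> 0" "K \<noteq> 0" for n K :: real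
        using that by (simp add: field_simps)
      note this[of "m + 1" "(B + 1)\<^sup>2"]
      then show ?thesis using B0 m by force
    qed
    also have "\<dots> \<le> \<iota> / 2 * 1" using m \<iota> by (intro mult_left_mono) auto
    finally show ?thesis by simp
  qed
  define S where "S = Sup (\<Phi> ` Collect (admissible J))"
  have bdd_S: "bdd_above (\<Phi> ` Collect (admissible J))"
    using \<Phi>_le by (intro bdd_aboveI[of _ "measure M (space M) * B"]) auto
  have "admissible J []" by (simp add: admissible_def)
  then have ne: "\<Phi> ` Collect (admissible J) \<noteq> {}" by auto
  \<comment> \<open>The deficit is proportional to the step, so that \<open>\<iota> / 2\<close>
    remains of it after division by \<open>t\<close>.\<close>
  have "S - t * \<iota> / 2 < S" using t \<iota> by simp
  then obtain F where F: "admissible J F" "S - t * \<iota> / 2 < \<Phi> F"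
    unfolding S_def using less_cSup_iff[OF ne bdd_S] by auto
  show ?thesis
  proof (rule that[OF F(1)])
    fix G assume G: "admissible J G"
    define d where "d s = (sqfun J x G s - sqfun J x F s) / (1 + sqfun J x F s)" for s
    have dm [measurable]: "d \<in> borel_measurable M" unfolding d_def by measurable
    have d: "-1 \<le> d s" "d s \<le> B" "\<bar>d s\<bar> \<le> B + 1" if "s \<in> space M" for s
    proof -
      have nn: "0 \<le> sqfun J x F s" "0 \<le> sqfun J x G s" by (rule sqfun_nonneg)+
      then show 1: "-1 \<le> d s" by (simp add: d_def field_simps)
      have "d s \<le> sqfun J x G s / (1 + sqfun J x F s)"
        using nn unfolding d_def by (intro divide_right_mono) auto
      also have "\<dots> \<le> sqfun J x G s / 1" using nn by (intro divide_left_mono) auto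
      also have "\<dots> \<le> B" using B[OF G that] by simp
      finally show 2: "d s \<le> B" .
      with 1 B0 show "\<bar>d s\<bar> \<le> B + 1" by linarith
    qed
    define H where "H = map (\<lambda>f a. sqrt (1 - t) * f a) F @ map (\<lambda>f a. sqrt t * f a) G"
    have H: "admissible J H" "\<And>s. sqfun J x H s = (1 - t) * sqfun J x F s + t * sqfun J x G s"
      unfolding H_def using t by (auto intro!: admissible_convex sqfun_convex F G)
    have intd: "integrable M (\<lambda>s. indicator Y s * d s)"
      using d B0 by (intro integrable_bounded[of _ "B + 1"]) (auto simp: indicator_def)
    have lnln: "t * d s - 2 * t\<^sup>2 * (B + 1)\<^sup>2 \<le> ln (1 + sqfun J x H s) - ln (1 + sqfun J x F s)"
      if s: "s \<in> space M" for s
    proof -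
      define y where "y = t * d s"
      have nn: "0 \<le> sqfun J x F s" "0 \<le> sqfun J x H s" by (rule sqfun_nonneg)+
      have "t * (-1) \<le> y" unfolding y_def using d[OF s] t by (intro mult_left_mono) auto
      then have y: "-1/2 \<le> y" using t by linarith
      \<comment> \<open>On the segment the argument of the logarithm factors, so the increment is
        exactly \<open>ln (1 + y)\<close>. It is bounded below by y - 2 y^2, valid for y \<ge>
        -1/2.\<close>
      have eq: "1 + sqfun J x H s = (1 + sqfun J x F s) * (1 + y)"
        using nn unfolding y_def d_def H(2) by (simp add: field_simps)
      have "ln (1 + sqfun J x H s) - ln (1 + sqfun J x F s) = ln (1 + y)"
        unfolding eq using nn y by (subst ln_mult) auto
      moreover have "- ln (1 + y) = ln (inverse (1 + y))" using y by (simp add: ln_inverse)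
      moreover have "ln (inverse (1 + y)) \<le> inverse (1 + y) - 1"
        using y by (intro ln_le_minus_one) auto
      moreover have "inverse (1 + y) - 1 \<le> - y + 2 * y\<^sup>2"
      proof -
        have "0 \<le> y\<^sup>2 * (1 + 2 * y)" using y by (intro mult_nonneg_nonneg) auto
        then show ?thesis using y by (simp add: field_simps power2_eq_square)
      qed
      moreover have "y\<^sup>2 \<le> t\<^sup>2 * (B + 1)\<^sup>2"
      proof -
        have "\<bar>y\<bar> \<le> t * (B + 1)" unfolding y_def abs_mult using d[OF s] t by (intro mult_mono) auto
        then have "\<bar>y\<bar>\<^sup>2 \<le> (t * (B + 1))\<^sup>2" by (intro power_mono) auto
        then show ?thesis by (simp add: power_mult_distrib)
      qed
      ultimately show ?thesis unfolding y_def by linarith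
    qed
    have "t * (\<integral>s. indicator Y s * d s \<partial>M) - 2 * t\<^sup>2 * (B + 1)\<^sup>2 * m =
        (\<integral>s. t * (indicator Y s * d s) - 2 * t\<^sup>2 * (B + 1)\<^sup>2 \<partial>M)"
      using intd by (simp add: m_def)
    also have "\<dots> \<le> (\<integral>s. indicator Y s * ln (1 + sqfun J x H s) - indicator Y s * ln (1 + sqfun J x F s) \<partial>M)"
    proof (rule integral_mono)
      fix s assume s: "s \<in> space M"
      have "0 \<le> 2 * t\<^sup>2 * (B + 1)\<^sup>2" by simp
      then show "t * (indicator Y s * d s) - 2 * t\<^sup>2 * (B + 1)\<^sup>2 \<le>
          indicator Y s * ln (1 + sqfun J x H s) - indicator Y s * ln (1 + sqfun J x F s)"
        using lnln[OF s] by (cases "s \<in> Y") auto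
    qed (use intd int[OF H(1)] int[OF F(1)] in auto)
    also have "\<dots> = \<Phi> H - \<Phi> F"
      using int[OF H(1)] int[OF F(1)] by (simp add: \<Phi>_def)
    also have "\<dots> \<le> t * \<iota> / 2"
    proof -
      have "\<Phi> H \<le> S" unfolding S_def by (rule cSup_upper[OF _ bdd_S]) (use H in auto)
      with F(2) show ?thesis by linarith
    qed
    finally have "t * (\<integral>s. indicator Y s * d s \<partial>M) \<le> t * (2 * t * ((B + 1)\<^sup>2 * m) + \<iota> / 2)"
      by (simp add: algebra_simps power2_eq_square)
    then have "(\<integral>s. indicator Y s * d s \<partial>M) \<le> 2 * t * ((B + 1)\<^sup>2 * m) + \<iota> / 2"
      using t by (subst (asm) mult_le_cancel_left_pos) auto
    with t' show "(\<integral>s. indicator Y s * ((sqfun J x G s - sqfun J x F s) / (1 + sqfun J x F s)) \<partial>M) \<le> \<iota>"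
      by (simp add: d_def)
  qed
qed

end

section \<open>From sums over subsets to coefficients in [-1, 1]\<close>

lemma coin_signs:
  assumes "distinct as" "(w, g) \<in> set (coin (map (\<lambda>b. (h b, \<lambda>a. of_bool (a = b))) as))"
  shows "(a \<in> set as \<longrightarrow> g a \<in> {-1, 1}) \<and> (a \<notin> set as \<longrightarrow> g a = 0)"
  using assms by (induction as arbitrary: w g) (fastforce split: if_splits)+

context finite_measure
begin

text \<open>A sum with signs is the difference of the sums over the positive and the negative
  indices. Both are covered by the hypothesis, at the cost of doubling threshold and bound.\<close>

lemma measure_signs_le:
  fixes x :: "'b \<Rightarrow> 'a \<Rightarrow> real"
  assumes J: "finite J" and x: "\<And>a. a \<in> J \<Longrightarrow> x a \<in> borel_measurable M"
    and small: "\<And>K. K \<subseteq> J \<Longrightarrow> measure M {s\<in>space M. 1 \<le> \<bar>\<Sum>a\<in>K. x a s\<bar>} \<le> \<beta>"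
    and g: "\<And>a. a \<in> J \<Longrightarrow> g a \<in> {-1, 1}"
  shows "measure M {s\<in>space M. 2 \<le> \<bar>lincomb J x g s\<bar>} \<le> 2 * \<beta>"
proof -
  define P where "P = {a\<in>J. g a = 1}"
  define N where "N = {a\<in>J. g a = -1}"
  have sub: "P \<subseteq> J" "N \<subseteq> J" by (auto simp: P_def N_def)
  have mS: "(\<lambda>s. \<Sum>a\<in>K. x a s) \<in> borel_measurable M" if "K \<subseteq> J" for K
    using x that by (intro borel_measurable_sum) auto
  note [measurable] = mS[OF sub(1)] mS[OF sub(2)]
  have eq: "lincomb J x g s = (\<Sum>a\<in>P. x a s) - (\<Sum>a\<in>N. x a s)" for s
  proof -
    have "J = P \<union> N" "P \<inter> N = {}" using g by (auto simp: P_def N_def)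
    then have "lincomb J x g s = (\<Sum>a\<in>P. g a * x a s) + (\<Sum>a\<in>N. g a * x a s)"
      unfolding lincomb_def using J by (metis finite_Un sum.union_disjoint)
    also have "\<dots> = (\<Sum>a\<in>P. x a s) + (\<Sum>a\<in>N. - x a s)"
      by (intro arg_cong2[where f = "(+)"] sum.cong) (auto simp: P_def N_def)
    finally show ?thesis by (simp add: sum_negf)
  qed
  have "measure M {s\<in>space M. 2 \<le> \<bar>lincomb J x g s\<bar>} \<le>
      measure M ({s\<in>space M. 1 \<le> \<bar>\<Sum>a\<in>P. x a s\<bar>} \<union> {s\<in>space M. 1 \<le> \<bar>\<Sum>a\<in>N. x a s\<bar>})"
    by (intro finite_measure_mono) (auto simp: eq)
  also have "\<dots> \<le> measure M {s\<in>space M. 1 \<le> \<bar>\<Sum>a\<in>P. x a s\<bar>} + measure M {s\<in>space M. 1 \<le> \<bar>\<Sum>a\<in>N. x a s\<bar>}"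
    by (intro measure_Un_le) auto
  also have "\<dots> \<le> 2 * \<beta>" using small[OF sub(1)] small[OF sub(2)] by simp
  finally show ?thesis .
qed

text \<open>Each outcome is a choice of signs and obeys the bound \<open>2 * \<beta>\<close>, hence
  so does the average, whatever the means \<open>h\<close>. The means are free: zero gives the
  square function, a prescribed \<open>h\<close> gives \<open>lincomb J x h\<close>.\<close>

lemma integral_coin_signs_le:
  fixes x :: "'b \<Rightarrow> 'a \<Rightarrow> real"
  assumes as: "distinct as" "set as = J" and x: "\<And>a. a \<in> J \<Longrightarrow> x a \<in> borel_measurable M"
    and small: "\<And>K. K \<subseteq> J \<Longrightarrow> measure M {s\<in>space M. 1 \<le> \<bar>\<Sum>a\<in>K. x a s\<bar>} \<le> \<beta>"
    and h: "\<And>a. a \<in> J \<Longrightarrow> \<bar>h a\<bar> \<le> 1"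
  defines "L \<equiv> map (\<lambda>b. (h b, \<lambda>a. of_bool (a = b))) as"
  shows "integrable M (\<lambda>s. cexp L (\<lambda>g. of_bool (2 \<le> \<bar>lincomb J x g s\<bar>)))" (is ?A)
    and "(\<integral>s. cexp L (\<lambda>g. of_bool (2 \<le> \<bar>lincomb J x g s\<bar>)) \<partial>M) \<le> 2 * \<beta>" (is ?B)
proof -
  have J: "finite J" using as by auto
  have [measurable]: "lincomb J x g \<in> borel_measurable M" for g
    by (rule borel_measurable_lincomb[OF x])
  have int: "integrable M (\<lambda>s. of_bool (2 \<le> \<bar>lincomb J x g s\<bar>) :: real)" for g
    by (intro integral_of_bool) measurable
  show ?A by (intro integral_cexp int)
  have "(\<integral>s. cexp L (\<lambda>g. of_bool (2 \<le> \<bar>lincomb J x g s\<bar>)) \<partial>M) =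
      cexp L (\<lambda>g. measure M {s\<in>space M. 2 \<le> \<bar>lincomb J x g s\<bar>})"
    by (subst integral_cexp[OF int], subst integral_of_bool) auto
  also have "\<dots> \<le> cexp L (\<lambda>g. 2 * \<beta>)"
  proof (rule cexp_mono)
    show "\<forall>(p, f)\<in>set L. \<bar>p\<bar> \<le> 1" using h as by (auto simp: L_def)
    fix w g assume "(w, g) \<in> set (coin L)"
    then have g: "g a \<in> {-1, 1}" if "a \<in> J" for a
      using coin_signs[OF as(1), of w g h a] as that unfolding L_def by auto
    show "measure M {s\<in>space M. 2 \<le> \<bar>lincomb J x g s\<bar>} \<le> 2 * \<beta>"
      by (rule measure_signs_le[OF J]) (use x small g in blast)+
  qed
  finally show ?B by simp
qed

text \<open>Where the square function Q is at least 16, a random signed sum has square at least Q /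
  4 \<ge> 4 with probability at least 3/16. Integration gives \<open>2 * \<beta>\<close> divided by
  3/16.\<close>

lemma measure_square_function_le:
  fixes x :: "'b \<Rightarrow> 'a \<Rightarrow> real"
  assumes J: "finite J" and x: "\<And>a. a \<in> J \<Longrightarrow> x a \<in> borel_measurable M"
    and small: "\<And>K. K \<subseteq> J \<Longrightarrow> measure M {s\<in>space M. 1 \<le> \<bar>\<Sum>a\<in>K. x a s\<bar>} \<le> \<beta>"
  shows "measure M {s\<in>space M. 16 \<le> (\<Sum>a\<in>J. (x a s)\<^sup>2)} \<le> 32 / 3 * \<beta>"
proof -
  obtain as where as: "distinct as" "set as = J" using finite_distinct_list[OF J] by auto
  define L where "L = map (\<lambda>b. (0::real, \<lambda>a. of_bool (a = b) :: real)) as"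
  have L: "L = map (Pair 0) (map (\<lambda>b a. of_bool (a = b)) as)" by (simp add: L_def)
  have [measurable]: "(\<lambda>s. \<Sum>a\<in>J. (x a s)\<^sup>2) \<in> borel_measurable M"
    using x by (intro borel_measurable_sum) auto
  have Q: "(\<Sum>f\<leftarrow>map (\<lambda>b a. of_bool (a = b)) as. (lincomb J x f s)\<^sup>2) = (\<Sum>a\<in>J. (x a s)\<^sup>2)" for s
  proof -
    have "(\<Sum>f\<leftarrow>map (\<lambda>b a. of_bool (a = b)) as. (lincomb J x f s)\<^sup>2) =
        (\<Sum>b\<leftarrow>as. (lincomb J x (\<lambda>a. of_bool (a = b)) s)\<^sup>2)" by (simp add: o_def)
    also have "\<dots> = (\<Sum>b\<in>J. (lincomb J x (\<lambda>a. of_bool (a = b)) s)\<^sup>2)"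
      using as by (simp add: sum_list_distinct_conv_sum_set)
    finally show ?thesis using J by (simp add: lincomb_indicator)
  qed
  note I = integral_coin_signs_le[OF as x small, where h = "\<lambda>_. 0", folded L_def]
  have "3 / 16 * measure M {s\<in>space M. 16 \<le> (\<Sum>a\<in>J. (x a s)\<^sup>2)} =
      (\<integral>s. 3 / 16 * of_bool (16 \<le> (\<Sum>a\<in>J. (x a s)\<^sup>2)) \<partial>M)"
    by (subst integral_mult_right_zero, subst integral_of_bool) auto
  also have "\<dots> \<le> (\<integral>s. cexp L (\<lambda>g. of_bool (2 \<le> \<bar>lincomb J x g s\<bar>)) \<partial>M)"
  proof (rule integral_mono)
    fix s assume "s \<in> space M"
    show "3 / 16 * of_bool (16 \<le> (\<Sum>a\<in>J. (x a s)\<^sup>2)) \<le> cexp L (\<lambda>g. of_bool (2 \<le> \<bar>lincomb J x g s\<bar>))"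
    proof (cases "16 \<le> (\<Sum>a\<in>J. (x a s)\<^sup>2)")
      case True
      have "3 / 16 \<le> cexp L (\<lambda>g. of_bool ((\<Sum>a\<in>J. (x a s)\<^sup>2) \<le> 4 * (lincomb J x g s)\<^sup>2))"
        using Paley_Zygmund_signs[OF additive_fun_lincomb[of J x s], of "map (\<lambda>b a. of_bool (a = b)) as"]
        by (simp only: Q L)
      also have "\<dots> \<le> cexp L (\<lambda>g. of_bool (2 \<le> \<bar>lincomb J x g s\<bar>))"
      proof (rule cexp_mono)
        fix w g
        have "2 \<le> \<bar>lincomb J x g s\<bar>" if "(\<Sum>a\<in>J. (x a s)\<^sup>2) \<le> 4 * (lincomb J x g s)\<^sup>2"
          using True that by (intro power2_le_imp_le[of 2]) auto
        then show "of_bool ((\<Sum>a\<in>J. (x a s)\<^sup>2) \<le> 4 * (lincomb J x g s)\<^sup>2) \<le>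
            (of_bool (2 \<le> \<bar>lincomb J x g s\<bar>) :: real)" by auto
      qed (auto simp: L_def)
      finally show ?thesis using True by simp
    next
      case False
      have "cexp L (\<lambda>g. 0) \<le> cexp L (\<lambda>g. of_bool (2 \<le> \<bar>lincomb J x g s\<bar>))"
        by (rule cexp_mono) (auto simp: L_def)
      with False show ?thesis by simp
    qed
  next
    show "integrable M (\<lambda>s. 3 / 16 * of_bool (16 \<le> (\<Sum>a\<in>J. (x a s)\<^sup>2)) :: real)"
      by (intro integrable_mult_right integral_of_bool) measurable
  qed (use I in auto)
  also have "\<dots> \<le> 2 * \<beta>" using I by auto
  finally show ?thesis by simp
qed

text \<open>\<open>L0\<close> is not locally convex, so coefficients in [-1, 1] do not follow from
  signs by convexity. Instead \<open>h a\<close> is taken as the mean of an independent sign at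
  \<open>a\<close>. Where the square function is below 16, the variance is at most 16; if the mean
  has modulus at least 10, a signed sum of modulus below 2 deviates by 8, which has probability at
  most 16/64. Hence 4/3 * 2 = 8/3, and 32/3 for a large square function, together at most
  14.\<close>

lemma measure_lincomb_le:
  fixes x :: "'b \<Rightarrow> 'a \<Rightarrow> real"
  assumes J: "finite J" and x: "\<And>a. a \<in> J \<Longrightarrow> x a \<in> borel_measurable M"
    and small: "\<And>K. K \<subseteq> J \<Longrightarrow> measure M {s\<in>space M. 1 \<le> \<bar>\<Sum>a\<in>K. x a s\<bar>} \<le> \<beta>"
    and h: "\<And>a. a \<in> J \<Longrightarrow> \<bar>h a\<bar> \<le> 1"
  shows "measure M {s\<in>space M. 10 \<le> \<bar>lincomb J x h s\<bar>} \<le> 14 * \<beta>"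
proof -
  obtain as where as: "distinct as" "set as = J" using finite_distinct_list[OF J] by auto
  define L where "L = map (\<lambda>b. (h b, \<lambda>a. of_bool (a = b) :: real)) as"
  have p: "\<forall>(p, f)\<in>set L. \<bar>p\<bar> \<le> 1" using h as by (auto simp: L_def)
  have mQ [measurable]: "(\<lambda>s. \<Sum>a\<in>J. (x a s)\<^sup>2) \<in> borel_measurable M"
    using x by (intro borel_measurable_sum) auto
  have [measurable]: "lincomb J x g \<in> borel_measurable M" for g
    by (rule borel_measurable_lincomb[OF x])
  note I = integral_coin_signs_le[where h = h, OF as x small, folded L_def]
  let ?P = "\<lambda>s. 10 \<le> \<bar>lincomb J x h s\<bar> \<and> (\<Sum>a\<in>J. (x a s)\<^sup>2) < 16"
  have "3 / 4 * measure M {s\<in>space M. ?P s} = (\<integral>s. 3 / 4 * of_bool (?P s) \<partial>M)"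
    by (subst integral_mult_right_zero, subst integral_of_bool) auto
  also have "\<dots> \<le> (\<integral>s. cexp L (\<lambda>g. of_bool (2 \<le> \<bar>lincomb J x g s\<bar>)) \<partial>M)"
  proof (rule integral_mono)
    fix s assume "s \<in> space M"
    show "3 / 4 * of_bool (?P s) \<le> cexp L (\<lambda>g. of_bool (2 \<le> \<bar>lincomb J x g s\<bar>))"
    proof (cases "?P s")
      case True
      let ?l = "\<lambda>g. lincomb J x g s"
      have mean: "(\<Sum>(p, f)\<leftarrow>L. p * ?l f) = ?l h"
        using as J
        by (simp add: L_def o_def sum_list_distinct_conv_sum_set lincomb_indicator)
          (simp add: lincomb_def)
      have "(\<Sum>(p, f)\<leftarrow>L. (1 - p\<^sup>2) * (?l f)\<^sup>2) = (\<Sum>a\<in>J. (1 - (h a)\<^sup>2) * (x a s)\<^sup>2)"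
        using as J by (simp add: L_def o_def sum_list_distinct_conv_sum_set lincomb_indicator)
      also have "\<dots> \<le> (\<Sum>a\<in>J. 1 * (x a s)\<^sup>2)" by (intro sum_mono mult_right_mono) auto
      also have "\<dots> \<le> 16" using True by simp
      finally have var: "cexp L (\<lambda>g. (?l g - ?l h)\<^sup>2) \<le> 16"
        unfolding cexp_square[OF additive_fun_lincomb] mean by simp
      have "3 / 4 \<le> 1 - 1 / 64 * cexp L (\<lambda>g. (?l g - ?l h)\<^sup>2)" using var by simp
      also have "\<dots> = cexp L (\<lambda>g. 1 - 1 / 64 * (?l g - ?l h)\<^sup>2)"
        by (simp only: cexp_diff cexp_cmult cexp_const)
      also have "\<dots> \<le> cexp L (\<lambda>g. of_bool (2 \<le> \<bar>lincomb J x g s\<bar>))"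
      proof (rule cexp_mono[OF p])
        fix w g
        have "64 \<le> (?l g - ?l h)\<^sup>2" if "\<not> 2 \<le> \<bar>?l g\<bar>"
        proof -
          have "8 \<le> \<bar>?l g - ?l h\<bar>" using that True by linarith
          then have "8\<^sup>2 \<le> \<bar>?l g - ?l h\<bar>\<^sup>2" by (intro power_mono) auto
          then show ?thesis by simp
        qed
        then show "1 - 1 / 64 * (?l g - ?l h)\<^sup>2 \<le> of_bool (2 \<le> \<bar>lincomb J x g s\<bar>)"
          by (cases "2 \<le> \<bar>?l g\<bar>") auto
      qed
      finally show ?thesis using True by simp
    next
      case False
      have "cexp L (\<lambda>g. 0) \<le> cexp L (\<lambda>g. of_bool (2 \<le> \<bar>lincomb J x g s\<bar>))"
        by (rule cexp_mono[OF p]) auto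
      moreover have "(of_bool (?P s) :: real) = 0" using False by simp
      ultimately show ?thesis by (simp only: mult_zero_right cexp_const)
    qed
  next
    show "integrable M (\<lambda>s. 3 / 4 * of_bool (?P s) :: real)"
      by (intro integrable_mult_right integral_of_bool) measurable
  qed (use I h in auto)
  also have "\<dots> \<le> 2 * \<beta>" using I h by auto
  finally have 1: "measure M {s\<in>space M. ?P s} \<le> 8 / 3 * \<beta>" by simp
  have \<beta>: "0 \<le> \<beta>" using measure_nonneg[of M] small[of "{}"] order_trans by blast
  have "measure M {s\<in>space M. 10 \<le> \<bar>lincomb J x h s\<bar>} \<le>
      measure M ({s\<in>space M. ?P s} \<union> {s\<in>space M. 16 \<le> (\<Sum>a\<in>J. (x a s)\<^sup>2)})"
    by (intro finite_measure_mono) auto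
  also have "\<dots> \<le> measure M {s\<in>space M. ?P s} + measure M {s\<in>space M. 16 \<le> (\<Sum>a\<in>J. (x a s)\<^sup>2)}"
    by (intro measure_Un_le) auto
  also have "\<dots> \<le> 8 / 3 * \<beta> + 32 / 3 * \<beta>"
    using 1 measure_square_function_le[OF J x small] by simp
  also have "\<dots> \<le> 14 * \<beta>" using \<beta> by simp
  finally show ?thesis .
qed


text \<open>Grothendieck's inequality in \<open>L\<^sub>0\<close>. For a nearly optimal family \<open>F\<close>, random signs recover
  \<open>sqfun J x F\<close> from \<open>lincomb J x g\<close> with \<open>g\<close> a signed sum of \<open>F\<close>. The part of \<open>g\<close> bounded by 56
  contributes little by smallness, and the family of the unbounded parts, rescaled by the fourth
  moment bound, is admissible again; where \<open>sqfun J x F\<close> is large it would beat \<open>F\<close> by a factor 8.\<close>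

lemma measure_sqfun_le_bounded:
  fixes x :: "'b \<Rightarrow> 'a \<Rightarrow> real"
  assumes J: "finite J" and x: "\<And>a. a \<in> J \<Longrightarrow> x a \<in> borel_measurable M"
    and bdd: "\<And>a s. a \<in> J \<Longrightarrow> s \<in> space M \<Longrightarrow> \<bar>x a s\<bar> \<le> C"
    and small: "\<And>K. K \<subseteq> J \<Longrightarrow> measure M {s\<in>space M. 1 \<le> \<bar>\<Sum>a\<in>K. x a s\<bar>} \<le> \<beta>"
    and H: "admissible J H"
  shows "measure M {s\<in>space M. 10035201 \<le> sqfun J x H s} \<le> 628 * \<beta>"
proof -
  note mb = borel_measurable_sqfun[OF x] borel_measurable_lincomb[OF x]
  have [measurable]: "sqfun J x F \<in> borel_measurable M" "lincomb J x g \<in> borel_measurable M" for F g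
    by (rule mb; assumption)+
  have B: "sqfun J x F s \<le> (real (card J) * C)\<^sup>2" if "admissible J F" "s \<in> space M" for F s
    using that bdd by (intro sqfun_le[OF J]) auto
  \<comment> \<open>The threshold is 2 * 2240^2 + 1: where \<open>w\<close> is below 2240^2 =
    5017600, it makes the quotient \<open>(sqfun J x H s - w s) / (1 + w s)\<close> at least 1. The
    number 2240 is 4 * 560, and 560 is 10 * 56.\<close>
  define Y where "Y = {s\<in>space M. 10035201 \<le> sqfun J x H s}"
  have Y [measurable]: "Y \<in> sets M" unfolding Y_def by measurable
  have \<beta>: "0 \<le> \<beta>" using measure_nonneg[of M] small[of "{}"] order_trans by blast
  have main: "measure M Y \<le> 9 / 5 * \<iota> + 628 * \<beta>" if \<iota>: "0 < \<iota>" for \<iota>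
  proof -
    obtain F where F: "admissible J F"
      and opt: "\<And>G. admissible J G \<Longrightarrow>
        (\<integral>s. indicator Y s * ((sqfun J x G s - sqfun J x F s) / (1 + sqfun J x F s)) \<partial>M) \<le> \<iota>"
      by (rule log_optimal[where x = x and C = C, OF J x bdd Y \<iota>]) blast+
    define w where "w = sqfun J x F"
    have w0: "0 \<le> w s" for s by (simp add: w_def sqfun_nonneg)
    have [measurable]: "w \<in> borel_measurable M" unfolding w_def by measurable
    have int: "integrable M (\<lambda>s. indicator Y s * ((sqfun J x G s - w s) / (1 + w s)))"
      if G: "admissible J G" for G
    proof (rule integrable_bounded[of _ "(real (card J) * C)\<^sup>2 + 1"])
      fix s assume s: "s \<in> space M"
      have "\<bar>(sqfun J x G s - w s) / (1 + w s)\<bar> \<le> (sqfun J x G s + w s) / (1 + w s)"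
        using w0[of s] sqfun_nonneg[of J x G s] by (simp add: divide_right_mono)
      also have "\<dots> = sqfun J x G s / (1 + w s) + w s / (1 + w s)"
        by (simp add: add_divide_distrib)
      also have "\<dots> \<le> sqfun J x G s / 1 + 1"
        using w0[of s] sqfun_nonneg[of J x G s] by (intro add_mono divide_left_mono) auto
      also have "\<dots> \<le> (real (card J) * C)\<^sup>2 + 1" using B[OF G s] by simp
      finally have *: "\<bar>(sqfun J x G s - w s) / (1 + w s)\<bar> \<le> (real (card J) * C)\<^sup>2 + 1" .
      show "\<bar>indicator Y s * ((sqfun J x G s - w s) / (1 + w s))\<bar> \<le> (real (card J) * C)\<^sup>2 + 1"
        using * by (cases "s \<in> Y") auto
    qed measurable
    \<comment> \<open>The quotient is at least -1 everywhere because square functions are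
      nonnegative. Optimality tested with \<open>G\<close> therefore limits the measure of any part
      of \<open>Y\<close> on which \<open>G\<close> beats \<open>F\<close> by a fixed
      factor.\<close>
    have low: "c * measure M {s\<in>space M. P s} - measure M Y \<le> \<iota>"
      if G: "admissible J G" and P [measurable]: "Measurable.pred M P"
        and PY: "\<And>s. s \<in> space M \<Longrightarrow> P s \<Longrightarrow> s \<in> Y"
        and c: "\<And>s. s \<in> space M \<Longrightarrow> P s \<Longrightarrow> c - 1 \<le> (sqfun J x G s - w s) / (1 + w s)" for G P c
    proof -
      have i: "integrable M (\<lambda>s. of_bool (P s) :: real)" by (rule integral_of_bool[OF P])
      have iY: "integrable M (indicator Y :: _ \<Rightarrow> real)"
        by (intro integrable_real_indicator) (auto simp: emeasure_eq_measure)
      have "c * measure M {s\<in>space M. P s} - measure M Y =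
          (\<integral>s. c * of_bool (P s) - indicator Y s \<partial>M)"
        using i iY sets.sets_into_space[OF Y]
        by (simp add: integral_of_bool(2)[OF P] Bochner_Integration.integral_diff Int_absorb2)
      also have "\<dots> \<le> (\<integral>s. indicator Y s * ((sqfun J x G s - w s) / (1 + w s)) \<partial>M)"
      proof (rule integral_mono)
        fix s assume s: "s \<in> space M"
        have "-1 \<le> (sqfun J x G s - w s) / (1 + w s)"
          using w0[of s] sqfun_nonneg[of J x G s] by (simp add: field_simps)
        then show "c * of_bool (P s) - indicator Y s \<le>
            indicator Y s * ((sqfun J x G s - w s) / (1 + w s))"
          using PY[OF s] c[OF s] by (cases "P s"; cases "s \<in> Y") auto
      qed (use i iY int[OF G] in auto)
      also have "\<dots> \<le> \<iota>" using opt[OF G] by (simp add: w_def)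
      finally show ?thesis .
    qed
    \<comment> \<open>Beyond 56 one has y^2 \<le> y^4 / 3136, and the fourth moment is at most 3, so
      the tails can be enlarged by 3136/3 in square sum. The level 56 is high enough for 3136/3 *
      1/128 to exceed the required factor 8.\<close>
    define tl where "tl g = (\<lambda>a. if \<bar>g a\<bar> \<le> 56 then 0 else g a :: real)" for g :: "'b \<Rightarrow> real"
    define tr where "tr g = (\<lambda>a. if \<bar>g a\<bar> \<le> 56 then g a else 0 :: real)" for g :: "'b \<Rightarrow> real"
    define L where "L = map (Pair (0::real)) F"
    have p: "\<forall>(p, f)\<in>set L. \<bar>p\<bar> \<le> 1" by (auto simp: L_def)
    \<comment> \<open>The root of the probability \<open>u\<close> turns the expectation of squares
      into the square sum of a list.\<close>
    define G where "G = map (\<lambda>(u, g) a. sqrt (u * 3136 / 3) * tl g a) (coin L)"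
    have Gsum: "(\<Sum>f\<leftarrow>G. (l f)\<^sup>2) = 3136 / 3 * cexp L (\<lambda>g. (l (tl g))\<^sup>2)"
      if l: "\<And>c f. l (\<lambda>a. c * f a) = c * l f" for l :: "('b \<Rightarrow> real) \<Rightarrow> real"
    proof -
      have "(\<Sum>f\<leftarrow>G. (l f)\<^sup>2) = (\<Sum>(u, g)\<leftarrow>coin L. 3136 / 3 * (u * (l (tl g))\<^sup>2))"
        unfolding G_def map_map o_def
      proof (intro arg_cong[where f = sum_list] map_cong refl)
        fix ug assume ug: "ug \<in> set (coin L)"
        obtain u g where [simp]: "ug = (u, g)" by force
        have "0 \<le> u" using coin_nonneg[OF p] ug by auto
        then show "(l (case ug of (u, g) \<Rightarrow> \<lambda>a. sqrt (u * 3136 / 3) * tl g a))\<^sup>2 =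
            (case ug of (u, g) \<Rightarrow> 3136 / 3 * (u * (l (tl g))\<^sup>2))"
          by (simp add: l power_mult_distrib)
      qed
      then show ?thesis by (simp only: cexp_def case_prod_unfold sum_list_const_mult)
    qed
    have G: "admissible J G"
      unfolding admissible_def
    proof
      fix a assume a: "a \<in> J"
      let ?V = "\<Sum>f\<leftarrow>F. (f a)\<^sup>2"
      have "0 \<le> ?V" "?V \<le> 1"
        using F a by (auto simp: admissible_def intro!: sum_list_nonneg)
      have "(\<Sum>f\<leftarrow>G. (f a)\<^sup>2) = cexp L (\<lambda>g. 3136 / 3 * (tl g a)\<^sup>2)"
        by (subst Gsum[where l = "\<lambda>f. f a"]) (simp_all only: cexp_cmult)
      also have "\<dots> \<le> cexp L (\<lambda>g. 1 / 3 * (g a) ^ 4)"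
      proof (rule cexp_mono[OF p])
        fix u and g :: "'b \<Rightarrow> real"
        have "3136 * (g a)\<^sup>2 \<le> (g a) ^ 4" if "\<not> \<bar>g a\<bar> \<le> 56"
        proof -
          have "56\<^sup>2 \<le> \<bar>g a\<bar>\<^sup>2" using that by (intro power_mono) auto
          then have "3136 * (g a)\<^sup>2 \<le> (g a)\<^sup>2 * (g a)\<^sup>2" by (intro mult_right_mono) auto
          then show ?thesis by (simp add: power2_eq_square power4_eq_xxxx)
        qed
        moreover have "0 \<le> (g a) ^ 4" by (rule zero_le_even_power) simp
        ultimately show "3136 / 3 * (tl g a)\<^sup>2 \<le> 1 / 3 * (g a) ^ 4"
          by (auto simp: tl_def)
      qed
      also have "\<dots> \<le> 1 / 3 * (3 * ?V\<^sup>2)"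
        unfolding cexp_cmult L_def
        by (intro mult_left_mono cexp_fourth_unbiased additive_fun_apply) simp
      also have "\<dots> \<le> 1" using \<open>0 \<le> ?V\<close> \<open>?V \<le> 1\<close> by (simp add: power_le_one)
      finally show "(\<Sum>f\<leftarrow>G. (f a)\<^sup>2) \<le> 1" .
    qed
    \<comment> \<open>Probability, at \<open>s\<close>, that the truncated part is large. After
      division by 56 its coefficients lie in [-1, 1], so the bound for threshold 10 applies at 560.
      Markov's inequality at level 1/16 then costs the factor 16, giving 16 * 14 = 224.\<close>
    define bad where "bad s = cexp L (\<lambda>g. of_bool (560 \<le> \<bar>lincomb J x (tr g) s\<bar>))" for s
    have ib: "integrable M (\<lambda>s. of_bool (560 \<le> \<bar>lincomb J x (tr g) s\<bar>) :: real)" for g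
      by (intro integral_of_bool) measurable
    have bad_int: "integrable M bad" unfolding bad_def by (intro integral_cexp ib)
    then have [measurable]: "bad \<in> borel_measurable M" by auto
    have bad0: "0 \<le> bad s" for s
      using cexp_mono[OF p, of "\<lambda>_. 0" "\<lambda>g. of_bool (560 \<le> \<bar>lincomb J x (tr g) s\<bar>)"]
      by (simp add: bad_def)
    have "(\<integral>s. bad s \<partial>M) = cexp L (\<lambda>g. measure M {s\<in>space M. 560 \<le> \<bar>lincomb J x (tr g) s\<bar>})"
      unfolding bad_def by (subst integral_cexp[OF ib], subst integral_of_bool) auto
    also have "\<dots> \<le> cexp L (\<lambda>_. 14 * \<beta>)"
    proof (rule cexp_mono[OF p])
      fix u g
      let ?h = "\<lambda>a. 1 / 56 * tr g a"
      have eq: "lincomb J x ?h s = 1 / 56 * lincomb J x (tr g) s" for s by (rule lincomb_cmult)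
      have "measure M {s\<in>space M. 10 \<le> \<bar>lincomb J x ?h s\<bar>} \<le> 14 * \<beta>"
        by (rule measure_lincomb_le[OF J x small]) (auto simp: tr_def)
      moreover have "10 \<le> \<bar>1 / 56 * r\<bar> \<longleftrightarrow> 560 \<le> \<bar>r\<bar>" for r :: real by auto
      ultimately show "measure M {s\<in>space M. 560 \<le> \<bar>lincomb J x (tr g) s\<bar>} \<le> 14 * \<beta>"
        by (simp only: eq)
    qed
    finally have bad_le: "(\<integral>s. bad s \<partial>M) \<le> 14 * \<beta>" by simp
    have "1 / 16 * measure M {s\<in>space M. 1 / 16 \<le> bad s} = (\<integral>s. 1 / 16 * of_bool (1 / 16 \<le> bad s) \<partial>M)"
      by (subst integral_mult_right_zero, subst integral_of_bool) auto
    also have "\<dots> \<le> (\<integral>s. bad s \<partial>M)"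
      using bad0 by (intro integral_mono integrable_mult_right integral_of_bool bad_int) auto
    finally have bad_meas: "measure M {s\<in>space M. 1 / 16 \<le> bad s} \<le> 224 * \<beta>"
      using bad_le by simp
    \<comment> \<open>With probability at least 3/16 - 1/16 = 1/8 the full sum has modulus at least
      z / 2 while its truncated part stays below 560 \<le> z / 4. The tail is then at least z / 4,
      so its mean square is at least \<open>w s / 128\<close>.\<close>
    have amplify: "8 * w s \<le> sqfun J x G s" if ws: "5017600 \<le> w s" and b: "bad s < 1 / 16" for s
    proof -
      let ?l = "\<lambda>g. lincomb J x g s"
      define z where "z = sqrt (w s)"
      have z2: "z\<^sup>2 = w s" using w0 by (simp add: z_def)
      have z: "2240 \<le> z" unfolding z_def using ws by (intro real_le_rsqrt) simp
      have "3 / 16 - 1 / 16 \<le> cexp L (\<lambda>g. of_bool (w s \<le> 4 * (?l g)\<^sup>2)) - bad s"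
        using b Paley_Zygmund_signs[OF additive_fun_lincomb[of J x s], of F]
        by (simp add: L_def w_def sqfun_def)
      also have "\<dots> = cexp L (\<lambda>g. of_bool (w s \<le> 4 * (?l g)\<^sup>2) - of_bool (560 \<le> \<bar>?l (tr g)\<bar>))"
        by (simp add: bad_def cexp_diff)
      also have "\<dots> \<le> cexp L (\<lambda>g. 16 / w s * (?l (tl g))\<^sup>2)"
      proof (rule cexp_mono[OF p])
        fix u g
        have "1 \<le> 16 / w s * (?l (tl g))\<^sup>2" if 1: "w s \<le> 4 * (?l g)\<^sup>2" and 2: "\<not> 560 \<le> \<bar>?l (tr g)\<bar>"
        proof -
          have "z\<^sup>2 \<le> (2 * \<bar>?l g\<bar>)\<^sup>2" using 1 z2 by (simp add: power_mult_distrib)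
          then have "z \<le> 2 * \<bar>?l g\<bar>" by (rule power2_le_imp_le) simp
          moreover have "?l g = ?l (tl g) + ?l (tr g)"
            by (simp add: lincomb_def tl_def tr_def sum.distrib[symmetric] if_distrib[of "\<lambda>t. t * _"] cong: if_cong)
              (rule sum.cong, auto)
          ultimately have "z / 4 \<le> \<bar>?l (tl g)\<bar>" using 2 z by linarith
          then have "(z / 4)\<^sup>2 \<le> \<bar>?l (tl g)\<bar>\<^sup>2" using z by (intro power_mono) auto
          then have "w s / 16 \<le> (?l (tl g))\<^sup>2" by (simp add: power_divide z2)
          then show ?thesis using ws by (simp add: field_simps)
        qed
        moreover have "0 \<le> 16 / w s * (?l (tl g))\<^sup>2" using w0 by simp
        ultimately show "of_bool (w s \<le> 4 * (?l g)\<^sup>2) - of_bool (560 \<le> \<bar>?l (tr g)\<bar>) \<le> 16 / w s * (?l (tl g))\<^sup>2"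
          by (cases "w s \<le> 4 * (?l g)\<^sup>2"; cases "560 \<le> \<bar>?l (tr g)\<bar>") auto
      qed
      also have "\<dots> = 16 / w s * cexp L (\<lambda>g. (?l (tl g))\<^sup>2)" by (rule cexp_cmult)
      finally have "w s / 128 \<le> cexp L (\<lambda>g. (?l (tl g))\<^sup>2)"
        using ws by (simp add: field_simps)
      moreover have "sqfun J x G s = 3136 / 3 * cexp L (\<lambda>g. (?l (tl g))\<^sup>2)"
        unfolding sqfun_def by (rule Gsum) (rule lincomb_cmult)
      ultimately show ?thesis using w0[of s] by linarith
    qed
    let ?P = "\<lambda>s. s \<in> Y \<and> 5017600 \<le> w s \<and> bad s < 1 / 16"
    let ?Q = "\<lambda>s. s \<in> Y \<and> w s < 5017600"
    have 1: "7 * measure M {s\<in>space M. ?P s} - measure M Y \<le> \<iota>"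
    proof (rule low[OF G])
      fix s assume "?P s"
      then have "8 * w s \<le> sqfun J x G s" "5017600 \<le> w s" using amplify by auto
      then show "7 - 1 \<le> (sqfun J x G s - w s) / (1 + w s)" by (simp add: field_simps)
    qed auto
    have 2: "2 * measure M {s\<in>space M. ?Q s} - measure M Y \<le> \<iota>"
    proof (rule low[OF H])
      fix s assume "?Q s"
      then show "2 - 1 \<le> (sqfun J x H s - w s) / (1 + w s)" using w0[of s] by (simp add: field_simps Y_def)
    qed auto
    have "measure M Y \<le> measure M (({s\<in>space M. ?P s} \<union> {s\<in>space M. 1 / 16 \<le> bad s}) \<union> {s\<in>space M. ?Q s})"
      using sets.sets_into_space[OF Y] by (intro finite_measure_mono) auto
    also have "\<dots> \<le> measure M ({s\<in>space M. ?P s} \<union> {s\<in>space M. 1 / 16 \<le> bad s}) + measure M {s\<in>space M. ?Q s}"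
      by (intro measure_Un_le) auto
    also have "\<dots> \<le> measure M {s\<in>space M. ?P s} + measure M {s\<in>space M. 1 / 16 \<le> bad s} + measure M {s\<in>space M. ?Q s}"
      by (intro add_right_mono measure_Un_le) auto
    \<comment> \<open>The measure of \<open>Y\<close> reappears on the right with coefficient 1/7 +
      1/2 = 9/14 and is absorbed; 224 * 14/5 = 627.2 is rounded up to 628.\<close>
    finally show ?thesis using 1 2 bad_meas \<beta> by linarith
  qed
  have "measure M Y \<le> 628 * \<beta> + e" if "0 < e" for e
    using main[of "5 / 9 * e"] that by simp
  then show ?thesis unfolding Y_def by (rule field_le_epsilon)
qed

lemma measure_sqfun_le:
  fixes x :: "'b \<Rightarrow> 'a \<Rightarrow> real"
  assumes J: "finite J" and x: "\<And>a. a \<in> J \<Longrightarrow> x a \<in> borel_measurable M"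
    and bdd: "\<And>a s. a \<in> J \<Longrightarrow> s \<in> space M \<Longrightarrow> \<bar>x a s\<bar> \<le> C"
    and t: "0 < t"
    and small: "\<And>K. K \<subseteq> J \<Longrightarrow> measure M {s\<in>space M. t \<le> \<bar>\<Sum>a\<in>K. x a s\<bar>} \<le> \<beta>"
    and H: "admissible J H"
  shows "measure M {s\<in>space M. 10035201 * t\<^sup>2 \<le> sqfun J x H s} \<le> 628 * \<beta>"
proof -
  let ?y = "\<lambda>a s. x a s / t"
  have lin: "lincomb J ?y f s = lincomb J x f s / t" for f s
    by (simp add: lincomb_def sum_divide_distrib)
  have sq: "sqfun J ?y H s = sqfun J x H s / t\<^sup>2" for s
    unfolding sqfun_def lin power_divide by (induction H) (auto simp: add_divide_distrib)
  have "measure M {s\<in>space M. 10035201 \<le> sqfun J ?y H s} \<le> 628 * \<beta>"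
  proof (rule measure_sqfun_le_bounded[OF J])
    show "\<bar>?y a s\<bar> \<le> C / t" if "a \<in> J" "s \<in> space M" for a s
      using bdd[OF that] t by (simp add: divide_right_mono)
    show "measure M {s\<in>space M. 1 \<le> \<bar>\<Sum>a\<in>K. ?y a s\<bar>} \<le> \<beta>" if "K \<subseteq> J" for K
      using small[OF that] t by (simp add: sum_divide_distrib[symmetric] field_simps)
  qed (use x H in auto)
  then show ?thesis using t by (simp add: sq field_simps)
qed

end

text \<open>The first term comes from the points where the square function is small,
  \<open>314 * sqrt t\<close> from the exceptional set of measure at most \<open>628 * t\<close>,
  and \<open>(c + 1) / 2 * sqrt t\<close> from the optimality bound \<open>c + 1\<close> for the
  weighted integral. It depends only on \<open>t\<close> and the total mass \<open>c\<close>, hence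
  is the same for every partition.\<close>

definition modulus :: "real \<Rightarrow> real \<Rightarrow> real" where
  "modulus c t = 3168 * t * c + (314 + (c + 1) / 2) * sqrt t"

lemma modulus_tendsto_0: "((\<lambda>t. modulus c t) \<longlongrightarrow> 0) (at_right 0)"
proof -
  have "((\<lambda>t. modulus c t) \<longlongrightarrow> modulus c 0) (at_right 0)"
    unfolding modulus_def by (intro tendsto_intros)
  then show ?thesis by (simp add: modulus_def)
qed

context finite_measure
begin

text \<open>With \<open>w\<close> the square function of a log-optimal family \<open>F\<close>, the set function is
  \<open>J \<mapsto> \<integral> (\<Sum>f\<leftarrow>F. lincomb I x f * lincomb J x f) / (1 + w)\<close>. Optimality bounds the integral of
  \<open>sqfun J x F / (1 + w)\<close>, so that smallness of \<open>sqfun J x F\<close> in measure is enough to make it small.\<close>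

lemma finite_stage_bounded:
  fixes x :: "'b \<Rightarrow> 'a \<Rightarrow> real"
  assumes I: "finite I" and x: "\<And>a. a \<in> I \<Longrightarrow> x a \<in> borel_measurable M"
    and bdd: "\<And>a s. a \<in> I \<Longrightarrow> s \<in> space M \<Longrightarrow> \<bar>x a s\<bar> \<le> C"
    and \<epsilon>: "0 < \<epsilon>" and b: "0 < b" "b \<le> measure M {s\<in>space M. \<epsilon> \<le> \<bar>\<Sum>a\<in>I. x a s\<bar>}"
  obtains \<nu> :: "'b \<Rightarrow> real" where "b * \<epsilon>\<^sup>2 / (2 * (1 + \<epsilon>\<^sup>2)) \<le> (\<Sum>a\<in>I. \<nu> a)"
    and "\<And>J t. J \<subseteq> I \<Longrightarrow> 0 < t \<Longrightarrow>
      (\<And>K. K \<subseteq> J \<Longrightarrow> measure M {s\<in>space M. t \<le> \<bar>\<Sum>a\<in>K. x a s\<bar>} \<le> t) \<Longrightarrow>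
      (\<Sum>a\<in>J. \<nu> a) \<le> modulus (measure M (space M)) t"
proof -
  let ?m = "measure M (space M)"
  \<comment> \<open>The bound 1 produces the \<open>c + 1\<close> in \<open>modulus\<close>; the
    other bound leaves half of the lower estimate for the total.\<close>
  define \<iota> where "\<iota> = min 1 (b * \<epsilon>\<^sup>2 / 2)"
  have \<iota>: "0 < \<iota>" "\<iota> \<le> 1" "\<iota> \<le> b * \<epsilon>\<^sup>2 / 2" using b \<epsilon> by (simp_all add: \<iota>_def)
  obtain F where F: "admissible I F"
    and opt: "\<And>G. admissible I G \<Longrightarrow>
      (\<integral>s. indicator (space M) s * ((sqfun I x G s - sqfun I x F s) / (1 + sqfun I x F s)) \<partial>M) \<le> \<iota>"
    by (rule log_optimal[where x = x and C = C, OF I x bdd sets.top \<iota>(1)]) blast+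
  have mb: "sqfun J x G \<in> borel_measurable M" "lincomb J x g \<in> borel_measurable M" if "J \<subseteq> I" for G g J
    using that x by (auto intro!: borel_measurable_sqfun borel_measurable_lincomb)
  have B: "sqfun J x G s \<le> (real (card J) * C)\<^sup>2" if "admissible I G" "J \<subseteq> I" "s \<in> space M" for G J s
    using that bdd by (intro sqfun_le finite_subset[OF _ I]) (auto intro: admissible_mono)
  define w where "w = sqfun I x F"
  have w0: "0 \<le> w s" for s by (simp add: w_def sqfun_nonneg)
  have [measurable]: "w \<in> borel_measurable M" unfolding w_def by (rule mb) simp
  have iq: "integrable M (\<lambda>s. sqfun J x G s / (1 + w s))" if "admissible I G" "J \<subseteq> I" for G J
  proof (rule integrable_bounded[of _ "(real (card J) * C)\<^sup>2"])
    fix s assume s: "s \<in> space M"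
    have "sqfun J x G s / (1 + w s) \<le> sqfun J x G s / 1"
      using w0[of s] sqfun_nonneg[of J x G s] by (intro divide_left_mono) auto
    with B[OF that s] show "\<bar>sqfun J x G s / (1 + w s)\<bar> \<le> (real (card J) * C)\<^sup>2"
      using w0[of s] sqfun_nonneg[of J x G s] by simp
  qed (use mb(1)[OF that(2), of G] in measurable)
  have opt': "(\<integral>s. sqfun J x G s / (1 + w s) \<partial>M) \<le> (\<integral>s. w s / (1 + w s) \<partial>M) + \<iota>"
    if G: "admissible I G" and J: "J \<subseteq> I" for G J
  proof -
    \<comment> \<open>Coefficients cut off outside \<open>J\<close> remain admissible on
      \<open>I\<close>, so optimality on \<open>I\<close> also controls the square functions of
      subfamilies.\<close>
    let ?G = "map (\<lambda>f a. if a \<in> J then f a else 0) G"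
    have lin: "lincomb I x (\<lambda>a. if a \<in> J then f a else 0) s = lincomb J x f s" for f s
      unfolding lincomb_def using J I
      by (simp add: if_distrib[of "\<lambda>t. t * _"] sum.If_cases Int_absorb1 cong: if_cong)
    have "sqfun I x ?G = sqfun J x G" by (auto simp: sqfun_def o_def lin)
    moreover have "admissible I ?G"
      unfolding admissible_def
    proof
      fix a assume "a \<in> I"
      then show "(\<Sum>f\<leftarrow>?G. (f a)\<^sup>2) \<le> 1"
        using G by (cases "a \<in> J") (auto simp: admissible_def o_def)
    qed
    ultimately have "(\<integral>s. indicator (space M) s * ((sqfun J x G s - w s) / (1 + w s)) \<partial>M) \<le> \<iota>"
      using opt[of ?G] by (simp add: w_def)
    also have "(\<integral>s. indicator (space M) s * ((sqfun J x G s - w s) / (1 + w s)) \<partial>M) =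
        (\<integral>s. sqfun J x G s / (1 + w s) - w s / (1 + w s) \<partial>M)"
      by (rule Bochner_Integration.integral_cong) (auto simp: diff_divide_distrib)
    also have "\<dots> = (\<integral>s. sqfun J x G s / (1 + w s) \<partial>M) - (\<integral>s. w s / (1 + w s) \<partial>M)"
      using iq[OF G J] iq[OF F order_refl] by (intro Bochner_Integration.integral_diff) (auto simp: w_def)
    finally show ?thesis by simp
  qed
  have iw: "integrable M (\<lambda>s. w s / (1 + w s))" using iq[OF F order_refl] by (simp add: w_def)
  have w1: "w s / (1 + w s) \<le> 1" for s using w0[of s] by simp
  have wm: "(\<integral>s. w s / (1 + w s) \<partial>M) \<le> ?m"
  proof -
    have "(\<integral>s. w s / (1 + w s) \<partial>M) \<le> (\<integral>s. 1 \<partial>M)" using iw w1 by (intro integral_mono) auto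
    then show ?thesis by simp
  qed
  define cr where "cr J s = (\<Sum>f\<leftarrow>F. lincomb I x f s * lincomb J x f s)" for J s
  \<comment> \<open>The arithmetic-geometric inequality for the inner product \<open>cr\<close>,
    with a free weight \<open>c\<close>. The value 1 serves integrability; the other choices balance
    the final estimate.\<close>
  have cr_le: "\<bar>cr J s\<bar> \<le> (c * w s + sqfun J x F s / c) / 2" if c: "0 < c" for J s c
  proof -
    have "\<bar>\<Sum>f\<leftarrow>F. lincomb I x f s * lincomb J x f s\<bar> \<le> (\<Sum>f\<leftarrow>F. \<bar>lincomb I x f s * lincomb J x f s\<bar>)"
      by (induction F) auto
    also have "\<dots> \<le> (\<Sum>f\<leftarrow>F. c / 2 * (lincomb I x f s)\<^sup>2 + 1 / (2 * c) * (lincomb J x f s)\<^sup>2)"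
    proof (rule sum_list_mono)
      fix f
      let ?u = "\<bar>lincomb I x f s\<bar>" and ?v = "\<bar>lincomb J x f s\<bar>"
      have "0 \<le> (c * ?u - ?v)\<^sup>2 / (2 * c)" using c by simp
      also have "\<dots> = c / 2 * ?u\<^sup>2 + 1 / (2 * c) * ?v\<^sup>2 - ?u * ?v"
        using c by (simp add: power2_eq_square field_simps)
      finally show "\<bar>lincomb I x f s * lincomb J x f s\<bar> \<le>
          c / 2 * (lincomb I x f s)\<^sup>2 + 1 / (2 * c) * (lincomb J x f s)\<^sup>2"
        by (simp add: abs_mult)
    qed
    also have "\<dots> = c / 2 * w s + 1 / (2 * c) * sqfun J x F s"
      by (simp only: sum_list_addf sum_list_const_mult w_def sqfun_def)
    finally show ?thesis by (simp add: cr_def add_divide_distrib mult.commute)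
  qed
  have crm: "cr J \<in> borel_measurable M" if "J \<subseteq> I" for J
  proof -
    have "(\<lambda>s. \<Sum>f\<leftarrow>G. lincomb I x f s * lincomb J x f s) \<in> borel_measurable M" for G
      using mb(2)[OF that] mb(2)[OF order_refl] by (induction G) simp_all
    then show ?thesis by (simp add: cr_def[abs_def])
  qed
  have ic: "integrable M (\<lambda>s. cr J s / (1 + w s))" if J: "J \<subseteq> I" for J
  proof (rule Bochner_Integration.integrable_bound)
    show "integrable M (\<lambda>s. w s / (1 + w s) + sqfun J x F s / (1 + w s))"
      using iw iq[OF F J] by simp
    show "(\<lambda>s. cr J s / (1 + w s)) \<in> borel_measurable M" using crm[OF J] by simp
    have "\<bar>cr J s\<bar> / (1 + w s) \<le> w s / (1 + w s) + sqfun J x F s / (1 + w s)" for s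
      using cr_le[of 1 J s] w0[of s] sqfun_nonneg[of J x F s]
      by (simp add: add_divide_distrib[symmetric] divide_right_mono)
    then show "AE s in M. norm (cr J s / (1 + w s)) \<le> norm (w s / (1 + w s) + sqfun J x F s / (1 + w s))"
      using w0 sqfun_nonneg[of J x F] by (simp add: abs_of_nonneg)
  qed
  define \<nu> where "\<nu> a = (\<integral>s. cr {a} s / (1 + w s) \<partial>M)" for a
  have \<nu>: "(\<Sum>a\<in>J. \<nu> a) = (\<integral>s. cr J s / (1 + w s) \<partial>M)" if J: "J \<subseteq> I" for J
  proof -
    have "cr J s = (\<Sum>a\<in>J. cr {a} s)" for s
      unfolding cr_def lincomb_def
      by (induction F) (simp_all add: sum.distrib sum_distrib_left)
    then have "cr J s / (1 + w s) = (\<Sum>a\<in>J. cr {a} s / (1 + w s))" for s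
      by (simp add: sum_divide_distrib)
    moreover have "(\<integral>s. (\<Sum>a\<in>J. cr {a} s / (1 + w s)) \<partial>M) = (\<Sum>a\<in>J. \<nu> a)"
      unfolding \<nu>_def by (rule Bochner_Integration.integral_sum) (use J in \<open>auto intro!: ic\<close>)
    ultimately show ?thesis by simp
  qed
  show ?thesis
  proof (rule that[of \<nu>])
    have crI: "cr I = w" by (auto simp: cr_def w_def sqfun_def power2_eq_square)
    let ?P = "\<lambda>s. \<epsilon> \<le> \<bar>\<Sum>a\<in>I. x a s\<bar>"
    have P [measurable]: "Measurable.pred M ?P"
    proof -
      have [measurable]: "(\<lambda>s. \<Sum>a\<in>I. x a s) \<in> borel_measurable M" using x by (intro borel_measurable_sum)
      show ?thesis by measurable
    qed
    \<comment> \<open>The competitor for the lower bound: the constant coefficient 1 has square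
      function \<open>(\<Sum>a\<in>I. x a s)^2\<close>, which is at least
      \<open>\<epsilon>^2\<close> on a set of measure at least \<open>b\<close>. Optimality
      transfers this to \<open>w\<close>, and \<open>cr I\<close> equals \<open>w\<close>.\<close>
    have one: "admissible I [\<lambda>_. 1]" by (simp add: admissible_def)
    have sq1: "sqfun I x [\<lambda>_. 1] s = (\<Sum>a\<in>I. x a s)\<^sup>2" for s by (simp add: sqfun_def lincomb_def)
    have "b * \<epsilon>\<^sup>2 \<le> (\<integral>s. \<epsilon>\<^sup>2 * of_bool (?P s) \<partial>M)"
      using mult_left_mono[OF b(2), of "\<epsilon>\<^sup>2"]
      by (simp only: integral_mult_right_zero integral_of_bool(2)[OF P] mult.commute[of b] zero_le_power2)
    also have "\<dots> \<le> (\<integral>s. sqfun I x [\<lambda>_. 1] s / (1 + w s) + \<epsilon>\<^sup>2 * (w s / (1 + w s)) \<partial>M)"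
    proof (rule integral_mono)
      fix s
      show "\<epsilon>\<^sup>2 * of_bool (?P s) \<le> sqfun I x [\<lambda>_. 1] s / (1 + w s) + \<epsilon>\<^sup>2 * (w s / (1 + w s))"
      proof (cases "?P s")
        case True
        then have "\<epsilon>\<^sup>2 \<le> \<bar>\<Sum>a\<in>I. x a s\<bar>\<^sup>2" using \<epsilon> by (intro power_mono) auto
        then have "\<epsilon>\<^sup>2 / (1 + w s) \<le> sqfun I x [\<lambda>_. 1] s / (1 + w s)"
          using w0[of s] by (intro divide_right_mono) (auto simp: sq1)
        moreover have "\<epsilon>\<^sup>2 / (1 + w s) + \<epsilon>\<^sup>2 * (w s / (1 + w s)) = \<epsilon>\<^sup>2"
          using w0[of s] by (simp add: field_simps add_nonneg_eq_0_iff)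
        ultimately show ?thesis using True by simp
      next
        case False
        then show ?thesis using w0[of s] sqfun_nonneg[of I x "[\<lambda>_. 1]" s] by simp
      qed
    next
      show "integrable M (\<lambda>s. \<epsilon>\<^sup>2 * of_bool (?P s) :: real)"
        by (intro integrable_mult_right integral_of_bool P)
    qed (intro Bochner_Integration.integrable_add integrable_mult_right iq[OF one order_refl] iw)
    also have "\<dots> = (\<integral>s. sqfun I x [\<lambda>_. 1] s / (1 + w s) \<partial>M) + \<epsilon>\<^sup>2 * (\<integral>s. w s / (1 + w s) \<partial>M)"
      using iq[OF one order_refl] iw by (simp del: times_divide_eq_right)
    also have "\<dots> \<le> (1 + \<epsilon>\<^sup>2) * (\<integral>s. w s / (1 + w s) \<partial>M) + b * \<epsilon>\<^sup>2 / 2"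
      using opt'[OF one order_refl] \<iota>(3) by (simp add: algebra_simps)
    finally have "b * \<epsilon>\<^sup>2 / 2 \<le> (1 + \<epsilon>\<^sup>2) * (\<Sum>a\<in>I. \<nu> a)"
      by (simp add: \<nu> crI)
    moreover have "0 < 1 + \<epsilon>\<^sup>2" by (simp add: add_pos_nonneg)
    ultimately show "b * \<epsilon>\<^sup>2 / (2 * (1 + \<epsilon>\<^sup>2)) \<le> (\<Sum>a\<in>I. \<nu> a)"
      by (simp add: field_simps)
  next
    fix J t assume J: "J \<subseteq> I" and t: "0 < (t::real)"
      and small: "\<And>K. K \<subseteq> J \<Longrightarrow> measure M {s\<in>space M. t \<le> \<bar>\<Sum>a\<in>K. x a s\<bar>} \<le> t"
    define P where "P s \<longleftrightarrow> 10035201 * t\<^sup>2 \<le> sqfun J x F s" for s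
    have [measurable]: "Measurable.pred M P"
      unfolding P_def using mb(1)[OF J, of F] by measurable
    have Pm: "measure M {s\<in>space M. P s} \<le> 628 * t"
      unfolding P_def
    proof (rule measure_sqfun_le[OF finite_subset[OF J I] _ _ t small])
      show "admissible J F" using F J by (rule admissible_mono)
    qed (use x bdd J in auto)
    have iP: "integrable M (\<lambda>s. of_bool (P s) :: real)" by (intro integral_of_bool) simp
    let ?r = "sqrt t"
    have r: "0 < ?r" using t by simp
    \<comment> \<open>On the exceptional set the weight in \<open>cr_le\<close> is
      \<open>1 / sqrt t\<close>: the set has measure of order \<open>t\<close>, so bounding w / (1 +
      w) by 1 costs only order \<open>sqrt t\<close>. Elsewhere the weight is
      \<open>3168 * t\<close>, where 3168^2 = 10036224 exceeds 10035201.\<close>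
    have pt: "cr J s / (1 + w s) \<le> 3168 * t + (1 / (2 * ?r) * of_bool (P s) + ?r / 2 * (sqfun J x F s / (1 + w s)))"
      (is "_ \<le> ?R s") for s
    proof (cases "P s")
      case True
      have "cr J s \<le> (1 / ?r * w s + ?r * sqfun J x F s) / 2"
        using cr_le[of "1 / ?r" J s] r by (simp add: mult.commute)
      then have "cr J s / (1 + w s) \<le> (1 / ?r * w s + ?r * sqfun J x F s) / 2 / (1 + w s)"
        using w0[of s] by (intro divide_right_mono) auto
      also have "\<dots> = 1 / (2 * ?r) * (w s / (1 + w s)) + ?r / 2 * (sqfun J x F s / (1 + w s))"
        by (simp add: add_divide_distrib)
      also have "\<dots> \<le> 1 / (2 * ?r) * 1 + ?r / 2 * (sqfun J x F s / (1 + w s))"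
        using w1 r by (intro add_right_mono mult_left_mono) auto
      finally show ?thesis using True t by simp
    next
      case False
      define c where "c = 3168 * t"
      have "c\<^sup>2 = 10036224 * t\<^sup>2" by (simp add: c_def power_mult_distrib)
      moreover have "0 \<le> t\<^sup>2" by simp
      ultimately have "sqfun J x F s \<le> c\<^sup>2" using False unfolding P_def by linarith
      then have c: "0 < c" "sqfun J x F s \<le> c\<^sup>2" using t by (auto simp: c_def)
      have "cr J s \<le> (c * w s + sqfun J x F s / c) / 2"
        using cr_le[OF c(1), of J s] by simp
      also have "\<dots> \<le> (c * w s + c) / 2"
        using c by (simp add: divide_le_eq power2_eq_square)
      also have "\<dots> \<le> c * (1 + w s)" using c w0[of s] by (simp add: algebra_simps)
      finally have "cr J s / (1 + w s) \<le> c" using w0[of s] by (simp add: divide_le_eq)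
      moreover have "0 \<le> ?r / 2 * (sqfun J x F s / (1 + w s))"
        using r w0[of s] sqfun_nonneg[of J x F s] by simp
      ultimately show ?thesis using False by (simp add: c_def)
    qed
    have "(\<Sum>a\<in>J. \<nu> a) \<le> (\<integral>s. ?R s \<partial>M)"
      unfolding \<nu>[OF J]
      by (rule integral_mono[OF ic[OF J] _ pt])
        (intro Bochner_Integration.integrable_add integrable_const integrable_mult_right iP iq[OF F J])
    also have "\<dots> = 3168 * t * ?m + (1 / (2 * ?r) * measure M {s\<in>space M. P s} +
        ?r / 2 * (\<integral>s. sqfun J x F s / (1 + w s) \<partial>M))"
      using iP iq[OF F J]
      by (simp del: times_divide_eq_right times_divide_eq_left times_divide_times_eq add: integral_of_bool)
    also have "\<dots> \<le> 3168 * t * ?m + (1 / (2 * ?r) * (628 * t) + ?r / 2 * (?m + 1))"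
      using Pm r wm opt'[OF F J] \<iota>(2) by (intro add_mono mult_left_mono) auto
    also have "1 / (2 * ?r) * (628 * t) = 314 * ?r"
      using r real_sqrt_mult_self[of t] t by (simp add: field_simps)
    finally show "(\<Sum>a\<in>J. \<nu> a) \<le> modulus ?m t" by (simp add: modulus_def algebra_simps)
  qed
qed

text \<open>All \<open>x a\<close> are replaced by 0 on a common set of measure below
  \<open>b / 2\<close> off which they are bounded. A common set is used so that every subsum is cut
  off in the same way, which preserves smallness; only a factor 2 in the lower bound is
  lost.\<close>

lemma finite_stage:
  fixes x :: "'b \<Rightarrow> 'a \<Rightarrow> real"
  assumes I: "finite I" and x: "\<And>a. a \<in> I \<Longrightarrow> x a \<in> borel_measurable M"
    and \<epsilon>: "0 < \<epsilon>" and b: "0 < b" "b \<le> measure M {s\<in>space M. \<epsilon> \<le> \<bar>\<Sum>a\<in>I. x a s\<bar>}"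
  obtains \<nu> :: "'b \<Rightarrow> real" where "\<And>a. 0 \<le> \<nu> a" and "b * \<epsilon>\<^sup>2 / (4 * (1 + \<epsilon>\<^sup>2)) \<le> (\<Sum>a\<in>I. \<nu> a)"
    and "\<And>J t. J \<subseteq> I \<Longrightarrow> 0 < t \<Longrightarrow>
      (\<And>K. K \<subseteq> J \<Longrightarrow> measure M {s\<in>space M. t \<le> \<bar>\<Sum>a\<in>K. x a s\<bar>} \<le> t) \<Longrightarrow>
      (\<Sum>a\<in>J. \<nu> a) \<le> modulus (measure M (space M)) t"
proof -
  define A where "A n = {s\<in>space M. \<exists>a\<in>I. real n < \<bar>x a s\<bar>}" for n :: nat
  have Am [measurable]: "A n \<in> sets M" for n
  proof -
    have "A n = (\<Union>a\<in>I. {s\<in>space M. real n < \<bar>x a s\<bar>})" by (auto simp: A_def)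
    also have "\<dots> \<in> sets M" using I x by (intro sets.finite_UN) auto
    finally show ?thesis .
  qed
  have "(\<lambda>n. measure M (A n)) \<longlonglongrightarrow> measure M (\<Inter>n. A n)"
  proof (rule finite_Lim_measure_decseq)
    show "range A \<subseteq> sets M" using Am by auto
    show "decseq A"
      unfolding decseq_def A_def by (auto intro: le_less_trans[OF of_nat_mono])
  qed
  moreover have "(\<Inter>n. A n) = {}"
  proof -
    have "s \<notin> (\<Inter>n. A n)" for s
    proof -
      obtain n where n: "(\<Sum>a\<in>I. \<bar>x a s\<bar>) \<le> real n" using real_arch_simple by blast
      have "\<bar>x a s\<bar> \<le> real n" if "a \<in> I" for a
        using member_le_sum[of a I "\<lambda>a. \<bar>x a s\<bar>"] I that n by auto
      then have "s \<notin> A n" by (force simp: A_def)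
      then show ?thesis by auto
    qed
    then show ?thesis by blast
  qed
  ultimately have "(\<lambda>n. measure M (A n)) \<longlonglongrightarrow> 0" by simp
  then have "eventually (\<lambda>n. measure M (A n) < b / 2) sequentially"
    using b by (intro order_tendstoD) auto
  then obtain n where n: "measure M (A n) < b / 2" by (auto simp: eventually_sequentially)
  define y where "y a s = (if s \<in> A n then 0 else x a s)" for a s
  have sumy: "(\<Sum>a\<in>K. y a s) = (if s \<in> A n then 0 else \<Sum>a\<in>K. x a s)" for K s
    by (simp add: y_def)
  have ym: "y a \<in> borel_measurable M" if "a \<in> I" for a
    unfolding y_def using x[OF that] by measurable
  have sm: "(\<lambda>s. \<Sum>a\<in>K. x a s) \<in> borel_measurable M" if "K \<subseteq> I" for K
    using x that by (intro borel_measurable_sum) auto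
  note [measurable] = sm[OF order_refl]
  have "b \<le> measure M {s\<in>space M. \<epsilon> \<le> \<bar>\<Sum>a\<in>I. x a s\<bar>}" by (rule b)
  also have "\<dots> \<le> measure M ({s\<in>space M. \<epsilon> \<le> \<bar>\<Sum>a\<in>I. y a s\<bar>} \<union> A n)"
    unfolding sumy by (intro finite_measure_mono) auto
  also have "\<dots> \<le> measure M {s\<in>space M. \<epsilon> \<le> \<bar>\<Sum>a\<in>I. y a s\<bar>} + measure M (A n)"
    unfolding sumy by (intro measure_Un_le) auto
  finally have b2: "b / 2 \<le> measure M {s\<in>space M. \<epsilon> \<le> \<bar>\<Sum>a\<in>I. y a s\<bar>}" using n by simp
  have ybdd: "\<bar>y a s\<bar> \<le> real n" if "a \<in> I" "s \<in> space M" for a s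
    using that by (force simp: y_def A_def)
  have b': "0 < b / 2" using b by simp
  obtain \<mu> :: "'b \<Rightarrow> real" where \<mu>: "b / 2 * \<epsilon>\<^sup>2 / (2 * (1 + \<epsilon>\<^sup>2)) \<le> (\<Sum>a\<in>I. \<mu> a)"
    "\<And>J t. J \<subseteq> I \<Longrightarrow> 0 < t \<Longrightarrow>
      (\<And>K. K \<subseteq> J \<Longrightarrow> measure M {s\<in>space M. t \<le> \<bar>\<Sum>a\<in>K. y a s\<bar>} \<le> t) \<Longrightarrow>
      (\<Sum>a\<in>J. \<mu> a) \<le> modulus (measure M (space M)) t"
    by (rule finite_stage_bounded[where x = y, OF I ym ybdd \<epsilon> b' b2]) blast+
  \<comment> \<open>Smallness is hereditary, so the upper bound survives passing to positive parts.\<close>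
  show ?thesis
  proof (rule that[of "\<lambda>a. max 0 (\<mu> a)"])
    have "(\<Sum>a\<in>I. \<mu> a) \<le> (\<Sum>a\<in>I. max 0 (\<mu> a))" by (intro sum_mono) auto
    with \<mu>(1) show "b * \<epsilon>\<^sup>2 / (4 * (1 + \<epsilon>\<^sup>2)) \<le> (\<Sum>a\<in>I. max 0 (\<mu> a))" by simp
    fix J t assume J: "J \<subseteq> I" and t: "0 < (t::real)"
      and small: "\<And>K. K \<subseteq> J \<Longrightarrow> measure M {s\<in>space M. t \<le> \<bar>\<Sum>a\<in>K. x a s\<bar>} \<le> t"
    have "(\<Sum>a\<in>J. max 0 (\<mu> a)) = (\<Sum>a\<in>{a\<in>J. 0 \<le> \<mu> a}. \<mu> a)"
      using finite_subset[OF J I] by (intro sum.mono_neutral_cong_right) auto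
    also have "\<dots> \<le> modulus (measure M (space M)) t"
    proof (rule \<mu>(2)[OF _ t])
      fix K assume K: "K \<subseteq> {a\<in>J. 0 \<le> \<mu> a}"
      then have KI: "K \<subseteq> I" "K \<subseteq> J" using J by auto
      note [measurable] = sm[OF KI(1)]
      have "measure M {s\<in>space M. t \<le> \<bar>\<Sum>a\<in>K. y a s\<bar>} \<le> measure M {s\<in>space M. t \<le> \<bar>\<Sum>a\<in>K. x a s\<bar>}"
        unfolding sumy using t by (intro finite_measure_mono) (auto split: if_splits)
      also have "\<dots> \<le> t" by (rule small[OF KI(2)])
      finally show "measure M {s\<in>space M. t \<le> \<bar>\<Sum>a\<in>K. y a s\<bar>} \<le> t" .
    qed (use J in auto)
    finally show "(\<Sum>a\<in>J. max 0 (\<mu> a)) \<le> modulus (measure M (space M)) t" .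
  qed simp
qed

end

section \<open>Scalar measures\<close>

lemma disjoint_family_lessI:
  fixes D :: "nat \<Rightarrow> 'a set"
  assumes "\<And>i j. i < j \<Longrightarrow> D i \<inter> D j = {}"
  shows "disjoint_family D"
  unfolding disjoint_family_on_def
proof (intro ballI impI)
  fix i j :: nat assume "i \<noteq> j"
  then show "D i \<inter> D j = {}"
    using assms[of i j] assms[of j i] by (cases "i < j") auto
qed

lemma (in finite_measure) AE_zeroI:
  fixes g :: "'a \<Rightarrow> real"
  assumes [measurable]: "g \<in> borel_measurable M"
    and "\<And>\<delta>. 0 < \<delta> \<Longrightarrow> measure M {s\<in>space M. \<delta> \<le> \<bar>g s\<bar>} = 0"
  shows "AE s in M. g s = 0"
proof -
  have "AE s in M. \<not> 1 / real (Suc n) \<le> \<bar>g s\<bar>" for n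
  proof (rule AE_I)
    show "emeasure M {s\<in>space M. 1 / real (Suc n) \<le> \<bar>g s\<bar>} = 0"
      using assms(2)[of "1 / real (Suc n)"] by (simp add: emeasure_eq_measure)
  qed auto
  then have "AE s in M. \<forall>n. \<not> 1 / real (Suc n) \<le> \<bar>g s\<bar>" by (simp add: AE_all_countable)
  then show ?thesis
  proof eventually_elim
    case (elim s)
    show ?case
    proof (rule ccontr)
      assume "g s \<noteq> 0"
      then obtain n where "1 / real (Suc n) < \<bar>g s\<bar>"
        using nat_approx_posE[of "\<bar>g s\<bar>"] by auto
      with elim show False by (auto dest: less_imp_le)
    qed
  qed
qed

text \<open>The values are representatives, chosen separately for each set, so additivity holds only
  almost everywhere, with an exceptional set depending on the sets involved. This is harmless
  because only finite partitions are compared at a time.\<close>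

locale scalar_L0_measure = finite_measure M + sigma_algebra E \<E>
  for M :: "'s measure" and E :: "'e set" and \<E> :: "'e set set" +
  fixes f :: "'e set \<Rightarrow> 's \<Rightarrow> real"
  assumes meas [measurable (raw)]: "A \<in> \<E> \<Longrightarrow> f A \<in> borel_measurable M"
    and sums: "range B \<subseteq> \<E> \<Longrightarrow> disjoint_family B \<Longrightarrow> 0 < \<delta> \<Longrightarrow>
      (\<lambda>n. measure M {s\<in>space M. \<delta> \<le> \<bar>(\<Sum>i<n. f (B i) s) - f (\<Union>i. B i) s\<bar>}) \<longlonglongrightarrow> 0"
begin

text \<open>The constant sequence of empty sets makes \<open>(n - 1) * f {}\<close> tend to 0 in
  measure, and from \<open>n = 2\<close> on this dominates \<open>f {}\<close>.\<close>

lemma AE_empty: "AE s in M. f {} s = 0"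
proof (rule AE_zeroI)
  fix \<delta> :: real assume \<delta>: "0 < \<delta>"
  let ?m = "\<lambda>n. measure M {s\<in>space M. \<delta> \<le> \<bar>(\<Sum>i<n. f {} s) - f {} s\<bar>}"
  have "?m \<longlonglongrightarrow> 0" using sums[of "\<lambda>_. {}" \<delta>] \<delta> by (simp add: disjoint_family_on_def)
  moreover have "measure M {s\<in>space M. \<delta> \<le> \<bar>f {} s\<bar>} \<le> ?m n" if "2 \<le> n" for n :: nat
  proof (intro finite_measure_mono)
    have "\<bar>f {} s\<bar> \<le> \<bar>(\<Sum>i<n. f {} s) - f {} s\<bar>" for s
    proof -
      have "(\<Sum>i<n. f {} s) - f {} s = (real n - 1) * f {} s" by (simp add: algebra_simps)
      then show ?thesis using that mult_right_mono[of 1 "real n - 1" "\<bar>f {} s\<bar>"] by (simp add: abs_mult)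
    qed
    then show "{s\<in>space M. \<delta> \<le> \<bar>f {} s\<bar>} \<subseteq> {s\<in>space M. \<delta> \<le> \<bar>(\<Sum>i<n. f {} s) - f {} s\<bar>}"
      by (auto intro: order_trans)
  qed auto
  ultimately have "measure M {s\<in>space M. \<delta> \<le> \<bar>f {} s\<bar>} \<le> 0"
    by (intro tendsto_lowerbound[of ?m 0 sequentially]) (auto simp: eventually_sequentially)
  then show "measure M {s\<in>space M. \<delta> \<le> \<bar>f {} s\<bar>} = 0" by (simp add: measure_le_0_iff)
qed auto

text \<open>For the sequence A, B, {}, {}, ... the partial sums are constant from
  \<open>n = 2\<close> on up to null sets, so a limit 0 of the error means that the error is
  0.\<close>

lemma AE_add:
  assumes A: "A \<in> \<E>" and B: "B \<in> \<E>" and AB: "A \<inter> B = {}"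
  shows "AE s in M. f (A \<union> B) s = f A s + f B s"
proof -
  note [measurable] = meas[OF A] meas[OF B] meas[OF Un[OF A B]]
  have "AE s in M. f A s + f B s - f (A \<union> B) s = 0"
  proof (rule AE_zeroI)
    fix \<delta> :: real assume \<delta>: "0 < \<delta>"
    let ?m = "\<lambda>n. measure M {s\<in>space M. \<delta> \<le> \<bar>(\<Sum>i<n. f (binaryset A B i) s) - f (A \<union> B) s\<bar>}"
    have r: "range (binaryset A B) \<subseteq> \<E>" using A B by (auto simp: range_binaryset_eq)
    have "?m \<longlonglongrightarrow> 0"
      using sums[OF r _ \<delta>] AB by (simp add: UN_binaryset_eq disjoint_family_on_def binaryset_def Int_commute)
    moreover have eq: "?m n = measure M {s\<in>space M. \<delta> \<le> \<bar>f A s + f B s - f (A \<union> B) s\<bar>}" if n: "2 \<le> n" for n :: nat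
    proof (rule measure_eq_AE)
      have "(\<Sum>i<n. f (binaryset A B i) s) = f A s + f B s" if "f {} s = 0" for s
      proof -
        have "(\<Sum>i<n. f (binaryset A B i) s) = (\<Sum>i\<in>{0,1}. f (binaryset A B i) s)"
          using n that by (intro sum.mono_neutral_right) (auto simp: binaryset_def)
        then show ?thesis by (simp add: binaryset_def)
      qed
      then show "AE s in M. (s \<in> {s\<in>space M. \<delta> \<le> \<bar>(\<Sum>i<n. f (binaryset A B i) s) - f (A \<union> B) s\<bar>}) =
          (s \<in> {s\<in>space M. \<delta> \<le> \<bar>f A s + f B s - f (A \<union> B) s\<bar>})"
        using AE_empty by (auto elim!: eventually_mono)
      have "(\<lambda>s. \<Sum>i<n. f (binaryset A B i) s) \<in> borel_measurable M"
        using r by (intro borel_measurable_sum meas) auto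
      then show "{s\<in>space M. \<delta> \<le> \<bar>(\<Sum>i<n. f (binaryset A B i) s) - f (A \<union> B) s\<bar>} \<in> sets M"
        by measurable
    qed measurable
    moreover from eq have "?m \<longlonglongrightarrow> measure M {s\<in>space M. \<delta> \<le> \<bar>f A s + f B s - f (A \<union> B) s\<bar>}"
      by (intro tendsto_eventually eventually_sequentiallyI[of 2])
    ultimately show "measure M {s\<in>space M. \<delta> \<le> \<bar>f A s + f B s - f (A \<union> B) s\<bar>} = 0"
      by (intro LIMSEQ_unique[of ?m]) auto
  qed auto
  then show ?thesis by eventually_elim simp
qed

lemma AE_sum:
  assumes "finite I" "I \<subseteq> \<E>" "disjoint I"
  shows "AE s in M. f (\<Union>I) s = (\<Sum>a\<in>I. f a s)"
  using assms
proof (induction I)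
  case empty
  then show ?case using AE_empty by simp
next
  case (insert a I)
  have "a \<inter> \<Union>I = {}"
    using insert.prems insert.hyps by (auto simp: disjoint_def)
  moreover have "\<Union>I \<in> \<E>" using insert by (intro finite_Union) auto
  ultimately have "AE s in M. f (a \<union> \<Union>I) s = f a s + f (\<Union>I) s"
    using insert.prems by (intro AE_add) auto
  moreover have "AE s in M. f (\<Union>I) s = (\<Sum>a\<in>I. f a s)"
    using insert by (intro insert.IH) (auto simp: disjoint_def)
  ultimately show ?case by eventually_elim (use insert.hyps in simp)
qed

lemma AE_diff:
  assumes "A \<in> \<E>" "B \<in> \<E>" "B \<subseteq> A"
  shows "AE s in M. f A s = f B s + f (A - B) s"
proof -
  have eq: "B \<union> (A - B) = A" using assms by auto
  show ?thesis using AE_add[of B "A - B"] assms unfolding eq by blast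
qed

lemma tendsto_disjoint:
  assumes A: "range A \<subseteq> \<E>" "disjoint_family A" and \<delta>: "0 < \<delta>"
  shows "(\<lambda>n. measure M {s\<in>space M. \<delta> \<le> \<bar>f (A n) s\<bar>}) \<longlonglongrightarrow> 0"
proof -
  define d where "d n s = (\<Sum>i<n. f (A i) s) - f (\<Union>i. A i) s" for n s
  let ?m = "\<lambda>n. measure M {s\<in>space M. \<delta> / 2 \<le> \<bar>d n s\<bar>}"
  have Am: "A i \<in> \<E>" for i using A by auto
  have [measurable]: "d n \<in> borel_measurable M" for n
    unfolding d_def using Am by (intro borel_measurable_diff borel_measurable_sum meas) auto
  have "?m \<longlonglongrightarrow> 0" using sums[OF A, of "\<delta> / 2"] \<delta> by (simp add: d_def)
  then have lim: "(\<lambda>n. ?m (Suc n) + ?m n) \<longlonglongrightarrow> 0"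
    using tendsto_add[OF LIMSEQ_Suc] by fastforce
  show ?thesis
  proof (rule tendsto_sandwich[OF _ _ tendsto_const lim])
    show "\<forall>\<^sub>F n in sequentially. measure M {s\<in>space M. \<delta> \<le> \<bar>f (A n) s\<bar>} \<le> ?m (Suc n) + ?m n"
    proof (intro always_eventually allI)
      fix n
      have "f (A n) s = d (Suc n) s - d n s" for s by (simp add: d_def)
      then have "measure M {s\<in>space M. \<delta> \<le> \<bar>f (A n) s\<bar>} \<le>
          measure M ({s\<in>space M. \<delta> / 2 \<le> \<bar>d (Suc n) s\<bar>} \<union> {s\<in>space M. \<delta> / 2 \<le> \<bar>d n s\<bar>})"
        by (intro finite_measure_mono sets.Un) auto
      also have "\<dots> \<le> ?m (Suc n) + ?m n" by (intro measure_Un_le) auto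
      finally show "measure M {s\<in>space M. \<delta> \<le> \<bar>f (A n) s\<bar>} \<le> ?m (Suc n) + ?m n" .
    qed
  qed auto
qed

text \<open>The differences of consecutive sets are disjoint with union \<open>A 0\<close>, the
  intersection being empty, and the n-th error of their series is \<open>f (A n)\<close> up to
  sign.\<close>

lemma tendsto_decseq:
  assumes A: "range A \<subseteq> \<E>" "decseq A" "(\<Inter>n. A n) = {}" and \<delta>: "0 < \<delta>"
  shows "(\<lambda>n. measure M {s\<in>space M. \<delta> \<le> \<bar>f (A n) s\<bar>}) \<longlonglongrightarrow> 0"
proof -
  define D where "D i = A i - A (Suc i)" for i
  have Am: "A i \<in> \<E>" for i using A by auto
  have Dm: "D i \<in> \<E>" for i using Am by (auto simp: D_def)
  have sub: "A (Suc i) \<subseteq> A i" for i using A(2) by (simp add: decseq_Suc_iff)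
  have disj: "disjoint_family D"
  proof (rule disjoint_family_lessI)
    fix i j :: nat assume "i < j"
    then have "A j \<subseteq> A (Suc i)" by (intro decseqD[OF A(2)]) auto
    then show "D i \<inter> D j = {}" by (auto simp: D_def)
  qed
  have U: "(\<Union>i. D i) = A 0"
  proof (intro equalityI subsetI)
    fix e assume e: "e \<in> A 0"
    have "\<exists>n. e \<notin> A n" using A(3) by auto
    define n where "n = (LEAST n. e \<notin> A n)"
    have n: "e \<notin> A n" unfolding n_def using \<open>\<exists>n. e \<notin> A n\<close> by (rule LeastI_ex)
    with e obtain k where k: "n = Suc k" by (cases n) auto
    have "e \<in> A k" using not_less_Least[of k "\<lambda>n. e \<notin> A n"] k by (auto simp: n_def)
    then show "e \<in> (\<Union>i. D i)" using n k by (auto simp: D_def)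
  next
    fix e assume "e \<in> (\<Union>i. D i)"
    then show "e \<in> A 0" using A(2) decseqD[of A 0] by (auto simp: D_def)
  qed
  have tel: "AE s in M. f (A 0) s = (\<Sum>i<n. f (D i) s) + f (A n) s" for n
  proof (induction n)
    case (Suc n)
    moreover have "AE s in M. f (A n) s = f (A (Suc n)) s + f (D n) s"
      unfolding D_def by (rule AE_diff[OF Am Am sub])
    ultimately show ?case by eventually_elim simp
  qed simp
  have "measure M {s\<in>space M. \<delta> \<le> \<bar>(\<Sum>i<n. f (D i) s) - f (A 0) s\<bar>} =
      measure M {s\<in>space M. \<delta> \<le> \<bar>f (A n) s\<bar>}" for n
  proof (intro measure_eq_AE)
    have [measurable]: "(\<lambda>s. (\<Sum>i<n. f (D i) s) - f (A 0) s) \<in> borel_measurable M"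
      using Dm Am by (intro borel_measurable_diff borel_measurable_sum meas) auto
    show "{s\<in>space M. \<delta> \<le> \<bar>(\<Sum>i<n. f (D i) s) - f (A 0) s\<bar>} \<in> sets M" by measurable
    show "{s\<in>space M. \<delta> \<le> \<bar>f (A n) s\<bar>} \<in> sets M" using meas[OF Am[of n]] by measurable
    show "AE s in M. (s \<in> {s\<in>space M. \<delta> \<le> \<bar>(\<Sum>i<n. f (D i) s) - f (A 0) s\<bar>}) =
        (s \<in> {s\<in>space M. \<delta> \<le> \<bar>f (A n) s\<bar>})"
      using tel[of n] by eventually_elim auto
  qed
  moreover have "range D \<subseteq> \<E>" using Dm by auto
  ultimately show ?thesis using sums[OF _ disj \<delta>] by (simp add: U)
qed

text \<open>The counterpart of a bound on the semivariation. It is hereditary, so that unions of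
  atoms inside \<open>A\<close> inherit the smallness required at the finite stage.\<close>

definition small :: "'e set \<Rightarrow> real \<Rightarrow> bool" where
  "small A t \<longleftrightarrow> (\<forall>B\<in>\<E>. B \<subseteq> A \<longrightarrow> measure M {s\<in>space M. t \<le> \<bar>f B s\<bar>} \<le> t)"

text \<open>A gliding hump. If every \<open>A n\<close> contains a set \<open>B n\<close> violating
  the bound, then \<open>f\<close> becomes small in measure on \<open>B n \<inter> A k\<close> for
  large \<open>k\<close>, so \<open>B n - A k\<close> keeps half of the violation. Iterating the
  choice of \<open>k\<close> yields disjoint sets, on which \<open>f\<close> must tend to 0.\<close>

lemma exhaustive:
  assumes A: "range A \<subseteq> \<E>" "decseq A" "(\<Inter>n. A n) = {}" and t: "0 < t"
  shows "\<exists>n. small (A n) t"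
proof (rule ccontr)
  assume "\<not> (\<exists>n. small (A n) t)"
  then have "\<forall>n. \<exists>B\<in>\<E>. B \<subseteq> A n \<and> t < measure M {s\<in>space M. t \<le> \<bar>f B s\<bar>}"
    by (auto simp: small_def not_le)
  then obtain B where B: "\<And>n. B n \<in> \<E>" "\<And>n. B n \<subseteq> A n"
    "\<And>n. t < measure M {s\<in>space M. t \<le> \<bar>f (B n) s\<bar>}" by metis
  have Am: "A i \<in> \<E>" for i using A by auto
  have "\<exists>k>n. t / 2 \<le> measure M {s\<in>space M. t / 2 \<le> \<bar>f (B n - A k) s\<bar>}" for n
  proof -
    have "(\<lambda>k. measure M {s\<in>space M. t / 2 \<le> \<bar>f (B n \<inter> A k) s\<bar>}) \<longlonglongrightarrow> 0"
      using A B t Am by (intro tendsto_decseq) (auto simp: decseq_def intro!: Int)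
    then have "\<forall>\<^sub>F k in sequentially. measure M {s\<in>space M. t / 2 \<le> \<bar>f (B n \<inter> A k) s\<bar>} < t / 2 \<and> n < k"
      using t by (intro eventually_conj order_tendstoD(2) eventually_gt_at_top) auto
    then obtain k where k: "measure M {s\<in>space M. t / 2 \<le> \<bar>f (B n \<inter> A k) s\<bar>} < t / 2" "n < k"
      by (auto simp: eventually_sequentially)
    have BA: "B n \<inter> A k \<in> \<E>" "B n - A k \<in> \<E>" using B Am by auto
    note [measurable] = meas[OF BA(1)] meas[OF BA(2)] meas[OF B(1)[of n]]
    have "AE s in M. f (B n) s = f (B n \<inter> A k) s + f (B n - B n \<inter> A k) s"
      by (rule AE_diff) (use B BA in auto)
    then have *: "AE s in M. f (B n) s = f (B n \<inter> A k) s + f (B n - A k) s"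
      by (simp add: Diff_Int)
    have "t < measure M {s\<in>space M. t \<le> \<bar>f (B n) s\<bar>}" by (rule B)
    also have "\<dots> \<le> measure M ({s\<in>space M. t / 2 \<le> \<bar>f (B n \<inter> A k) s\<bar>} \<union> {s\<in>space M. t / 2 \<le> \<bar>f (B n - A k) s\<bar>})"
      using * by (intro finite_measure_mono_AE) (auto elim!: eventually_mono)
    also have "\<dots> \<le> measure M {s\<in>space M. t / 2 \<le> \<bar>f (B n \<inter> A k) s\<bar>} +
        measure M {s\<in>space M. t / 2 \<le> \<bar>f (B n - A k) s\<bar>}"
      by (intro measure_Un_le) auto
    finally show ?thesis using k by (intro exI[of _ k]) auto
  qed
  then obtain k where k: "\<And>n. n < k n" "\<And>n. t / 2 \<le> measure M {s\<in>space M. t / 2 \<le> \<bar>f (B n - A (k n)) s\<bar>}"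
    by metis
  define r where "r j = (k ^^ j) 0" for j
  have r: "r (Suc j) = k (r j)" for j by (simp add: r_def)
  have mono: "strict_mono r" by (rule strict_mono_Suc_iff[THEN iffD2]) (simp add: r k)
  define D where "D j = B (r j) - A (r (Suc j))" for j
  have "disjoint_family D"
  proof (rule disjoint_family_lessI)
    fix i j :: nat assume "i < j"
    then have "r (Suc i) \<le> r j" by (intro monoD[OF strict_mono_mono[OF mono]]) auto
    then have "A (r j) \<subseteq> A (r (Suc i))" by (rule decseqD[OF A(2)])
    then show "D i \<inter> D j = {}" using B(2)[of "r j"] by (auto simp: D_def)
  qed
  moreover have "range D \<subseteq> \<E>" using B Am by (auto simp: D_def)
  ultimately have "(\<lambda>n. measure M {s\<in>space M. t / 2 \<le> \<bar>f (D n) s\<bar>}) \<longlonglongrightarrow> 0"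
    using t by (intro tendsto_disjoint) auto
  then have "\<forall>\<^sub>F n in sequentially. measure M {s\<in>space M. t / 2 \<le> \<bar>f (D n) s\<bar>} < t / 2"
    using t by (intro order_tendstoD(2)) auto
  then obtain n where "measure M {s\<in>space M. t / 2 \<le> \<bar>f (D n) s\<bar>} < t / 2"
    by (auto simp: eventually_sequentially)
  with k(2)[of "r n"] show False by (simp add: D_def r)
qed

end

section \<open>Limit over finite partitions\<close>

lemma finite_atoms:
  assumes "finite P"
  shows "finite ((\<lambda>e. {e'\<in>E. \<forall>A\<in>P. e' \<in> A \<longleftrightarrow> e \<in> A}) ` E)"
proof -
  have "(\<lambda>e. {e'\<in>E. \<forall>A\<in>P. e' \<in> A \<longleftrightarrow> e \<in> A}) ` E \<subseteq> (\<lambda>Q. {e'\<in>E. \<forall>A\<in>P. e' \<in> A \<longleftrightarrow> A \<in> Q}) ` Pow P"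
  proof (rule image_subsetI)
    fix e
    show "{e'\<in>E. \<forall>A\<in>P. e' \<in> A \<longleftrightarrow> e \<in> A} \<in> (\<lambda>Q. {e'\<in>E. \<forall>A\<in>P. e' \<in> A \<longleftrightarrow> A \<in> Q}) ` Pow P"
      by (rule image_eqI[of _ _ "{A\<in>P. e \<in> A}"]) auto
  qed
  then show ?thesis using assms by (meson finite_Pow_iff finite_imageI finite_subset)
qed

context scalar_L0_measure
begin

text \<open>The partition consists of the atoms of \<open>P\<close>. For members \<open>A\<close>
  and \<open>B\<close> of \<open>P\<close> an atom inside \<open>A \<union> B\<close> lies in
  \<open>A\<close> or in \<open>B\<close>, which gives additivity although the union need not belong
  to \<open>P\<close>.\<close>

lemma finite_approximation:
  assumes \<epsilon>: "0 < \<epsilon>" and b: "0 < b" "b \<le> measure M {s\<in>space M. \<epsilon> \<le> \<bar>f E s\<bar>}"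
    and P: "finite P" "P \<subseteq> \<E>"
  obtains \<nu> :: "'e set \<Rightarrow> real" where "b * \<epsilon>\<^sup>2 / (4 * (1 + \<epsilon>\<^sup>2)) \<le> \<nu> E"
    and "\<And>A B. A \<in> P \<Longrightarrow> B \<in> P \<Longrightarrow> A \<inter> B = {} \<Longrightarrow> \<nu> (A \<union> B) = \<nu> A + \<nu> B"
    and "\<And>A. A \<in> P \<Longrightarrow> 0 \<le> \<nu> A"
    and "\<And>A t. A \<in> P \<Longrightarrow> 0 < t \<Longrightarrow> small A t \<Longrightarrow> \<nu> A \<le> modulus (measure M (space M)) t"
proof -
  define atom where "atom e = {e'\<in>E. \<forall>A\<in>P. e' \<in> A \<longleftrightarrow> e \<in> A}" for e
  define I where "I = atom ` E"
  have finI: "finite I" unfolding I_def atom_def using P(1) by (rule finite_atoms)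
  have atom_sets: "atom e \<in> \<E>" for e
  proof -
    have "(\<Inter>A\<in>P. if e \<in> A then A else E - A) \<in> \<E>" if "P \<noteq> {}"
      using P that by (intro finite_INT) auto
    moreover have "atom e = E \<inter> (\<Inter>A\<in>P. if e \<in> A then A else E - A)"
      unfolding atom_def by (auto split: if_splits)
    ultimately show ?thesis by (cases "P = {}") (simp, metis Int top)
  qed
  then have I_sets: "I \<subseteq> \<E>" by (auto simp: I_def)
  have disjI: "disjoint I" unfolding disjoint_def I_def atom_def by auto
  have UI: "\<Union>I = E" by (auto simp: I_def atom_def)
  have neI: "a \<noteq> {}" if "a \<in> I" for a using that by (auto simp: I_def atom_def)
  have xm: "f a \<in> borel_measurable M" if "a \<in> I" for a using that I_sets by auto
  have sums_eq: "measure M {s\<in>space M. t \<le> \<bar>\<Sum>a\<in>K. f a s\<bar>} = measure M {s\<in>space M. t \<le> \<bar>f (\<Union>K) s\<bar>}"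
    if K: "K \<subseteq> I" for K t
  proof (rule measure_eq_AE)
    have fK: "finite K" using K finI finite_subset by auto
    have U: "\<Union>K \<in> \<E>" using K I_sets fK by (intro finite_Union) auto
    have "(\<lambda>s. \<Sum>a\<in>K. f a s) \<in> borel_measurable M" using K xm by (intro borel_measurable_sum) auto
    then show "{s\<in>space M. t \<le> \<bar>\<Sum>a\<in>K. f a s\<bar>} \<in> sets M" by measurable
    show "{s\<in>space M. t \<le> \<bar>f (\<Union>K) s\<bar>} \<in> sets M" using meas[OF U] by measurable
    have "disjoint K" using K disjI unfolding disjoint_def by blast
    then have "AE s in M. f (\<Union>K) s = (\<Sum>a\<in>K. f a s)"
      using K I_sets fK by (intro AE_sum) auto
    then show "AE s in M. (s \<in> {s\<in>space M. t \<le> \<bar>\<Sum>a\<in>K. f a s\<bar>}) = (s \<in> {s\<in>space M. t \<le> \<bar>f (\<Union>K) s\<bar>})"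
      by eventually_elim auto
  qed
  have b': "b \<le> measure M {s\<in>space M. \<epsilon> \<le> \<bar>\<Sum>a\<in>I. f a s\<bar>}"
    using b(2) sums_eq[of I \<epsilon>] UI by simp
  obtain \<mu> where \<mu>: "\<And>a. 0 \<le> \<mu> a" "b * \<epsilon>\<^sup>2 / (4 * (1 + \<epsilon>\<^sup>2)) \<le> (\<Sum>a\<in>I. \<mu> a)"
    "\<And>J t. J \<subseteq> I \<Longrightarrow> 0 < t \<Longrightarrow>
      (\<And>K. K \<subseteq> J \<Longrightarrow> measure M {s\<in>space M. t \<le> \<bar>\<Sum>a\<in>K. f a s\<bar>} \<le> t) \<Longrightarrow>
      (\<Sum>a\<in>J. \<mu> a) \<le> modulus (measure M (space M)) t"
    by (rule finite_stage[where x = f, OF finI xm \<epsilon> b(1) b']) blast+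
  define \<nu> where "\<nu> A = (\<Sum>a\<in>{a\<in>I. a \<subseteq> A}. \<mu> a)" for A
  show ?thesis
  proof (rule that[of \<nu>])
    have "{a\<in>I. a \<subseteq> E} = I" using UI by auto
    then show "b * \<epsilon>\<^sup>2 / (4 * (1 + \<epsilon>\<^sup>2)) \<le> \<nu> E" using \<mu>(2) by (simp add: \<nu>_def)
    show "\<nu> (A \<union> B) = \<nu> A + \<nu> B" if A: "A \<in> P" and B: "B \<in> P" and AB: "A \<inter> B = {}" for A B
    proof -
      have "a \<subseteq> A \<or> a \<subseteq> B" if "a \<in> I" "a \<subseteq> A \<union> B" for a
        using that A B unfolding I_def atom_def by blast
      then have "{a\<in>I. a \<subseteq> A \<union> B} = {a\<in>I. a \<subseteq> A} \<union> {a\<in>I. a \<subseteq> B}" by auto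
      moreover have "{a\<in>I. a \<subseteq> A} \<inter> {a\<in>I. a \<subseteq> B} = {}" using AB neI by blast
      ultimately show ?thesis using finI by (simp add: \<nu>_def sum.union_disjoint)
    qed
    show "0 \<le> \<nu> A" for A using \<mu>(1) by (simp add: \<nu>_def sum_nonneg)
    show "\<nu> A \<le> modulus (measure M (space M)) t" if A: "A \<in> P" and t: "0 < t" "small A t" for A t
      unfolding \<nu>_def
    proof (rule \<mu>(3)[OF _ t(1)])
      fix K assume K: "K \<subseteq> {a\<in>I. a \<subseteq> A}"
      then have "\<Union>K \<in> \<E>" using I_sets finite_subset[OF _ finI, of K] by (intro finite_Union) auto
      moreover have "\<Union>K \<subseteq> A" "K \<subseteq> I" using K by auto
      ultimately show "measure M {s\<in>space M. t \<le> \<bar>\<Sum>a\<in>K. f a s\<bar>} \<le> t"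
        using t(2) by (simp add: sums_eq small_def)
    qed auto
  qed
qed

lemma finitely_additive_control:
  assumes \<epsilon>: "0 < \<epsilon>" and b: "0 < b" "b \<le> measure M {s\<in>space M. \<epsilon> \<le> \<bar>f E s\<bar>}"
  obtains \<nu> :: "'e set \<Rightarrow> real" where "0 < \<nu> E"
    and "\<And>A B. A \<in> \<E> \<Longrightarrow> B \<in> \<E> \<Longrightarrow> A \<inter> B = {} \<Longrightarrow> \<nu> (A \<union> B) = \<nu> A + \<nu> B"
    and "\<And>A. A \<in> \<E> \<Longrightarrow> 0 \<le> \<nu> A"
    and "\<And>A t. A \<in> \<E> \<Longrightarrow> 0 < t \<Longrightarrow> small A t \<Longrightarrow> \<nu> A \<le> modulus (measure M (space M)) t"
proof -
  let ?m = "measure M (space M)"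
  define c where "c = b * \<epsilon>\<^sup>2 / (4 * (1 + \<epsilon>\<^sup>2))"
  have c: "0 < c" unfolding c_def using \<epsilon> b by (intro divide_pos_pos mult_pos_pos add_pos_nonneg) auto
  \<comment> \<open>Every set is small at level \<open>?m + 1\<close>, because no measure exceeds
    \<open>?m\<close>. So the modulus at this level is a bound uniform over all partitions, and the
    candidates lie in one compact cube.\<close>
  define C where "C = modulus ?m (?m + 1)"
  have top_small: "small A (?m + 1)" for A
    unfolding small_def
  proof (intro ballI impI)
    fix B
    have "measure M {s\<in>space M. ?m + 1 \<le> \<bar>f B s\<bar>} \<le> ?m" by (rule bounded_measure)
    then show "measure M {s\<in>space M. ?m + 1 \<le> \<bar>f B s\<bar>} \<le> ?m + 1" by simp
  qed
  have C0: "0 \<le> C" unfolding C_def modulus_def by (intro add_nonneg_nonneg mult_nonneg_nonneg) auto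
  define box where "box = (UNIV :: 'e set set) \<rightarrow>\<^sub>E {0..C}"
  have "compactin (product_topology (\<lambda>_. euclidean) (UNIV :: 'e set set)) box"
    unfolding box_def by (subst compactin_PiE) auto
  then have compact_box: "compact box" by (simp add: euclidean_product_topology)
  \<comment> \<open>Each condition involves at most three coordinates of \<open>\<nu>\<close>, and
    smallness does not depend on \<open>\<nu>\<close>. Hence \<open>K P\<close> is closed for
    pointwise convergence; it shrinks as \<open>P\<close> grows, which reduces finite intersections
    to a single \<open>P\<close>.\<close>
  define K where "K P = {\<nu>. c \<le> \<nu> E \<and>
      (\<forall>A\<in>P. \<forall>B\<in>P. A \<inter> B = {} \<longrightarrow> \<nu> (A \<union> B) = \<nu> A + \<nu> B) \<and>
      (\<forall>A\<in>P. \<forall>t>0. small A t \<longrightarrow> \<nu> A \<le> modulus ?m t)}" for P :: "'e set set"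
  have closed_K: "closed (K P)" for P
    unfolding K_def Ball_def
    by (intro closed_Collect_conj closed_Collect_all closed_Collect_imp open_Collect_const
        closed_Collect_le closed_Collect_eq continuous_intros continuous_on_product_coordinates)
  have K_mono: "K Q \<subseteq> K P" if "P \<subseteq> Q" for P Q using that unfolding K_def by blast
  have K_ne: "box \<inter> K P \<noteq> {}" if P: "finite P" "P \<subseteq> \<E>" for P
  proof -
    \<comment> \<open>\<open>E\<close> and the pairwise unions are included so that extending by 0
      outside \<open>P'\<close>, which keeps the values in the cube, does not disturb the lower
      bound or additivity on \<open>P\<close>.\<close>
    define P' where "P' = insert E (P \<union> (\<lambda>(A, B). A \<union> B) ` (P \<times> P))"
    have P': "finite P'" "P' \<subseteq> \<E>" using P by (auto simp: P'_def)
    obtain \<nu> :: "'e set \<Rightarrow> real" where \<nu>: "c \<le> \<nu> E"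
      "\<And>A B. A \<in> P' \<Longrightarrow> B \<in> P' \<Longrightarrow> A \<inter> B = {} \<Longrightarrow> \<nu> (A \<union> B) = \<nu> A + \<nu> B"
      "\<And>A. A \<in> P' \<Longrightarrow> 0 \<le> \<nu> A"
      "\<And>A t. A \<in> P' \<Longrightarrow> 0 < t \<Longrightarrow> small A t \<Longrightarrow> \<nu> A \<le> modulus ?m t"
      unfolding c_def by (rule finite_approximation[OF \<epsilon> b P']) blast+
    define \<nu>' where "\<nu>' A = (if A \<in> P' then \<nu> A else 0)" for A
    have "\<nu>' \<in> box"
      unfolding box_def \<nu>'_def using \<nu>(3) \<nu>(4)[OF _ _ top_small] measure_nonneg[of M "space M"] C0
      by (auto simp: C_def)
    moreover have "\<nu>' \<in> K P"
      unfolding K_def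
    proof (intro CollectI conjI ballI allI impI)
      show "c \<le> \<nu>' E" using \<nu>(1) by (simp add: \<nu>'_def P'_def)
      fix A assume A: "A \<in> P"
      then have A': "A \<in> P'" by (auto simp: P'_def)
      show "\<nu>' A \<le> modulus ?m t" if "0 < t" "small A t" for t
        using \<nu>(4)[OF A' that] A' by (simp add: \<nu>'_def)
      fix B assume B: "B \<in> P" and AB: "A \<inter> B = {}"
      then have B': "B \<in> P'" "A \<union> B \<in> P'" using A by (auto simp: P'_def)
      show "\<nu>' (A \<union> B) = \<nu>' A + \<nu>' B"
        using \<nu>(2)[OF A' B'(1) AB] A' B' by (simp add: \<nu>'_def)
    qed
    ultimately show ?thesis by auto
  qed
  have "box \<inter> \<Inter>(K ` {P. finite P \<and> P \<subseteq> \<E>}) \<noteq> {}"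
  proof (rule compact_imp_fip[OF compact_box])
    show "closed T" if "T \<in> K ` {P. finite P \<and> P \<subseteq> \<E>}" for T using that closed_K by auto
    fix F assume "finite F" "F \<subseteq> K ` {P. finite P \<and> P \<subseteq> \<E>}"
    then obtain Q where Q: "finite Q" "Q \<subseteq> {P. finite P \<and> P \<subseteq> \<E>}" "F = K ` Q"
      by (meson finite_subset_image)
    then have "box \<inter> K (\<Union>Q) \<noteq> {}" by (intro K_ne finite_Union) auto
    moreover have "K (\<Union>Q) \<subseteq> \<Inter>F" using Q(3) K_mono[of _ "\<Union>Q"] by blast
    ultimately show "box \<inter> \<Inter>F \<noteq> {}" by blast
  qed
  then obtain \<nu> where \<nu>: "\<nu> \<in> box" "\<And>P. finite P \<Longrightarrow> P \<subseteq> \<E> \<Longrightarrow> \<nu> \<in> K P" by auto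
  show ?thesis
  proof (rule that[of \<nu>])
    have "c \<le> \<nu> E" using \<nu>(2)[of "{}"] by (simp add: K_def)
    with c show "0 < \<nu> E" by simp
    show "\<nu> (A \<union> B) = \<nu> A + \<nu> B" if "A \<in> \<E>" "B \<in> \<E>" "A \<inter> B = {}" for A B
      using \<nu>(2)[of "{A, B}"] that by (auto simp: K_def)
    show "0 \<le> \<nu> A" for A using \<nu>(1) by (auto simp: box_def PiE_iff)
    show "\<nu> A \<le> modulus ?m t" if "A \<in> \<E>" "0 < t" "small A t" for A t
      using \<nu>(2)[of "{A}"] that by (auto simp: K_def)
  qed
qed

text \<open>The modulus is used twice. Together with exhaustivity it gives continuity at the empty
  set, hence countable additivity; and a set with only null subsets is small at every level, so its
  measure is below every value of the modulus.\<close>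

theorem exists_nonzero_continuous_measure:
  assumes nz: "\<not> (AE s in M. f E s = 0)"
  obtains \<nu> :: "'e measure" where "space \<nu> = E" "sets \<nu> = \<E>" "finite_measure \<nu>" "0 < emeasure \<nu> E"
    and "\<And>A. A \<in> \<E> \<Longrightarrow> (\<And>B. B \<in> \<E> \<Longrightarrow> B \<subseteq> A \<Longrightarrow> AE s in M. f B s = 0) \<Longrightarrow> emeasure \<nu> A = 0"
proof -
  obtain \<epsilon> where \<epsilon>: "0 < \<epsilon>" "measure M {s\<in>space M. \<epsilon> \<le> \<bar>f E s\<bar>} \<noteq> 0"
    using AE_zeroI[OF meas[OF top]] nz by blast
  then have b: "0 < measure M {s\<in>space M. \<epsilon> \<le> \<bar>f E s\<bar>}" using zero_less_measure_iff by blast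
  let ?mod = "modulus (measure M (space M))"
  obtain \<nu> :: "'e set \<Rightarrow> real" where \<nu>: "0 < \<nu> E"
    "\<And>A B. A \<in> \<E> \<Longrightarrow> B \<in> \<E> \<Longrightarrow> A \<inter> B = {} \<Longrightarrow> \<nu> (A \<union> B) = \<nu> A + \<nu> B"
    "\<And>A. A \<in> \<E> \<Longrightarrow> 0 \<le> \<nu> A"
    "\<And>A t. A \<in> \<E> \<Longrightarrow> 0 < t \<Longrightarrow> small A t \<Longrightarrow> \<nu> A \<le> ?mod t"
    by (rule finitely_additive_control[OF \<epsilon>(1) b order_refl]) blast+
  have mod: "\<exists>t>0. ?mod t < e" if "0 < e" for e
  proof -
    have "\<forall>\<^sub>F t in at_right 0. ?mod t < e"
      using modulus_tendsto_0 that by (rule order_tendstoD(2))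
    then have "\<forall>\<^sub>F t in at_right 0. ?mod t < e \<and> 0 < t"
      by (intro eventually_conj eventually_at_right_less)
    then show ?thesis by (metis (mono_tags, lifting) eventually_happens trivial_limit_at_right_real)
  qed
  define N where "N A = ennreal (\<nu> A)" for A
  have empty: "\<nu> {} = 0" using \<nu>(2)[of "{}" "{}"] by simp
  have N1: "positive \<E> N" using empty by (simp add: positive_def N_def)
  have N2: "additive \<E> N" using \<nu>(2,3) by (simp add: additive_def N_def ennreal_plus)
  have N3: "countably_additive \<E> N"
  proof (rule empty_continuous_imp_countably_additive[OF N1 N2])
    show "\<forall>A\<in>\<E>. N A \<noteq> \<infinity>" by (simp add: N_def)
    fix A :: "nat \<Rightarrow> 'e set" assume A: "range A \<subseteq> \<E>" "decseq A" "(\<Inter>i. A i) = {}"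
    have "(\<lambda>i. \<nu> (A i)) \<longlonglongrightarrow> 0"
    proof (rule LIMSEQ_I)
      fix e :: real assume "0 < e"
      then obtain t where t: "0 < t" "?mod t < e" using mod by blast
      obtain n where n: "small (A n) t" using exhaustive[OF A t(1)] by blast
      have "norm (\<nu> (A k) - 0) < e" if "n \<le> k" for k
      proof -
        have "A k \<subseteq> A n" using A(2) that by (rule decseqD)
        then have "small (A k) t" using n by (auto simp: small_def)
        then have "\<nu> (A k) \<le> ?mod t" using A(1) t by (intro \<nu>(4)) auto
        moreover have "0 \<le> \<nu> (A k)" using A(1) by (intro \<nu>(3)) auto
        ultimately show ?thesis using t by simp
      qed
      then show "\<exists>no. \<forall>k\<ge>no. norm (\<nu> (A k) - 0) < e" by blast
    qed
    then show "(\<lambda>i. N (A i)) \<longlonglongrightarrow> 0"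
      unfolding N_def by (metis ennreal_0 tendsto_ennrealI)
  qed
  define \<nu>' where "\<nu>' = measure_of E \<E> N"
  have sp: "space \<nu>' = E" "sets \<nu>' = \<E>" by (simp_all add: \<nu>'_def space_measure_of_conv)
  have em: "emeasure \<nu>' A = N A" if "A \<in> \<E>" for A
    unfolding \<nu>'_def using that N1 N3 by (rule emeasure_measure_of_sigma[OF sigma_algebra_axioms, rotated 2])
  show ?thesis
  proof (rule that[OF sp])
    show "finite_measure \<nu>'" by (rule finite_measureI) (simp add: sp em N_def)
    show "0 < emeasure \<nu>' E" using \<nu>(1) by (simp add: em N_def)
    fix A assume A: "A \<in> \<E>" and null: "\<And>B. B \<in> \<E> \<Longrightarrow> B \<subseteq> A \<Longrightarrow> AE s in M. f B s = 0"
    have "small A t" if "0 < t" for t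
      unfolding small_def
    proof (intro ballI impI)
      fix B assume "B \<in> \<E>" "B \<subseteq> A"
      then have "AE s in M. f B s = 0" by (rule null)
      then have "measure M {s\<in>space M. t \<le> \<bar>f B s\<bar>} = measure M {}"
        using that \<open>B \<in> \<E>\<close> by (intro measure_eq_AE) auto
      then show "measure M {s\<in>space M. t \<le> \<bar>f B s\<bar>} \<le> t" using that by simp
    qed
    then have "\<nu> A < e" if "0 < e" for e
      using mod[OF that] \<nu>(4)[OF A] by (meson le_less_trans)
    then have "\<nu> A \<le> 0" using less_irrefl not_less by blast
    then show "emeasure \<nu>' A = 0" using A by (simp add: em N_def ennreal_neg)
  qed
qed

end

section \<open>Norming functionals\<close>

definition sublinear :: "('v::real_vector \<Rightarrow> real) \<Rightarrow> bool" where
  "sublinear q \<longleftrightarrow> (\<forall>x y. q (x + y) \<le> q x + q y) \<and> (\<forall>t>0. \<forall>x. q (t *\<^sub>R x) = t * q x)"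

lemma sublinearD:
  assumes "sublinear q"
  shows "q (x + y) \<le> q x + q y" "0 \<le> t \<Longrightarrow> q (t *\<^sub>R x) = t * q x" "q 0 = 0" "- q (- x) \<le> q x"
proof -
  show add: "q (x + y) \<le> q x + q y" for x y using assms by (auto simp: sublinear_def)
  have "q (2 *\<^sub>R 0) = 2 * q 0" using assms unfolding sublinear_def by (metis zero_less_numeral)
  then show 0: "q 0 = 0" by simp
  show "q (t *\<^sub>R x) = t * q x" if "0 \<le> t"
    using that assms 0 by (cases "t = 0") (auto simp: sublinear_def)
  show "- q (- x) \<le> q x" using add[of x "- x"] 0 by simp
qed

text \<open>A minimal sublinear functional is fixed by this operation, which forces it to be linear.\<close>

definition shift :: "('v::real_vector \<Rightarrow> real) \<Rightarrow> 'v \<Rightarrow> 'v \<Rightarrow> real" where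
  "shift q y x = (INF t\<in>{0..}. q (x + t *\<^sub>R y) - t * q y)"

text \<open>Subadditivity gives the lower bound \<open>- q (- x)\<close>, without which the real
  infimum would carry no information.\<close>

lemma shift_le:
  assumes "sublinear q" "0 \<le> t"
  shows "shift q y x \<le> q (x + t *\<^sub>R y) - t * q y"
  unfolding shift_def
proof (rule cINF_lower)
  show "bdd_below ((\<lambda>t. q (x + t *\<^sub>R y) - t * q y) ` {0..})"
  proof (intro bdd_belowI2)
    fix t :: real assume "t \<in> {0..}"
    then show "- q (- x) \<le> q (x + t *\<^sub>R y) - t * q y"
      using sublinearD(1)[OF assms(1), of "x + t *\<^sub>R y" "- x"] sublinearD(2)[OF assms(1), of t y] by simp
  qed
qed (use assms in auto)

text \<open>Parameters \<open>t\<close> and \<open>u\<close> for two summands combine to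
  \<open>t + u\<close>, and scaling by \<open>a\<close> replaces \<open>t\<close> by
  \<open>a * t\<close>. One inequality suffices for homogeneity, the other being its instance for
  \<open>inverse a\<close>.\<close>

lemma sublinear_shift:
  assumes q: "sublinear q"
  shows "sublinear (shift q y)"
  unfolding sublinear_def
proof (intro conjI allI impI)
  have ge: "c \<le> shift q y x" if "\<And>t. 0 \<le> t \<Longrightarrow> c \<le> q (x + t *\<^sub>R y) - t * q y" for c x
    unfolding shift_def using that by (intro cINF_greatest) auto
  fix x z
  have *: "shift q y (x + z) \<le> (q (x + t *\<^sub>R y) - t * q y) + (q (z + u *\<^sub>R y) - u * q y)"
    if "0 \<le> t" "0 \<le> u" for t u
  proof -
    have "shift q y (x + z) \<le> q ((x + z) + (t + u) *\<^sub>R y) - (t + u) * q y"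
      using that by (intro shift_le[OF q]) auto
    also have "(x + z) + (t + u) *\<^sub>R y = (x + t *\<^sub>R y) + (z + u *\<^sub>R y)"
      by (simp add: algebra_simps)
    finally show ?thesis
      using sublinearD(1)[OF q, of "x + t *\<^sub>R y" "z + u *\<^sub>R y"] by (simp add: algebra_simps)
  qed
  have "shift q y (x + z) - (q (x + t *\<^sub>R y) - t * q y) \<le> shift q y z" if t: "0 \<le> t" for t
  proof (rule ge)
    fix u :: real assume "0 \<le> u"
    from *[OF t this] show "shift q y (x + z) - (q (x + t *\<^sub>R y) - t * q y) \<le> q (z + u *\<^sub>R y) - u * q y"
      by linarith
  qed
  then have "shift q y (x + z) - shift q y z \<le> shift q y x"
    by (intro ge) (simp add: algebra_simps)
  then show "shift q y (x + z) \<le> shift q y x + shift q y z" by simp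
next
  have ge: "c \<le> shift q y x" if "\<And>t. 0 \<le> t \<Longrightarrow> c \<le> q (x + t *\<^sub>R y) - t * q y" for c x
    unfolding shift_def using that by (intro cINF_greatest) auto
  have le: "shift q y (a *\<^sub>R x) \<le> a * shift q y x" if a: "0 < a" for a :: real and x
  proof -
    have "shift q y (a *\<^sub>R x) / a \<le> shift q y x"
    proof (rule ge)
      fix t :: real assume t: "0 \<le> t"
      have "shift q y (a *\<^sub>R x) \<le> q (a *\<^sub>R x + (a * t) *\<^sub>R y) - (a * t) * q y"
        using t a by (intro shift_le[OF q]) auto
      also have "a *\<^sub>R x + (a * t) *\<^sub>R y = a *\<^sub>R (x + t *\<^sub>R y)" by (simp add: algebra_simps)
      also have "q (a *\<^sub>R (x + t *\<^sub>R y)) = a * q (x + t *\<^sub>R y)" using a by (intro sublinearD(2)[OF q]) auto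
      finally show "shift q y (a *\<^sub>R x) / a \<le> q (x + t *\<^sub>R y) - t * q y"
        using a by (simp add: field_simps)
    qed
    then show ?thesis using a by (simp add: field_simps)
  qed
  fix a :: real and x assume a: "0 < a"
  have "shift q y (inverse a *\<^sub>R (a *\<^sub>R x)) \<le> inverse a * shift q y (a *\<^sub>R x)"
    using a by (intro le) auto
  then have "a * shift q y x \<le> shift q y (a *\<^sub>R x)" using a by (simp add: field_simps)
  with le[OF a, of x] show "shift q y (a *\<^sub>R x) = a * shift q y x" by simp
qed

text \<open>Zorn's lemma with pointwise infima as lower bounds of chains. They are finite because
  every member is at least \<open>- p (- x)\<close>, and subadditive because for two members of a
  chain the smaller one serves both summands.\<close>

lemma exists_minimal_sublinear:
  fixes p :: "'v::real_vector \<Rightarrow> real"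
  assumes p: "sublinear p"
  obtains q where "sublinear q" "q \<le> p" "\<And>r. sublinear r \<Longrightarrow> r \<le> q \<Longrightarrow> r = q"
proof -
  define A where "A = {q. sublinear q \<and> q \<le> p}"
  have "\<exists>m\<in>A. \<forall>a\<in>A. a \<le> m \<longrightarrow> a = m"
  proof (rule predicate_Zorn)
    show "partial_order_on A (relation_of (\<lambda>x y. y \<le> x) A)"
      by (auto simp: partial_order_on_def preorder_on_def refl_on_def trans_def antisym_def relation_of_def)
    fix C assume C: "C \<in> Chains (relation_of (\<lambda>x y. y \<le> x) A)"
    then have CA: "C \<subseteq> A" and chain: "\<And>q r. q \<in> C \<Longrightarrow> r \<in> C \<Longrightarrow> q \<le> r \<or> r \<le> q"
      by (auto simp: Chains_def relation_of_def)
    show "\<exists>u\<in>A. \<forall>a\<in>C. u \<le> a"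
    proof (cases "C = {}")
      case True
      then show ?thesis using p by (auto simp: A_def)
    next
      case False
      define u where "u x = (INF q\<in>C. q x)" for x
      have low: "u x \<le> q x" if "q \<in> C" for q x
        unfolding u_def
      proof (rule cINF_lower[OF _ that])
        show "bdd_below ((\<lambda>q. q x) ` C)"
        proof (intro bdd_belowI2)
          fix q assume "q \<in> C"
          then have "sublinear q" "q (- x) \<le> p (- x)" using CA by (auto simp: A_def le_fun_def)
          then show "- p (- x) \<le> q x" using sublinearD(4)[of q x] by simp
        qed
      qed
      have ge: "c \<le> u x" if "\<And>q. q \<in> C \<Longrightarrow> c \<le> q x" for c x
        unfolding u_def using that False by (intro cINF_greatest) auto
      have "sublinear u"
        unfolding sublinear_def
      proof (intro conjI allI impI)
        fix x y
        have *: "u (x + y) \<le> q x + r y" if qr: "q \<in> C" "r \<in> C" for q r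
        proof -
          obtain w where w: "w \<in> C" "w \<le> q" "w \<le> r" using chain[OF qr] qr by blast
          have "sublinear w" using w CA by (auto simp: A_def)
          have "u (x + y) \<le> w (x + y)" by (rule low[OF w(1)])
          also have "\<dots> \<le> w x + w y" by (rule sublinearD(1)[OF \<open>sublinear w\<close>])
          also have "\<dots> \<le> q x + r y" using w by (intro add_mono) (auto simp: le_fun_def)
          finally show ?thesis .
        qed
        have "u (x + y) - q x \<le> u y" if q: "q \<in> C" for q
        proof (rule ge)
          fix r assume "r \<in> C"
          from *[OF q this] show "u (x + y) - q x \<le> r y" by linarith
        qed
        then have "u (x + y) - u y \<le> u x" by (intro ge) (simp add: algebra_simps)
        then show "u (x + y) \<le> u x + u y" by simp
      next
        have le: "u (t *\<^sub>R x) \<le> t * u x" if t: "0 < t" for t x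
        proof -
          have "u (t *\<^sub>R x) / t \<le> u x"
          proof (rule ge)
            fix q assume q: "q \<in> C"
            then have "q (t *\<^sub>R x) = t * q x" using CA t by (intro sublinearD(2)) (auto simp: A_def)
            then show "u (t *\<^sub>R x) / t \<le> q x" using low[OF q, of "t *\<^sub>R x"] t by (simp add: field_simps)
          qed
          then show ?thesis using t by (simp add: field_simps)
        qed
        fix t :: real and x assume t: "0 < t"
        have "u (inverse t *\<^sub>R (t *\<^sub>R x)) \<le> inverse t * u (t *\<^sub>R x)" using t by (intro le) auto
        then have "t * u x \<le> u (t *\<^sub>R x)" using t by (simp add: field_simps)
        with le[OF t, of x] show "u (t *\<^sub>R x) = t * u x" by simp
      qed
      moreover have "u \<le> p"
      proof -
        obtain q where "q \<in> C" using False by auto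
        then have "u \<le> q" "q \<le> p" using low CA by (auto simp: le_fun_def A_def)
        then show ?thesis by (rule order_trans)
      qed
      ultimately show ?thesis using low by (auto simp: A_def le_fun_def)
    qed
  qed
  then obtain q where "q \<in> A" "\<And>a. a \<in> A \<Longrightarrow> a \<le> q \<Longrightarrow> a = q" by blast
  then show ?thesis by (intro that[of q]) (auto simp: A_def intro: order_trans)
qed

text \<open>Minimality is sought below \<open>shift norm z0\<close> instead of the norm. Its value
  at \<open>- z0\<close> is at most \<open>- norm z0\<close>, which already forces
  \<open>q z0\<close> to be \<open>norm z0\<close>, so no extension from the line through
  \<open>z0\<close> is involved.\<close>

lemma Hahn_Banach_norming:
  fixes z0 :: "'v::real_normed_vector"
  obtains \<phi> where "linear \<phi>" "\<And>z. \<bar>\<phi> z\<bar> \<le> norm z" "\<phi> z0 = norm z0"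
proof -
  have "sublinear (norm :: 'v \<Rightarrow> real)"
    by (auto simp: sublinear_def norm_triangle_ineq)
  note norm = this sublinear_shift[OF this, of z0]
  obtain q where q: "sublinear q" "q \<le> shift norm z0" "\<And>r. sublinear r \<Longrightarrow> r \<le> q \<Longrightarrow> r = q"
    using exists_minimal_sublinear[OF norm(2)] by blast
  have sh: "shift q y = q" for y
    using shift_le[OF q(1), of 0 y] by (intro q(3) sublinear_shift q(1)) (auto simp: le_fun_def)
  have neg: "q (- y) = - q y" for y
  proof (rule antisym)
    show "q (- y) \<le> - q y"
      using shift_le[OF q(1), of 1 y "- y"] sublinearD(3)[OF q(1)] by (simp add: sh)
    show "- q y \<le> q (- y)" using sublinearD(4)[OF q(1), of "- y"] by simp
  qed
  have le: "q z \<le> norm z" for z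
    using q(2) shift_le[OF norm(1), of 0 z0 z] by (auto simp: le_fun_def intro: order_trans)
  show ?thesis
  proof (rule that[of q])
    show "linear q"
    proof (rule linearI)
      show "q (x + y) = q x + q y" for x y
        using sublinearD(1)[OF q(1), of x y] sublinearD(1)[OF q(1), of "x + y" "- y"] by (simp add: neg)
      fix t :: real and x
      show "q (t *\<^sub>R x) = t *\<^sub>R q x"
      proof (cases "0 \<le> t")
        case True
        then show ?thesis by (simp add: sublinearD(2)[OF q(1)])
      next
        case False
        then have "q ((- t) *\<^sub>R x) = (- t) * q x" by (intro sublinearD(2)[OF q(1)]) simp
        then show ?thesis by (simp add: neg)
      qed
    qed
    show "\<bar>q z\<bar> \<le> norm z" for z using le[of z] le[of "- z"] by (simp add: neg)
    have "q (- z0) \<le> shift norm z0 (- z0)" using q(2) by (simp add: le_fun_def)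
    also have "\<dots> \<le> - norm z0" using shift_le[OF norm(1), of 1 z0 "- z0"] by simp
    finally have "norm z0 \<le> q z0" by (simp add: neg)
    with le[of z0] show "q z0 = norm z0" by simp
  qed
qed

section \<open>Vector measures\<close>

text \<open>Convergence at every point makes the norm measurable with respect to \<open>M\<close>
  itself, so that outer measures turn into measures.\<close>

definition strongly_measurable :: "'s measure \<Rightarrow> ('s \<Rightarrow> 'z::banach) \<Rightarrow> bool" where
  "strongly_measurable M f \<longleftrightarrow>
     (\<exists>u. (\<forall>n. simple_function M (u n)) \<and> (\<forall>s\<in>space M. (\<lambda>n. u n s) \<longlonglongrightarrow> f s))"

lemma strongly_measurable_imp_bochner: "strongly_measurable M f \<Longrightarrow> bochner_measurable M f"
  unfolding strongly_measurable_def bochner_measurable_def by (blast intro: AE_I2)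

text \<open>Both the function and its approximants are set to 0 on a measurable null set containing
  all points of divergence.\<close>

lemma bochner_measurable_strong_version:
  assumes "bochner_measurable M f"
  obtains g where "strongly_measurable M g" "AE s in M. f s = g s"
proof -
  obtain u where u: "\<And>n. simple_function M (u n)" "AE s in M. (\<lambda>n. u n s) \<longlonglongrightarrow> f s"
    using assms by (auto simp: bochner_measurable_def)
  obtain N where N: "{s\<in>space M. \<not> (\<lambda>n. u n s) \<longlonglongrightarrow> f s} \<subseteq> N" "emeasure M N = 0" "N \<in> sets M"
    using u(2) by (rule AE_E)
  define g where "g s = (if s \<in> N then 0 else f s)" for s
  show ?thesis
  proof (rule that[of g])
    show "strongly_measurable M g"
      unfolding strongly_measurable_def
    proof (intro exI[of _ "\<lambda>n s. if s \<in> N then 0 else u n s"] conjI allI ballI)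
      show "simple_function M (\<lambda>s. if s \<in> N then 0 else u n s)" for n
        using u(1)[of n] N(3) by (intro simple_function_If_set) auto
      show "(\<lambda>n. if s \<in> N then 0 else u n s) \<longlonglongrightarrow> g s" if "s \<in> space M" for s
        using N(1) that by (auto simp: g_def)
    qed
    have "AE s in M. s \<notin> N" using N by (intro AE_not_in) auto
    then show "AE s in M. f s = g s" by eventually_elim (simp add: g_def)
  qed
qed

lemma strongly_measurable_zero: "strongly_measurable M (\<lambda>_. 0)"
  unfolding strongly_measurable_def by (intro exI[of _ "\<lambda>_ _. 0"]) auto

lemma strongly_measurable_add:
  assumes "strongly_measurable M f" "strongly_measurable M g"
  shows "strongly_measurable M (\<lambda>s. f s + g s)"
proof -
  obtain u v where uv: "\<forall>n. simple_function M (u n)" "\<forall>s\<in>space M. (\<lambda>n. u n s) \<longlonglongrightarrow> f s"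
    "\<forall>n. simple_function M (v n)" "\<forall>s\<in>space M. (\<lambda>n. v n s) \<longlonglongrightarrow> g s"
    using assms unfolding strongly_measurable_def by blast
  have "simple_function M (\<lambda>s. u n s + v n s)" for n
    using uv(1,3) by (intro simple_function_compose2[where h = "(+)"]) auto
  moreover have "\<forall>s\<in>space M. (\<lambda>n. u n s + v n s) \<longlonglongrightarrow> f s + g s"
    using uv(2,4) by (simp add: tendsto_add)
  ultimately show ?thesis
    unfolding strongly_measurable_def by (intro exI[of _ "\<lambda>n s. u n s + v n s"]) simp
qed

lemma strongly_measurable_uminus:
  assumes "strongly_measurable M f"
  shows "strongly_measurable M (\<lambda>s. - f s)"
proof -
  obtain u where u: "\<forall>n. simple_function M (u n)" "\<forall>s\<in>space M. (\<lambda>n. u n s) \<longlonglongrightarrow> f s"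
    using assms unfolding strongly_measurable_def by blast
  have "simple_function M (\<lambda>s. - u n s)" for n
    using u(1) by (intro simple_function_compose1[where g = uminus]) auto
  moreover have "\<forall>s\<in>space M. (\<lambda>n. - u n s) \<longlonglongrightarrow> - f s"
    using u(2) by (simp add: tendsto_minus)
  ultimately show ?thesis
    unfolding strongly_measurable_def by (intro exI[of _ "\<lambda>n s. - u n s"]) simp
qed

lemma strongly_measurable_diff:
  assumes "strongly_measurable M f" "strongly_measurable M g"
  shows "strongly_measurable M (\<lambda>s. f s - g s)"
  using strongly_measurable_add[OF assms(1) strongly_measurable_uminus[OF assms(2)]] by simp

lemma strongly_measurable_sum:
  assumes "\<And>i. i \<in> I \<Longrightarrow> strongly_measurable M (f i)"
  shows "strongly_measurable M (\<lambda>s. \<Sum>i\<in>I. f i s)"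
  using assms
proof (induction I rule: infinite_finite_induct)
  case (insert i I)
  then have "strongly_measurable M (\<lambda>s. f i s + (\<Sum>i\<in>I. f i s))"
    by (intro strongly_measurable_add) simp_all
  then show ?case using insert.hyps by simp
qed (simp_all add: strongly_measurable_zero)

lemma borel_measurable_strongly:
  fixes \<phi> :: "'z::banach \<Rightarrow> real"
  assumes "strongly_measurable M f" and \<phi>: "continuous_on UNIV \<phi>"
  shows "(\<lambda>s. \<phi> (f s)) \<in> borel_measurable M"
proof -
  obtain u where u: "\<And>n. simple_function M (u n)" "\<And>s. s \<in> space M \<Longrightarrow> (\<lambda>n. u n s) \<longlonglongrightarrow> f s"
    using assms(1) unfolding strongly_measurable_def by blast
  show ?thesis
  proof (rule borel_measurable_LIMSEQ_real)
    show "(\<lambda>n. \<phi> (u n s)) \<longlonglongrightarrow> \<phi> (f s)" if "s \<in> space M" for s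
      by (rule continuous_on_tendsto_compose[OF \<phi> u(2)[OF that]]) auto
    show "(\<lambda>s. \<phi> (u n s)) \<in> borel_measurable M" for n
      by (rule borel_measurable_simple_function[OF simple_function_compose1[OF u(1)]])
  qed
qed

lemma borel_measurable_norm_strongly:
  "strongly_measurable M f \<Longrightarrow> (\<lambda>s. norm (f s)) \<in> borel_measurable M"
  by (rule borel_measurable_strongly[OF _ continuous_on_norm[OF continuous_on_id]])

text \<open>Functionals norming the countably many values of the approximating simple functions
  suffice to detect nonzero values.\<close>

lemma strongly_measurable_functional_nonzero:
  fixes f :: "'s \<Rightarrow> 'z::banach"
  assumes f: "strongly_measurable M f" and nz: "\<not> (AE s in M. f s = 0)"
  obtains \<phi> :: "'z \<Rightarrow> real" where "linear \<phi>" "\<And>z. \<bar>\<phi> z\<bar> \<le> norm z" "\<not> (AE s in M. \<phi> (f s) = 0)"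
proof -
  have "\<exists>\<phi> :: 'z \<Rightarrow> real. linear \<phi> \<and> (\<forall>z. \<bar>\<phi> z\<bar> \<le> norm z) \<and> \<not> (AE s in M. \<phi> (f s) = 0)"
  proof (rule ccontr)
    assume *: "\<not> ?thesis"
    have zero: "AE s in M. \<phi> (f s) = 0" if "linear \<phi>" "\<And>z. \<bar>\<phi> z\<bar> \<le> norm z" for \<phi> :: "'z \<Rightarrow> real"
      using * that by blast
    obtain u where u: "\<And>n. simple_function M (u n)" "\<And>s. s \<in> space M \<Longrightarrow> (\<lambda>n. u n s) \<longlonglongrightarrow> f s"
      using f unfolding strongly_measurable_def by blast
    define R where "R = (\<Union>n. u n ` space M)"
    have R: "countable R" unfolding R_def using u(1) by (auto intro: countable_finite simp: simple_function_def)
    have "\<exists>\<phi>. linear \<phi> \<and> (\<forall>z. \<bar>\<phi> z\<bar> \<le> norm z) \<and> \<phi> c = norm c" for c :: 'z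
      using Hahn_Banach_norming[of c] by metis
    then obtain \<phi> :: "'z \<Rightarrow> 'z \<Rightarrow> real" where \<phi>: "\<And>c. linear (\<phi> c)" "\<And>c z. \<bar>\<phi> c z\<bar> \<le> norm z" "\<And>c. \<phi> c c = norm c"
      by metis
    have "AE s in M. \<forall>c\<in>R. \<phi> c (f s) = 0"
      using zero[OF \<phi>(1,2)] R by (subst AE_ball_countable) auto
    with AE_space have "AE s in M. f s = 0"
    proof eventually_elim
      case (elim s)
      \<comment> \<open>The functional norming \<open>u n s\<close> vanishes at \<open>f s\<close>,
        so \<open>norm (u n s)\<close> is bounded by the approximation error and tends to 0.\<close>
      have le: "norm (u n s) \<le> norm (u n s - f s)" for n
      proof -
        have "u n s \<in> R" using elim by (auto simp: R_def)
        then have "norm (u n s) = \<phi> (u n s) (u n s - f s)"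
          using elim by (simp add: \<phi>(3) linear_diff[OF \<phi>(1)])
        also have "\<dots> \<le> norm (u n s - f s)" using \<phi>(2)[of "u n s" "u n s - f s"] by simp
        finally show ?thesis .
      qed
      have "(\<lambda>n. norm (u n s - f s)) \<longlonglongrightarrow> 0"
        using u(2)[OF elim(1)] by (simp add: LIM_zero tendsto_norm_zero)
      then have "(\<lambda>n. norm (u n s)) \<longlonglongrightarrow> 0"
        by (rule tendsto_sandwich[OF _ _ tendsto_const, rotated 2]) (use le in \<open>auto intro: always_eventually\<close>)
      moreover have "(\<lambda>n. norm (u n s)) \<longlonglongrightarrow> norm (f s)" using u(2)[OF elim(1)] by (rule tendsto_norm)
      ultimately have "0 = norm (f s)" by (rule LIMSEQ_unique)
      then show ?case by simp
    qed
    with nz show False by simp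
  qed
  then show thesis using that by blast
qed

text \<open>Some admissible \<epsilon> lies below \<delta>. For a real infimum this requires the set
  to be nonempty; total mass plus 1 is a member.\<close>

lemma outer_measure_of_less_in_measure_norm:
  assumes "finite_measure M" and "in_measure_norm M f < \<delta>"
  shows "outer_measure_of M {s \<in> space M. \<delta> \<le> norm (f s)} \<le> ennreal \<delta>"
proof -
  interpret finite_measure M by fact
  let ?S = "{\<epsilon>. \<epsilon> > 0 \<and> outer_measure_of M {s \<in> space M. norm (f s) \<ge> \<epsilon>} \<le> ennreal \<epsilon>}"
  have "outer_measure_of M X \<le> ennreal (measure M (space M) + 1)" if "X \<subseteq> space M" for X
  proof -
    have "outer_measure_of M X \<le> outer_measure_of M (space M)" using that by (rule outer_measure_of_mono)
    also have "\<dots> = ennreal (measure M (space M))" by (simp add: emeasure_eq_measure)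
    also have "\<dots> \<le> ennreal (measure M (space M) + 1)" by (intro ennreal_leI) simp
    finally show ?thesis .
  qed
  then have "measure M (space M) + 1 \<in> ?S" by (auto intro: add_nonneg_pos)
  then have "?S \<noteq> {}" by blast
  then obtain \<epsilon> where \<epsilon>: "\<epsilon> \<in> ?S" "\<epsilon> < \<delta>"
    using cInf_lessD[of ?S \<delta>] assms(2) unfolding in_measure_norm_def by blast
  have "outer_measure_of M {s \<in> space M. \<delta> \<le> norm (f s)} \<le> outer_measure_of M {s \<in> space M. \<epsilon> \<le> norm (f s)}"
    using \<epsilon> by (intro outer_measure_of_mono) auto
  also have "\<dots> \<le> ennreal \<epsilon>" using \<epsilon> by simp
  also have "\<dots> \<le> ennreal \<delta>" using \<epsilon> by (intro ennreal_leI) simp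
  finally show ?thesis .
qed

text \<open>The weights are positive, so a null set of the sum is null for every summand, and they
  make the total masses summable. Writing the sum as an integral over counting measure allows it to
  be exchanged with the series over sets.\<close>

lemma countable_sum_of_measures:
  fixes \<nu> :: "nat \<Rightarrow> 'e measure"
  assumes sa: "sigma_algebra E \<E>"
    and \<nu>: "\<And>i. space (\<nu> i) = E" "\<And>i. sets (\<nu> i) = \<E>" "\<And>i. finite_measure (\<nu> i)"
  obtains \<rho> :: "'e measure" where "space \<rho> = E" "sets \<rho> = \<E>" "finite_measure \<rho>"
    and "\<And>A i. A \<in> \<E> \<Longrightarrow> emeasure \<rho> A = 0 \<Longrightarrow> emeasure (\<nu> i) A = 0"
proof -
  interpret sigma_algebra E \<E> by (rule sa)
  define c where "c i = ennreal ((1 / 2) ^ i / (1 + measure (\<nu> i) E))" for i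
  have c0: "0 < c i" for i unfolding c_def by (simp add: add_pos_nonneg)
  define N where "N A = (\<integral>\<^sup>+i. c i * emeasure (\<nu> i) A \<partial>count_space UNIV)" for A
  have N1: "positive \<E> N" by (simp add: positive_def N_def)
  have N2: "countably_additive \<E> N"
    unfolding countably_additive_def
  proof (intro allI impI)
    fix A :: "nat \<Rightarrow> 'e set" assume A: "range A \<subseteq> \<E>" "disjoint_family A"
    have "(\<Sum>j. N (A j)) = (\<integral>\<^sup>+i. (\<Sum>j. c i * emeasure (\<nu> i) (A j)) \<partial>count_space UNIV)"
      unfolding N_def by (rule nn_integral_suminf[symmetric]) simp
    also have "\<dots> = N (\<Union>j. A j)"
      unfolding N_def using A \<nu>(2) by (intro nn_integral_cong) (simp add: suminf_emeasure)
    finally show "(\<Sum>j. N (A j)) = N (\<Union>j. A j)" .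
  qed
  define \<rho> where "\<rho> = measure_of E \<E> N"
  have sp: "space \<rho> = E" "sets \<rho> = \<E>" by (simp_all add: \<rho>_def space_measure_of_conv)
  have em: "emeasure \<rho> A = N A" if "A \<in> \<E>" for A
    unfolding \<rho>_def using that N1 N2 by (rule emeasure_measure_of_sigma[OF sa, rotated 2])
  show ?thesis
  proof (rule that[OF sp])
    have "N E \<le> (\<integral>\<^sup>+i. ennreal ((1 / 2) ^ i) \<partial>count_space (UNIV :: nat set))"
      unfolding N_def
    proof (rule nn_integral_mono)
      fix i :: nat
      interpret finite_measure "\<nu> i" by (rule \<nu>(3))
      let ?x = "measure (\<nu> i) E"
      have "c i * emeasure (\<nu> i) E = ennreal ((1 / 2) ^ i / (1 + ?x) * ?x)"
        unfolding c_def emeasure_eq_measure by (rule ennreal_mult[symmetric]) simp_all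
      also have "\<dots> \<le> ennreal ((1 / 2) ^ i)"
      proof (rule ennreal_leI)
        have "(1 / 2) ^ i / (1 + ?x) * ?x = (1 / 2) ^ i * (?x / (1 + ?x))" by simp
        also have "\<dots> \<le> (1 / 2) ^ i * 1"
        proof (rule mult_left_mono)
          have "0 < 1 + ?x" by (simp add: add_pos_nonneg)
          then show "?x / (1 + ?x) \<le> 1" by (simp add: divide_le_eq)
        qed simp
        finally show "(1 / 2) ^ i / (1 + ?x) * ?x \<le> (1 / 2) ^ i" by simp
      qed
      finally show "c i * emeasure (\<nu> i) E \<le> ennreal ((1 / 2) ^ i)" .
    qed
    also have "\<dots> = (\<Sum>i. ennreal ((1 / 2) ^ i))" by (rule nn_integral_count_space_nat)
    also have "\<dots> = ennreal (\<Sum>i. (1 / 2) ^ i)" by (rule suminf_ennreal2) (auto intro: summable_geometric)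
    also have "\<dots> < \<infinity>" by simp
    finally show "finite_measure \<rho>" by (intro finite_measureI) (simp add: sp em)
    fix A i assume A: "A \<in> \<E>" "emeasure \<rho> A = 0"
    then have "AE i in count_space UNIV. c i * emeasure (\<nu> i) A = 0"
      by (simp add: em N_def nn_integral_0_iff_AE)
    then show "emeasure (\<nu> i) A = 0" using c0[of i] by (auto simp: AE_count_space dest: spec[of _ i])
  qed
qed

text \<open>Exhaustion by Zorn's lemma: a set of \<open>P\<close> missing the union could be added
  to a maximal disjoint family. A nonempty such set would be new, hence the condition on the empty
  set. Countability keeps the union inside a \<sigma>-algebra.\<close>

lemma countable_maximal_disjoint:
  assumes ccc: "\<And>D. D \<subseteq> P \<Longrightarrow> disjoint D \<Longrightarrow> countable D" and ne: "{} \<notin> P"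
  obtains D where "D \<subseteq> P" "countable D" "disjoint D" "\<And>A. A \<in> P \<Longrightarrow> A \<inter> \<Union>D \<noteq> {}"
proof -
  let ?A = "{D. D \<subseteq> P \<and> disjoint D}"
  have "\<exists>D\<in>?A. \<forall>X\<in>?A. D \<subseteq> X \<longrightarrow> X = D"
  proof (rule subset_Zorn')
    fix C assume C: "subset.chain ?A C"
    have "disjoint (\<Union>C)"
    proof (rule disjointI)
      fix a b assume ab: "a \<in> \<Union>C" "b \<in> \<Union>C" "a \<noteq> b"
      then obtain X Y where XY: "X \<in> C" "Y \<in> C" "a \<in> X" "b \<in> Y" by auto
      then obtain Z where "Z \<in> C" "a \<in> Z" "b \<in> Z"
        using C unfolding subset.chain_def by blast
      moreover have "disjoint Z" using C \<open>Z \<in> C\<close> by (auto simp: subset.chain_def)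
      ultimately show "a \<inter> b = {}" using ab(3) by (auto simp: disjoint_def)
    qed
    moreover have "\<Union>C \<subseteq> P" using C by (auto simp: subset.chain_def)
    ultimately show "\<Union>C \<in> ?A" by simp
  qed
  then obtain D where D: "D \<subseteq> P" "disjoint D" "\<And>X. X \<subseteq> P \<Longrightarrow> disjoint X \<Longrightarrow> D \<subseteq> X \<Longrightarrow> X = D" by auto
  show ?thesis
  proof (rule that[OF D(1) ccc[OF D(1,2)] D(2)])
    fix A assume A: "A \<in> P"
    show "A \<inter> \<Union>D \<noteq> {}"
    proof
      assume disj: "A \<inter> \<Union>D = {}"
      have "disjoint (insert A D)" using D(2) disj by (auto simp: disjoint_def)
      then have "insert A D = D" using A D(1) by (intro D(3)) auto
      then have "A \<subseteq> \<Union>D" by auto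
      with disj have "A = {}" by auto
      with A ne show False by simp
    qed
  qed
qed

section \<open>Countable chain condition and exhaustion\<close>

locale strong_L0_measure = finite_measure M + sigma_algebra E \<E>
  for M :: "'s measure" and E :: "'e set" and \<E> :: "'e set set" +
  fixes r :: "'e set \<Rightarrow> 's \<Rightarrow> 'z::banach"
  assumes strong: "A \<in> \<E> \<Longrightarrow> strongly_measurable M (r A)"
    and norm_sums: "range B \<subseteq> \<E> \<Longrightarrow> disjoint_family B \<Longrightarrow> 0 < \<delta> \<Longrightarrow>
      (\<lambda>n. measure M {s\<in>space M. \<delta> \<le> norm ((\<Sum>i<n. r (B i) s) - r (\<Union>i. B i) s)}) \<longlonglongrightarrow> 0"
begin

lemma sets_norm_ge:
  assumes "strongly_measurable M g"
  shows "{s\<in>space M. \<delta> \<le> norm (g s)} \<in> sets M"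
  using borel_measurable_norm_strongly[OF assms] by measurable

lemma strong_partial_sum:
  fixes B :: "nat \<Rightarrow> 'e set"
  assumes "range B \<subseteq> \<E>"
  shows "strongly_measurable M (\<lambda>s. (\<Sum>i<n. r (B i) s) - r (\<Union>i. B i) s)"
  using assms countable_nat_UN[OF assms]
  by (intro strongly_measurable_diff strongly_measurable_sum strong) auto

text \<open>The bound by the norm transfers convergence in measure. Intersecting with
  \<open>A0\<close> makes the value at the whole space that of \<open>A0\<close>, so the scalar
  theorem can be applied to any set.\<close>

lemma scalar_L0_measure_functional:
  assumes \<phi>: "linear \<phi>" "\<And>z. \<bar>\<phi> z\<bar> \<le> norm (z :: 'z)" and A0: "A0 \<in> \<E>"
  shows "scalar_L0_measure M E \<E> (\<lambda>A s. \<phi> (r (A \<inter> A0) s))"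
proof unfold_locales
  have bl: "bounded_linear \<phi>"
    using \<phi> by (intro bounded_linear_intro[of _ 1]) (auto simp: linear_add linear_cmul)
  show "(\<lambda>s. \<phi> (r (A \<inter> A0) s)) \<in> borel_measurable M" if "A \<in> \<E>" for A
    using that A0 by (intro borel_measurable_strongly strong linear_continuous_on bl Int)
  fix B :: "nat \<Rightarrow> 'e set" and \<delta> :: real
  assume B: "range B \<subseteq> \<E>" "disjoint_family B" and \<delta>: "0 < \<delta>"
  let ?B = "\<lambda>i. B i \<inter> A0"
  have B': "range ?B \<subseteq> \<E>" "disjoint_family ?B"
    using B A0 by (auto simp: disjoint_family_on_def)
  have U: "(\<Union>i. ?B i) = (\<Union>i. B i) \<inter> A0" by auto
  let ?m = "\<lambda>n. measure M {s\<in>space M. \<delta> \<le> norm ((\<Sum>i<n. r (?B i) s) - r ((\<Union>i. B i) \<inter> A0) s)}"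
  have lim: "?m \<longlonglongrightarrow> 0" using norm_sums[OF B' \<delta>] by (simp add: U)
  show "(\<lambda>n. measure M {s\<in>space M. \<delta> \<le> \<bar>(\<Sum>i<n. \<phi> (r (?B i) s)) - \<phi> (r ((\<Union>i. B i) \<inter> A0) s)\<bar>}) \<longlonglongrightarrow> 0"
  proof (rule tendsto_sandwich[OF _ _ tendsto_const lim])
    show "\<forall>\<^sub>F n in sequentially. measure M {s\<in>space M. \<delta> \<le>
        \<bar>(\<Sum>i<n. \<phi> (r (?B i) s)) - \<phi> (r ((\<Union>i. B i) \<inter> A0) s)\<bar>} \<le> ?m n"
    proof (intro always_eventually allI finite_measure_mono)
      fix n
      have "\<bar>(\<Sum>i<n. \<phi> (r (?B i) s)) - \<phi> (r ((\<Union>i. B i) \<inter> A0) s)\<bar> \<le>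
          norm ((\<Sum>i<n. r (?B i) s) - r ((\<Union>i. B i) \<inter> A0) s)" for s
        using \<phi>(2)[of "(\<Sum>i<n. r (?B i) s) - r ((\<Union>i. B i) \<inter> A0) s"]
        by (simp add: linear_diff[OF \<phi>(1)] linear_sum[OF \<phi>(1)])
      then show "{s\<in>space M. \<delta> \<le> \<bar>(\<Sum>i<n. \<phi> (r (?B i) s)) - \<phi> (r ((\<Union>i. B i) \<inter> A0) s)\<bar>} \<subseteq>
          {s\<in>space M. \<delta> \<le> norm ((\<Sum>i<n. r (?B i) s) - r ((\<Union>i. B i) \<inter> A0) s)}"
        by (auto intro: order_trans)
      show "{s\<in>space M. \<delta> \<le> norm ((\<Sum>i<n. r (?B i) s) - r ((\<Union>i. B i) \<inter> A0) s)} \<in> sets M"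
        using sets_norm_ge[OF strong_partial_sum[OF B'(1), of n], of \<delta>] by (simp only: U)
    qed
  qed simp
qed

lemma measure_zero_imp_AE:
  assumes g: "strongly_measurable M (g :: 's \<Rightarrow> 'z)"
    and "\<And>\<delta>. 0 < \<delta> \<Longrightarrow> measure M {s\<in>space M. \<delta> \<le> norm (g s)} = 0"
  shows "AE s in M. g s = 0"
proof -
  have "AE s in M. norm (g s) = 0"
    using assms(2) by (intro AE_zeroI borel_measurable_norm_strongly g) simp
  then show ?thesis by simp
qed

text \<open>All subsets are included because \<open>r A\<close> may vanish by cancellation; the
  hereditary version is an ideal and is stable under countable unions.\<close>

definition null :: "'e set \<Rightarrow> bool" where
  "null A \<longleftrightarrow> A \<in> \<E> \<and> (\<forall>B\<in>\<E>. B \<subseteq> A \<longrightarrow> (AE s in M. r B s = 0))"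

lemma null_subset: "null A \<Longrightarrow> B \<in> \<E> \<Longrightarrow> B \<subseteq> A \<Longrightarrow> null B"
  unfolding null_def by blast

text \<open>A subset is cut along the disjointed union into null pieces; the partial sums then
  vanish almost everywhere, and so does their limit.\<close>

lemma null_UN:
  assumes A: "\<And>i::nat. null (A i)"
  shows "null (\<Union>i. A i)"
  unfolding null_def
proof (intro conjI ballI impI)
  have Am: "A i \<in> \<E>" for i using A by (simp add: null_def)
  then show "(\<Union>i. A i) \<in> \<E>" by auto
  fix B assume B: "B \<in> \<E>" "B \<subseteq> (\<Union>i. A i)"
  define D where "D i = B \<inter> disjointed A i" for i
  have "range (disjointed A) \<subseteq> \<E>" using Am by (intro range_disjointed_sets) auto
  then have D: "range D \<subseteq> \<E>" using B by (auto simp: D_def)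
  have Dd: "disjoint_family D"
    using disjoint_family_disjointed[of A] by (auto simp: disjoint_family_on_def D_def)
  have U: "(\<Union>i. D i) = B" using B(2) UN_disjointed_eq[of A] by (auto simp: D_def)
  have "AE s in M. r (D i) s = 0" for i
  proof -
    have "D i \<subseteq> A i" "D i \<in> \<E>" using disjointed_subset[of A i] D by (auto simp: D_def)
    then show ?thesis using A[of i] unfolding null_def by blast
  qed
  then have D0: "AE s in M. \<forall>i. r (D i) s = 0" by (simp add: AE_all_countable)
  show "AE s in M. r B s = 0"
  proof (rule measure_zero_imp_AE[OF strong[OF B(1)]])
    fix \<delta> :: real assume \<delta>: "0 < \<delta>"
    have "measure M {s\<in>space M. \<delta> \<le> norm ((\<Sum>i<n. r (D i) s) - r (\<Union>i. D i) s)} =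
        measure M {s\<in>space M. \<delta> \<le> norm (r B s)}" for n
    proof (rule measure_eq_AE)
      show "AE s in M. (s \<in> {s\<in>space M. \<delta> \<le> norm ((\<Sum>i<n. r (D i) s) - r (\<Union>i. D i) s)}) =
          (s \<in> {s\<in>space M. \<delta> \<le> norm (r B s)})"
        using D0 by eventually_elim (simp add: U)
    qed (intro sets_norm_ge strong_partial_sum strong D B)+
    with norm_sums[OF D Dd \<delta>] show "measure M {s\<in>space M. \<delta> \<le> norm (r B s)} = 0"
      by (simp add: LIMSEQ_const_iff)
  qed
qed

lemma norm_tendsto_disjoint:
  assumes B: "range B \<subseteq> \<E>" "disjoint_family B" and \<delta>: "0 < \<delta>"
  shows "(\<lambda>n. measure M {s\<in>space M. \<delta> \<le> norm (r (B n) s)}) \<longlonglongrightarrow> 0"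
proof -
  define d where "d n s = (\<Sum>i<n. r (B i) s) - r (\<Union>i. B i) s" for n s
  let ?m = "\<lambda>n. measure M {s\<in>space M. \<delta> / 2 \<le> norm (d n s)}"
  have dm: "{s\<in>space M. \<delta> / 2 \<le> norm (d n s)} \<in> sets M" for n
    unfolding d_def by (intro sets_norm_ge strong_partial_sum B)
  have "?m \<longlonglongrightarrow> 0" using norm_sums[OF B, of "\<delta> / 2"] \<delta> by (simp add: d_def)
  then have lim: "(\<lambda>n. ?m (Suc n) + ?m n) \<longlonglongrightarrow> 0"
    using tendsto_add[OF LIMSEQ_Suc] by fastforce
  show ?thesis
  proof (rule tendsto_sandwich[OF _ _ tendsto_const lim])
    show "\<forall>\<^sub>F n in sequentially. measure M {s\<in>space M. \<delta> \<le> norm (r (B n) s)} \<le> ?m (Suc n) + ?m n"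
    proof (intro always_eventually allI)
      fix n
      have "norm (r (B n) s) \<le> norm (d (Suc n) s) + norm (d n s)" for s
        using norm_triangle_ineq4[of "d (Suc n) s" "d n s"] by (simp add: d_def)
      then have "\<delta> / 2 \<le> norm (d (Suc n) s) \<or> \<delta> / 2 \<le> norm (d n s)" if "\<delta> \<le> norm (r (B n) s)" for s
        using that by (smt (verit) field_sum_of_halves)
      then have "measure M {s\<in>space M. \<delta> \<le> norm (r (B n) s)} \<le>
          measure M ({s\<in>space M. \<delta> / 2 \<le> norm (d (Suc n) s)} \<union> {s\<in>space M. \<delta> / 2 \<le> norm (d n s)})"
        by (intro finite_measure_mono sets.Un dm) auto
      also have "\<dots> \<le> ?m (Suc n) + ?m n" by (intro measure_Un_le dm)
      finally show "measure M {s\<in>space M. \<delta> \<le> norm (r (B n) s)} \<le> ?m (Suc n) + ?m n" .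
    qed
  qed simp
qed

text \<open>Each member contains a set on which \<open>r\<close> is at least
  \<open>1 / Suc n\<close> on a set of at least that measure. If \<open>D\<close> were uncountable,
  some \<open>n\<close> would occur infinitely often, and the values on disjoint sets would not tend
  to 0.\<close>

lemma countable_disjoint_nonnull:
  assumes D: "D \<subseteq> {A\<in>\<E>. \<not> null A}" "disjoint D"
  shows "countable D"
proof (rule ccontr)
  assume unc: "\<not> countable D"
  have "\<exists>B n. B \<in> \<E> \<and> B \<subseteq> A \<and> 1 / real (Suc n) \<le> measure M {s\<in>space M. 1 / real (Suc n) \<le> norm (r B s)}"
    if A: "A \<in> D" for A
  proof -
    obtain B where B: "B \<in> \<E>" "B \<subseteq> A" "\<not> (AE s in M. r B s = 0)" using A D by (auto simp: null_def)
    obtain \<delta> where \<delta>: "0 < \<delta>" "measure M {s\<in>space M. \<delta> \<le> norm (r B s)} \<noteq> 0"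
      using measure_zero_imp_AE[OF strong[OF B(1)]] B(3) by blast
    define \<mu> where "\<mu> = measure M {s\<in>space M. \<delta> \<le> norm (r B s)}"
    have "0 < min \<delta> \<mu>" using \<delta> by (simp add: \<mu>_def zero_less_measure_iff)
    then obtain n where n: "1 / real (Suc n) < min \<delta> \<mu>" using nat_approx_posE by blast
    then have "\<mu> \<le> measure M {s\<in>space M. 1 / real (Suc n) \<le> norm (r B s)}"
      unfolding \<mu>_def by (intro finite_measure_mono sets_norm_ge strong B) auto
    then show ?thesis using B n by (intro exI[of _ B] exI[of _ n]) auto
  qed
  then obtain B n where B: "\<And>A. A \<in> D \<Longrightarrow> B A \<in> \<E>" "\<And>A. A \<in> D \<Longrightarrow> B A \<subseteq> A"
    "\<And>A. A \<in> D \<Longrightarrow> 1 / real (Suc (n A)) \<le> measure M {s\<in>space M. 1 / real (Suc (n A)) \<le> norm (r (B A) s)}"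
    by metis
  have "\<exists>k. infinite {A\<in>D. n A = k}"
  proof (rule ccontr)
    assume "\<not> ?thesis"
    then have "countable (\<Union>k. {A\<in>D. n A = k})"
      by (intro Countable_Set.countable_UN countableI_type) (auto intro: countable_finite)
    moreover have "(\<Union>k. {A\<in>D. n A = k}) = D" by auto
    ultimately show False using unc by simp
  qed
  then obtain k where "infinite {A\<in>D. n A = k}" by blast
  then obtain g :: "nat \<Rightarrow> 'e set" where g: "inj g" "range g \<subseteq> {A\<in>D. n A = k}"
    using infinite_countable_subset by blast
  have gD: "g j \<in> D" "n (g j) = k" for j using g(2) by auto
  have "disjoint_family (\<lambda>j. B (g j))"
    unfolding disjoint_family_on_def
  proof (intro ballI impI)
    fix i j :: nat assume "i \<noteq> j"
    then have "g i \<noteq> g j" using g(1) by (auto dest: injD)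
    then have "g i \<inter> g j = {}" using D(2) gD by (auto simp: disjoint_def)
    then show "B (g i) \<inter> B (g j) = {}" using B(2)[OF gD(1)[of i]] B(2)[OF gD(1)[of j]] by blast
  qed
  moreover have "range (\<lambda>j. B (g j)) \<subseteq> \<E>" using B(1) gD by auto
  ultimately have "(\<lambda>j. measure M {s\<in>space M. 1 / real (Suc k) \<le> norm (r (B (g j)) s)}) \<longlonglongrightarrow> 0"
    by (intro norm_tendsto_disjoint) auto
  then have "\<forall>\<^sub>F j in sequentially. measure M {s\<in>space M. 1 / real (Suc k) \<le> norm (r (B (g j)) s)} < 1 / real (Suc k)"
    by (rule order_tendstoD(2)) simp
  then obtain j where "measure M {s\<in>space M. 1 / real (Suc k) \<le> norm (r (B (g j)) s)} < 1 / real (Suc k)"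
    by (auto simp: eventually_sequentially)
  with B(3)[OF gD(1)[of j]] gD(2)[of j] show False by simp
qed

text \<open>Absolute continuity with respect to the ideal of null sets.\<close>

definition continuous_measure :: "'e measure \<Rightarrow> bool" where
  "continuous_measure \<nu> \<longleftrightarrow> space \<nu> = E \<and> sets \<nu> = \<E> \<and> finite_measure \<nu> \<and>
     (\<forall>A. null A \<longrightarrow> emeasure \<nu> A = 0)"

text \<open>A functional is chosen that detects a nonzero \<open>r B\<close> with \<open>B\<close>
  inside \<open>A\<close>, and the scalar theorem is applied to the measure concentrated on
  \<open>B\<close>. The resulting measure vanishes on \<open>E - A\<close>, so its positive mass
  lies in \<open>A\<close>.\<close>

lemma exists_continuous_measure_nonnull:
  assumes A: "A \<in> \<E>" "\<not> null A"
  obtains \<nu> where "continuous_measure \<nu>" "emeasure \<nu> A \<noteq> 0"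
proof -
  obtain B where B: "B \<in> \<E>" "B \<subseteq> A" "\<not> (AE s in M. r B s = 0)" using A by (auto simp: null_def)
  obtain \<phi> :: "'z \<Rightarrow> real" where \<phi>: "linear \<phi>" "\<And>z. \<bar>\<phi> z\<bar> \<le> norm z" "\<not> (AE s in M. \<phi> (r B s) = 0)"
    by (rule strongly_measurable_functional_nonzero[OF strong[OF B(1)] B(3)]) blast
  interpret S: scalar_L0_measure M E \<E> "\<lambda>A s. \<phi> (r (A \<inter> B) s)"
    by (rule scalar_L0_measure_functional[OF \<phi>(1,2) B(1)])
  have EB: "E \<inter> B = B" using sets_into_space[OF B(1)] by auto
  obtain \<nu> where \<nu>: "space \<nu> = E" "sets \<nu> = \<E>" "finite_measure \<nu>" "0 < emeasure \<nu> E"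
    "\<And>A. A \<in> \<E> \<Longrightarrow> (\<And>C. C \<in> \<E> \<Longrightarrow> C \<subseteq> A \<Longrightarrow> AE s in M. \<phi> (r (C \<inter> B) s) = 0) \<Longrightarrow> emeasure \<nu> A = 0"
    by (rule S.exists_nonzero_continuous_measure) (use \<phi>(3) EB in auto)
  show ?thesis
  proof (rule that[of \<nu>])
    show "continuous_measure \<nu>"
      unfolding continuous_measure_def
    proof (intro conjI allI impI \<nu>(1-3))
      fix A' assume A': "null A'"
      show "emeasure \<nu> A' = 0"
      proof (rule \<nu>(5))
        show "A' \<in> \<E>" using A' by (simp add: null_def)
        fix C assume C: "C \<in> \<E>" "C \<subseteq> A'"
        then have "C \<inter> B \<in> \<E>" "C \<inter> B \<subseteq> A'" using B(1) by auto
        then have "AE s in M. r (C \<inter> B) s = 0" using A' unfolding null_def by blast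
        then show "AE s in M. \<phi> (r (C \<inter> B) s) = 0" by eventually_elim (simp add: linear_0[OF \<phi>(1)])
      qed
    qed
    have 0: "emeasure \<nu> (E - A) = 0"
    proof (rule \<nu>(5))
      fix C assume C: "C \<in> \<E>" "C \<subseteq> E - A"
      then have "C \<inter> B = {}" using B(2) by auto
      then show "AE s in M. \<phi> (r (C \<inter> B) s) = 0" using S.AE_empty by simp
    qed (use A in auto)
    show "emeasure \<nu> A \<noteq> 0"
    proof
      assume "emeasure \<nu> A = 0"
      then have "emeasure \<nu> (A \<union> (E - A)) = 0"
        using 0 A by (subst emeasure_Un_null_set) (auto simp: null_sets_def \<nu>(2))
      moreover have "A \<union> (E - A) = E" using sets_into_space[OF A(1)] by auto
      ultimately show False using \<nu>(4) by simp
    qed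
  qed
qed

text \<open>A nonzero value at the empty set would be seen by some functional, against the scalar
  case.\<close>

lemma empty_null: "null {}"
proof -
  have "AE s in M. r {} s = 0"
  proof (rule ccontr)
    assume nz: "\<not> ?thesis"
    obtain \<phi> :: "'z \<Rightarrow> real" where \<phi>: "linear \<phi>" "\<And>z. \<bar>\<phi> z\<bar> \<le> norm z" "\<not> (AE s in M. \<phi> (r {} s) = 0)"
      by (rule strongly_measurable_functional_nonzero[OF strong[OF empty_sets] nz]) blast
    interpret S: scalar_L0_measure M E \<E> "\<lambda>A s. \<phi> (r (A \<inter> {}) s)"
      by (rule scalar_L0_measure_functional[OF \<phi>(1,2) empty_sets])
    show False using S.AE_empty \<phi>(3) by simp
  qed
  then show ?thesis by (simp add: null_def)
qed

definition good :: "'e set \<Rightarrow> bool" where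
  "good D \<longleftrightarrow> (\<exists>\<nu>. continuous_measure \<nu> \<and> (\<forall>C\<in>\<E>. C \<subseteq> D \<longrightarrow> emeasure \<nu> C = 0 \<longrightarrow> null C))"

text \<open>A measure charging \<open>A\<close> may still vanish on non-null subsets. A maximal
  disjoint family of these is countable, so removing it costs no mass: the rest is still charged,
  hence non-null, and contains no further such subset by maximality.\<close>

lemma exists_good_subset:
  assumes A: "A \<in> \<E>" "\<not> null A"
  obtains D where "D \<in> \<E>" "D \<subseteq> A" "\<not> null D" "good D"
proof -
  obtain \<nu> where \<nu>: "continuous_measure \<nu>" "emeasure \<nu> A \<noteq> 0"
    using exists_continuous_measure_nonnull[OF A] by blast
  have sets: "sets \<nu> = \<E>" using \<nu>(1) by (simp add: continuous_measure_def)
  define P where "P = {C\<in>\<E>. C \<subseteq> A \<and> emeasure \<nu> C = 0 \<and> \<not> null C}"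
  obtain \<D> where \<D>: "\<D> \<subseteq> P" "countable \<D>" "disjoint \<D>" "\<And>C. C \<in> P \<Longrightarrow> C \<inter> \<Union>\<D> \<noteq> {}"
  proof (rule countable_maximal_disjoint[of P])
    show "countable D" if "D \<subseteq> P" "disjoint D" for D
      using that by (intro countable_disjoint_nonnull) (auto simp: P_def)
    show "{} \<notin> P" using empty_null by (simp add: P_def)
  qed blast
  have "(\<Union>C\<in>\<D>. C) \<in> null_sets \<nu>"
    using \<D>(1,2) by (intro null_sets_UN') (auto simp: P_def null_sets_def sets)
  then have U: "\<Union>\<D> \<in> \<E>" "emeasure \<nu> (\<Union>\<D>) = 0" by (auto simp: null_sets_def sets)
  have D: "A - \<Union>\<D> \<in> \<E>" using A U by auto
  show ?thesis
  proof (rule that[OF D])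
    have "emeasure \<nu> (A - \<Union>\<D>) = emeasure \<nu> A"
      using U A by (intro emeasure_Diff_null_set) (auto simp: null_sets_def sets)
    with \<nu> show "\<not> null (A - \<Union>\<D>)" by (auto simp: continuous_measure_def)
    show "good (A - \<Union>\<D>)"
      unfolding good_def
    proof (intro exI[of _ \<nu>] conjI \<nu>(1) ballI impI)
      fix C assume C: "C \<in> \<E>" "C \<subseteq> A - \<Union>\<D>" "emeasure \<nu> C = 0"
      show "null C"
      proof (rule ccontr)
        assume "\<not> null C"
        then have "C \<inter> \<Union>\<D> \<noteq> {}" using C by (intro \<D>(4)) (auto simp: P_def)
        with C(2) show False by auto
      qed
    qed
  qed auto
qed

text \<open>A maximal disjoint family of good non-null sets leaves only a null remainder, since a
  non-null one would contain another good set. The countably many local measures are added up, and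
  null pieces are put together by countable unions.\<close>

theorem exists_control_measure:
  obtains \<rho> where "space \<rho> = E" "sets \<rho> = \<E>" "finite_measure \<rho>"
    and "\<And>A. A \<in> \<E> \<Longrightarrow> emeasure \<rho> A = 0 \<Longrightarrow> null A"
proof -
  define P where "P = {D\<in>\<E>. \<not> null D \<and> good D}"
  obtain \<D> where \<D>: "\<D> \<subseteq> P" "countable \<D>" "disjoint \<D>" "\<And>C. C \<in> P \<Longrightarrow> C \<inter> \<Union>\<D> \<noteq> {}"
  proof (rule countable_maximal_disjoint[of P])
    show "countable D" if "D \<subseteq> P" "disjoint D" for D
      using that by (intro countable_disjoint_nonnull) (auto simp: P_def)
    show "{} \<notin> P" using empty_null by (simp add: P_def)
  qed blast
  have U: "\<Union>\<D> \<in> \<E>" using \<D>(1,2) by (intro countable_Union) (auto simp: P_def)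
  have rest: "null (E - \<Union>\<D>)"
  proof (rule ccontr)
    assume "\<not> null (E - \<Union>\<D>)"
    then obtain D where D: "D \<in> \<E>" "D \<subseteq> E - \<Union>\<D>" "\<not> null D" "good D"
      using exists_good_subset[of "E - \<Union>\<D>"] U by blast
    then have "D \<inter> \<Union>\<D> \<noteq> {}" by (intro \<D>(4)) (auto simp: P_def)
    with D(2) show False by auto
  qed
  \<comment> \<open>Adding the remainder makes the family nonempty, so that
    \<open>from_nat_into\<close> enumerates it even if it is finite, and lets the enumeration cover
    \<open>E\<close>. On the null remainder the zero measure is a control measure.\<close>
  define D where "D = from_nat_into (insert (E - \<Union>\<D>) \<D>)"
  have range_D: "range D = insert (E - \<Union>\<D>) \<D>"
    unfolding D_def using \<D>(2) by (intro range_from_nat_into) auto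
  have good_rest: "good (E - \<Union>\<D>)"
    unfolding good_def
  proof (intro exI[of _ "null_measure (sigma E \<E>)"] conjI ballI impI)
    show "continuous_measure (null_measure (sigma E \<E>))"
      by (auto simp: continuous_measure_def space_measure_of_conv intro!: finite_measureI)
    show "null C" if "C \<in> \<E>" "C \<subseteq> E - \<Union>\<D>" for C using null_subset[OF rest that] .
  qed
  have "good (D i)" for i
    using range_D \<D>(1) good_rest by (metis (mono_tags, lifting) P_def insertE mem_Collect_eq rangeI subsetD)
  then obtain \<nu> where \<nu>: "\<And>i. continuous_measure (\<nu> i)"
    "\<And>i C. C \<in> \<E> \<Longrightarrow> C \<subseteq> D i \<Longrightarrow> emeasure (\<nu> i) C = 0 \<Longrightarrow> null C"
    unfolding good_def by metis
  obtain \<rho> where \<rho>: "space \<rho> = E" "sets \<rho> = \<E>" "finite_measure \<rho>"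
    "\<And>A i. A \<in> \<E> \<Longrightarrow> emeasure \<rho> A = 0 \<Longrightarrow> emeasure (\<nu> i) A = 0"
    by (rule countable_sum_of_measures[of E \<E> \<nu>])
      (use \<nu>(1) sigma_algebra_axioms in \<open>auto simp: continuous_measure_def\<close>)
  show ?thesis
  proof (rule that[OF \<rho>(1-3)])
    fix A assume A: "A \<in> \<E>" "emeasure \<rho> A = 0"
    have Dm: "D i \<in> \<E>" for i
    proof -
      have "D i \<in> insert (E - \<Union>\<D>) \<D>" using range_D by auto
      then show ?thesis using U \<D>(1) by (auto simp: P_def)
    qed
    have "null (A \<inter> D i)" for i
    proof (rule \<nu>(2)[of _ i])
      have s: "sets (\<nu> i) = \<E>" using \<nu>(1)[of i] by (simp add: continuous_measure_def)
      have "emeasure (\<nu> i) (A \<inter> D i) \<le> emeasure (\<nu> i) A" using A s by (intro emeasure_mono) auto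
      then show "emeasure (\<nu> i) (A \<inter> D i) = 0" using \<rho>(4)[OF A] by simp
    qed (use A Dm in auto)
    then have "null (\<Union>i. A \<inter> D i)" by (rule null_UN)
    moreover have "(\<Union>i. A \<inter> D i) = A"
    proof -
      have "\<Union>(range D) = E" using range_D sets_into_space[OF U] by auto
      then show ?thesis using sets_into_space[OF A(1)] by auto
    qed
    ultimately show "null A" by simp
  qed
qed

end

section \<open>Passage to equivalence classes\<close>

lemma L0_psum_class:
  assumes "\<And>i. bochner_measurable M (g i)" "\<And>i. F i = L0_class M (g i)"
  shows "bochner_measurable M (\<lambda>s. \<Sum>i<n. g i s) \<and> L0_psum M F n = L0_class M (\<lambda>s. \<Sum>i<n. g i s)"
proof (induction n)
  case 0
  then show ?case by (simp add: bochner_measurable_zero L0_zero_def)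
next
  case (Suc n)
  then show ?case
    using bochner_measurable_add[of M "\<lambda>s. \<Sum>i<n. g i s" "g n"] assms
    by (simp add: L0_add_class)
qed

theorem theorem3p3:
  fixes M :: "'s measure"
    and E :: "'e set" and \<E> :: "'e set set"
    and m :: "'e set \<Rightarrow> ('s \<Rightarrow> 'z::banach) set"
  assumes "finite_measure M"
    and "sigma_algebra E \<E>"
    and "L0_vector_measure M \<E> m"
  shows "\<exists>\<nu> :: 'e measure. space \<nu> = E \<and> sets \<nu> = \<E> \<and> finite_measure \<nu> \<and>
           (\<forall>A\<in>\<E>. emeasure \<nu> A = 0 \<longrightarrow> m A = L0_zero M)"
proof -
  interpret finite_measure M by fact
  interpret sigma_algebra E \<E> by fact
  have "\<exists>g. strongly_measurable M g \<and> m A = L0_class M g" if "A \<in> \<E>" for A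
  proof -
    have "m A \<in> L0 M" using assms(3) that by (simp add: L0_vector_measure_def)
    then obtain f where f: "bochner_measurable M f" "m A = L0_class M f" by (rule L0_E)
    obtain g where g: "strongly_measurable M g" "AE s in M. f s = g s"
      using bochner_measurable_strong_version[OF f(1)] by blast
    then have "m A = L0_class M g"
      using f L0_class_eq_iff[OF f(1) strongly_measurable_imp_bochner[OF g(1)]] by simp
    with g show ?thesis by blast
  qed
  then obtain r where r: "\<And>A. A \<in> \<E> \<Longrightarrow> strongly_measurable M (r A)" "\<And>A. A \<in> \<E> \<Longrightarrow> m A = L0_class M (r A)"
    by metis
  have rb: "bochner_measurable M (r A)" if "A \<in> \<E>" for A
    by (rule strongly_measurable_imp_bochner[OF r(1)[OF that]])
  interpret strong_L0_measure M E \<E> r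
  proof unfold_locales
    show "strongly_measurable M (r A)" if "A \<in> \<E>" for A using r(1)[OF that] .
    fix B :: "nat \<Rightarrow> 'e set" and \<delta> :: real
    assume B: "range B \<subseteq> \<E>" "disjoint_family B" and \<delta>: "0 < \<delta>"
    have Bi: "B i \<in> \<E>" for i using B by auto
    have BU: "(\<Union>i. B i) \<in> \<E>" using Bi by auto
    let ?d = "\<lambda>n s. (\<Sum>i<n. r (B i) s) - r (\<Union>i. B i) s"
    have ds: "strongly_measurable M (?d n)" for n
      by (intro strongly_measurable_diff strongly_measurable_sum r(1) Bi BU)
    have dsets: "{s\<in>space M. t \<le> norm (?d n s)} \<in> sets M" for t n
      using borel_measurable_norm_strongly[OF ds[of n]] by measurable
    have "L0_diff M (L0_psum M (\<lambda>i. m (B i)) n) (m (\<Union>i. B i)) = L0_class M (?d n)" for n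
      using L0_psum_class[of M "\<lambda>i. r (B i)" "\<lambda>i. m (B i)" n] rb[OF Bi] r(2)[OF Bi] rb[OF BU] r(2)[OF BU]
      by (simp add: L0_diff_class)
    then have eq: "L0_norm M (L0_diff M (L0_psum M (\<lambda>i. m (B i)) n) (m (\<Union>i. B i))) = in_measure_norm M (?d n)" for n
      using L0_norm_class[OF strongly_measurable_imp_bochner[OF ds[of n]]] by simp
    have "L0_tendsto M (L0_psum M (\<lambda>i. m (B i))) (m (\<Union>i. B i))"
      using assms(3) B unfolding L0_vector_measure_def by blast
    then have lim: "(\<lambda>n. in_measure_norm M (?d n)) \<longlonglongrightarrow> 0"
      unfolding L0_tendsto_def eq .
    show "(\<lambda>n. measure M {s\<in>space M. \<delta> \<le> norm (?d n s)}) \<longlonglongrightarrow> 0"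
    proof (rule LIMSEQ_I)
      fix e :: real assume e: "0 < e"
      \<comment> \<open>One number serves as threshold and as bound: an F-norm below
        \<open>t\<close> bounds the measure at threshold \<open>t\<close> by \<open>t\<close>. Here
        \<open>t \<le> \<delta>\<close> passes this to threshold \<delta>, and
        \<open>t \<le> e / 2\<close> makes it less than \<open>e\<close>.\<close>
      define t where "t = min \<delta> (e / 2)"
      have t: "0 < t" "t \<le> \<delta>" "t < e" using e \<delta> by (auto simp: t_def)
      have "\<forall>\<^sub>F n in sequentially. in_measure_norm M (?d n) < t"
        using lim t(1) by (rule order_tendstoD(2))
      then obtain n0 where n0: "\<And>n. n0 \<le> n \<Longrightarrow> in_measure_norm M (?d n) < t"
        by (auto simp: eventually_sequentially)
      have "norm (measure M {s\<in>space M. \<delta> \<le> norm (?d n s)} - 0) < e" if "n0 \<le> n" for n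
      proof -
        have "ennreal (measure M {s\<in>space M. t \<le> norm (?d n s)}) \<le> ennreal t"
          using outer_measure_of_less_in_measure_norm[OF assms(1) n0[OF that]] dsets[of t n]
          by (simp add: emeasure_eq_measure)
        then have "measure M {s\<in>space M. t \<le> norm (?d n s)} \<le> t" using t by simp
        moreover have "measure M {s\<in>space M. \<delta> \<le> norm (?d n s)} \<le> measure M {s\<in>space M. t \<le> norm (?d n s)}"
          using t by (intro finite_measure_mono dsets) auto
        ultimately show ?thesis using t by simp
      qed
      then show "\<exists>n0. \<forall>n\<ge>n0. norm (measure M {s\<in>space M. \<delta> \<le> norm (?d n s)} - 0) < e" by blast
    qed
  qed
  obtain \<rho> where \<rho>: "space \<rho> = E" "sets \<rho> = \<E>" "finite_measure \<rho>"
    "\<And>A. A \<in> \<E> \<Longrightarrow> emeasure \<rho> A = 0 \<Longrightarrow> null A"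
    using exists_control_measure by blast
  have "m A = L0_zero M" if A: "A \<in> \<E>" "emeasure \<rho> A = 0" for A
  proof -
    have "AE s in M. r A s = 0" using \<rho>(4)[OF A] A(1) by (auto simp: null_def)
    then show ?thesis
      unfolding L0_zero_def r(2)[OF A(1)] by (subst L0_class_eq_iff) (auto intro: rb A bochner_measurable_zero)
  qed
  then show ?thesis using \<rho>(1-3) by blast
qed

end
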